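(* Suppose that the following statement (C) holds. (C): For every odd prime power $q$, every $b\in\mathbb{F}_{q^2}$ with $b^{q+1}=-1$, and every $(s,u,w)\in\mathbb{F}_{q^2}^3\setminus\{(0,0,0)\}$ with $s^{q+1}=u^{q+1}+w^{q+1}$, one has $n(\kappa)=n(-\kappa)$ for all $\kappa\in\mathbb{F}_q^*$, where $n(\kappa)$ denotes the number of $\lambda\in\mathbb{F}_{q^2}\cup\{\infty\}$ such that \[(w \lambda+1)(b+u \lambda)^q-(w \lambda+1)^q (b+u \lambda)=\kappa \left(b^2+1+\lambda^2 \left(s^2-u^2-w^2\right)\right)^{(q+1)/2}.\] Let $q$ be an odd prime power. Then $\mathrm{P\Gamma U}(5,q)$, in its action on the set of totally isotropic $1$-spaces, is non-spreading.
   Context: In (C), the equation at $\lambda=\infty$ is understood by homogenising, i.e. comparing the coefficients of $\lambda^{q+1}$: it reads $wu^q-w^qu=\kappa(s^2-u^2-w^2)^{(q+1)/2}$. $\mathrm{P\Gamma U}(5,q)$ is the collineation group (projective semisimilarity group) of the Hermitian polar space $\mathsf{H}(4,q^2)$, defined by a non-degenerate Hermitian form on $\mathbb{F}_{q^2}^5$; it acts on the set of totally isotropic 1-dimensional subspaces. Multisets on $\Omega$ are functions $\Omega\to\mathbb{Z}_{\ge 0}$ (multiplicities), sets are identified with characteristic functions, $|X|$ is the sum of multiplicities, and $(X\star Y)(i)=X(i)Y(i)$. A multiset (or set) is trivial if it is constant or only one element has nonzero multiplicity. A transitive permutation group $G$ on a finite set $\Omega$ is non-spreading if there exist a nontrivial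 multiset $X$ and a nontrivial set $Y$ on $\Omega$ such that $|X|$ divides $|\Omega|$ and $|X\star Y^g|$ is constant for all $g\in G$. *)

theory Defs
  imports "HOL-Library.Indicator_Function" "HOL-Number_Theory.Prime_Powers" "HOL-Algebra.Algebra"
begin

section \<open>The finite field of order \<open>q\<^sup>2\<close> and the condition on \<open>n(\<kappa>)\<close>\<close>

definition field_of_order :: "('a, 'm) ring_scheme \<Rightarrow> nat \<Rightarrow> bool" where
  "field_of_order K n \<longleftrightarrow> field K \<and> finite (carrier K) \<and> card (carrier K) = n"

text \<open>The subfield of order \<open>q\<close> of a field \<open>K\<close> of order \<open>q\<^sup>2\<close> consists of the fixed points of
  \<open>x \<mapsto> x\<^sup>q\<close>.\<close>

definition Fq_units :: "('a, 'm) ring_scheme \<Rightarrow> nat \<Rightarrow> 'a set" where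
  "Fq_units K q = {x \<in> carrier K. x [^]\<^bsub>K\<^esub> q = x} - {\<zero>\<^bsub>K\<^esub>}"

text \<open>The point at infinity is \<open>None\<close>; its equation compares the coefficients of
  \<open>\<lambda>\<^bsup>q+1\<^esup>\<close> on both sides of the equation for \<open>Some \<lambda>\<close>.\<close>

fun kappa_equation ::
  "('a, 'm) ring_scheme \<Rightarrow> nat \<Rightarrow> 'a \<Rightarrow> 'a \<Rightarrow> 'a \<Rightarrow> 'a \<Rightarrow> 'a \<Rightarrow> 'a option \<Rightarrow> bool" where
  "kappa_equation K q b s u w \<kappa> (Some l) \<longleftrightarrow>
     ((w \<otimes>\<^bsub>K\<^esub> l \<oplus>\<^bsub>K\<^esub> \<one>\<^bsub>K\<^esub>) \<otimes>\<^bsub>K\<^esub> (b \<oplus>\<^bsub>K\<^esub> u \<otimes>\<^bsub>K\<^esub> l) [^]\<^bsub>K\<^esub> q)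
       \<ominus>\<^bsub>K\<^esub> ((w \<otimes>\<^bsub>K\<^esub> l \<oplus>\<^bsub>K\<^esub> \<one>\<^bsub>K\<^esub>) [^]\<^bsub>K\<^esub> q \<otimes>\<^bsub>K\<^esub> (b \<oplus>\<^bsub>K\<^esub> u \<otimes>\<^bsub>K\<^esub> l))
     = \<kappa> \<otimes>\<^bsub>K\<^esub> ((b [^]\<^bsub>K\<^esub> (2::nat) \<oplus>\<^bsub>K\<^esub> \<one>\<^bsub>K\<^esub>) \<oplus>\<^bsub>K\<^esub>
         l [^]\<^bsub>K\<^esub> (2::nat) \<otimes>\<^bsub>K\<^esub>
           (s [^]\<^bsub>K\<^esub> (2::nat) \<ominus>\<^bsub>K\<^esub> u [^]\<^bsub>K\<^esub> (2::nat) \<ominus>\<^bsub>K\<^esub> w [^]\<^bsub>K\<^esub> (2::nat)))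
         [^]\<^bsub>K\<^esub> ((q + 1) div 2)"
| "kappa_equation K q b s u w \<kappa> None \<longleftrightarrow>
     (w \<otimes>\<^bsub>K\<^esub> u [^]\<^bsub>K\<^esub> q) \<ominus>\<^bsub>K\<^esub> (w [^]\<^bsub>K\<^esub> q \<otimes>\<^bsub>K\<^esub> u)
     = \<kappa> \<otimes>\<^bsub>K\<^esub>
         (s [^]\<^bsub>K\<^esub> (2::nat) \<ominus>\<^bsub>K\<^esub> u [^]\<^bsub>K\<^esub> (2::nat) \<ominus>\<^bsub>K\<^esub> w [^]\<^bsub>K\<^esub> (2::nat))
         [^]\<^bsub>K\<^esub> ((q + 1) div 2)"

definition kappa_count ::
  "('a, 'm) ring_scheme \<Rightarrow> nat \<Rightarrow> 'a \<Rightarrow> 'a \<Rightarrow> 'a \<Rightarrow> 'a \<Rightarrow> 'a \<Rightarrow> nat" where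
  "kappa_count K q b s u w \<kappa> =
     card {l \<in> insert None (Some ` carrier K). kappa_equation K q b s u w \<kappa> l}"

text \<open>Every finite field is isomorphic to one whose carrier is a set of natural numbers, so
  quantifying over \<^typ>\<open>nat ring\<close> covers the field of order \<open>q\<^sup>2\<close> for every \<open>q\<close>.\<close>

definition condition_C :: bool where
  "condition_C \<longleftrightarrow>
     (\<forall>q (K :: nat ring). primepow q \<longrightarrow> odd q \<longrightarrow> field_of_order K (q\<^sup>2) \<longrightarrow>
       (\<forall>b \<in> carrier K. \<forall>s \<in> carrier K. \<forall>u \<in> carrier K. \<forall>w \<in> carrier K.
          b [^]\<^bsub>K\<^esub> (q + 1) = \<ominus>\<^bsub>K\<^esub> \<one>\<^bsub>K\<^esub> \<longrightarrow>
          (s, u, w) \<noteq> (\<zero>\<^bsub>K\<^esub>, \<zero>\<^bsub>K\<^esub>, \<zero>\<^bsub>K\<^esub>) \<longrightarrow>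
          s [^]\<^bsub>K\<^esub> (q + 1) = u [^]\<^bsub>K\<^esub> (q + 1) \<oplus>\<^bsub>K\<^esub> w [^]\<^bsub>K\<^esub> (q + 1) \<longrightarrow>
          (\<forall>\<kappa> \<in> Fq_units K q.
             kappa_count K q b s u w \<kappa> = kappa_count K q b s u w (\<ominus>\<^bsub>K\<^esub> \<kappa>))))"


section \<open>Hermitian polar spaces\<close>

text \<open>\<open>K\<^sup>n\<close> with pointwise operations; the record type also asks for a multiplication and a
  unit, for which we take the pointwise ones.\<close>

definition coord_space :: "('a, 'm) ring_scheme \<Rightarrow> nat \<Rightarrow> ('a, nat \<Rightarrow> 'a) module" where
  "coord_space K n =
     \<lparr>carrier = {..<n} \<rightarrow>\<^sub>E carrier K,
      monoid.mult = (\<lambda>x y. \<lambda>i\<in>{..<n}. x i \<otimes>\<^bsub>K\<^esub> y i),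
      one = (\<lambda>i\<in>{..<n}. \<one>\<^bsub>K\<^esub>),
      ring.zero = (\<lambda>i\<in>{..<n}. \<zero>\<^bsub>K\<^esub>),
      add = (\<lambda>x y. \<lambda>i\<in>{..<n}. x i \<oplus>\<^bsub>K\<^esub> y i),
      smult = (\<lambda>c x. \<lambda>i\<in>{..<n}. c \<otimes>\<^bsub>K\<^esub> x i)\<rparr>"

text \<open>Here \<open>K\<close> is a field of order \<open>q\<^sup>2\<close>, whose involution is \<open>x \<mapsto> x\<^sup>q\<close>. Semilinearity in the
  second argument follows from the last clause.\<close>

definition hermitian_form ::
  "('a, 'm) ring_scheme \<Rightarrow> nat \<Rightarrow> ('a, 'v, 'n) module_scheme \<Rightarrow> ('v \<Rightarrow> 'v \<Rightarrow> 'a) \<Rightarrow> bool" where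
  "hermitian_form K q V h \<longleftrightarrow>
     (\<forall>x \<in> carrier V. \<forall>y \<in> carrier V. h x y \<in> carrier K) \<and>
     (\<forall>x \<in> carrier V. \<forall>y \<in> carrier V. \<forall>z \<in> carrier V.
        h (x \<oplus>\<^bsub>V\<^esub> y) z = h x z \<oplus>\<^bsub>K\<^esub> h y z) \<and>
     (\<forall>c \<in> carrier K. \<forall>x \<in> carrier V. \<forall>y \<in> carrier V.
        h (c \<odot>\<^bsub>V\<^esub> x) y = c \<otimes>\<^bsub>K\<^esub> h x y) \<and>
     (\<forall>x \<in> carrier V. \<forall>y \<in> carrier V. h y x = h x y [^]\<^bsub>K\<^esub> q)"

definition nondegenerate ::
  "('a, 'm) ring_scheme \<Rightarrow> ('a, 'v, 'n) module_scheme \<Rightarrow> ('v \<Rightarrow> 'v \<Rightarrow> 'a) \<Rightarrow> bool" where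
  "nondegenerate K V h \<longleftrightarrow>
     (\<forall>x \<in> carrier V. (\<forall>y \<in> carrier V. h x y = \<zero>\<^bsub>K\<^esub>) \<longrightarrow> x = \<zero>\<^bsub>V\<^esub>)"

definition one_spaces ::
  "('a, 'm) ring_scheme \<Rightarrow> ('a, 'v, 'n) module_scheme \<Rightarrow> 'v set set" where
  "one_spaces K V = {{c \<odot>\<^bsub>V\<^esub> v | c. c \<in> carrier K} | v. v \<in> carrier V - {\<zero>\<^bsub>V\<^esub>}}"

definition isotropic_one_spaces ::
  "('a, 'm) ring_scheme \<Rightarrow> ('a, 'v, 'n) module_scheme \<Rightarrow> ('v \<Rightarrow> 'v \<Rightarrow> 'a) \<Rightarrow> 'v set set" where
  "isotropic_one_spaces K V h =
     {U \<in> one_spaces K V. \<forall>x \<in> U. \<forall>y \<in> U. h x y = \<zero>\<^bsub>K\<^esub>}"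

definition semisimilarity ::
  "('a, 'm) ring_scheme \<Rightarrow> ('a, 'v, 'n) module_scheme \<Rightarrow> ('v \<Rightarrow> 'v \<Rightarrow> 'a) \<Rightarrow> ('v \<Rightarrow> 'v) \<Rightarrow> bool" where
  "semisimilarity K V h g \<longleftrightarrow>
     bij_betw g (carrier V) (carrier V) \<and>
     (\<forall>x \<in> carrier V. \<forall>y \<in> carrier V. g (x \<oplus>\<^bsub>V\<^esub> y) = g x \<oplus>\<^bsub>V\<^esub> g y) \<and>
     (\<exists>\<sigma> \<in> ring_iso K K. \<exists>\<alpha> \<in> carrier K - {\<zero>\<^bsub>K\<^esub>}.
        (\<forall>c \<in> carrier K. \<forall>x \<in> carrier V. g (c \<odot>\<^bsub>V\<^esub> x) = \<sigma> c \<odot>\<^bsub>V\<^esub> g x) \<and>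
        (\<forall>x \<in> carrier V. \<forall>y \<in> carrier V. h (g x) (g y) = \<alpha> \<otimes>\<^bsub>K\<^esub> \<sigma> (h x y)))"

text \<open>The projective semisimilarity group, i.e. the semisimilarities modulo scalars, realised by
  the permutations of the points of the projective space that they induce.\<close>

definition PGammaU ::
  "('a, 'm) ring_scheme \<Rightarrow> ('a, 'v, 'n) module_scheme \<Rightarrow> ('v \<Rightarrow> 'v \<Rightarrow> 'a)
     \<Rightarrow> ('v set \<Rightarrow> 'v set) monoid" where
  "PGammaU K V h =
     (BijGroup (one_spaces K V))
       \<lparr>carrier := {(\<lambda>U \<in> one_spaces K V. g ` U) | g. semisimilarity K V h g}\<rparr>"


section \<open>Non-spreading group actions\<close>

definition trivial_multiset_on :: "'p set \<Rightarrow> ('p \<Rightarrow> nat) \<Rightarrow> bool" where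
  "trivial_multiset_on \<Omega> M \<longleftrightarrow>
     (\<exists>c. \<forall>i \<in> \<Omega>. M i = c) \<or> (\<exists>!i. i \<in> \<Omega> \<and> M i \<noteq> 0)"

text \<open>Stated for a transitive action \<open>act\<close> of \<open>G\<close>; the property depends only on the transitive
  permutation group \<open>act ` carrier G\<close> on \<open>\<Omega>\<close>. The translate \<open>Y\<^sup>g\<close> is the image \<open>act g ` Y\<close>.\<close>

definition non_spreading ::
  "('g, 'm) monoid_scheme \<Rightarrow> 'p set \<Rightarrow> ('g \<Rightarrow> 'p \<Rightarrow> 'p) \<Rightarrow> bool" where
  "non_spreading G \<Omega> act \<longleftrightarrow>
     finite \<Omega> \<and> transitive_action G \<Omega> act \<and>
     (\<exists>(M :: 'p \<Rightarrow> nat) Y.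
        Y \<subseteq> \<Omega> \<and>
        \<not> trivial_multiset_on \<Omega> M \<and>
        \<not> trivial_multiset_on \<Omega> (indicator Y) \<and>
        (\<Sum>i\<in>\<Omega>. M i) dvd card \<Omega> \<and>
        (\<exists>c. \<forall>g \<in> carrier G. (\<Sum>i\<in>\<Omega>. M i * indicator (act g ` Y) i) = c))"

end

theory Submission
  imports Defs "HOL-Decision_Procs.Commutative_Ring" "HOL-Library.Reflection"
begin

text \<open>Choose coordinates in which the Hermitian form is \<open>x\<^sub>1 y\<^sub>2\<^sup>q + x\<^sub>2 y\<^sub>1\<^sup>q + x\<^sub>3 y\<^sub>4\<^sup>q + x\<^sub>4 y\<^sub>3\<^sup>q + 2 x\<^sub>5 y\<^sub>5\<^sup>q\<close>,
  and put \<open>Q = x\<^sub>1 x\<^sub>2 + x\<^sub>3 x\<^sub>4 + x\<^sub>5\<^sup>2\<close> and \<open>N = x\<^sub>1 x\<^sub>3\<^sup>q - x\<^sub>1\<^sup>q x\<^sub>3\<close>. Both \<open>N\<close> and \<open>Q\<^bsup>(q+1)/2\<^esup>\<close> are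
  multiplied by \<open>c\<^bsup>q+1\<^esup>\<close> when the vector is multiplied by \<open>c\<close>, so the sets \<open>S\<^sub>\<kappa>\<close> of points with
  \<open>N = \<kappa> Q\<^bsup>(q+1)/2\<^esup>\<close> are well defined. For a suitable \<open>\<kappa>\<close>, the set \<open>Y\<close> is a totally isotropic line
  and the multiset is \<open>1 + S\<^sub>\<kappa> - S\<^sub>-\<^sub>\<kappa>\<close>. Exchanging \<open>x\<^sub>1\<close> with \<open>x\<^sub>3\<close> and \<open>x\<^sub>2\<close> with \<open>x\<^sub>4\<close> negates \<open>N\<close> and
  fixes \<open>Q\<close>, so the multiset has size \<open>|\<Omega>|\<close>.

  Condition (C) says that \<open>S\<^sub>\<kappa>\<close> and \<open>S\<^sub>-\<^sub>\<kappa>\<close> meet every totally isotropic line \<open>\<ell>\<close> in equally many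
  points. If some point \<open>\<langle>v\<rangle>\<close> of \<open>\<ell>\<close> has \<open>N \<noteq> 0\<close> and lies in one of the two sets, then \<open>Q v\<close> is a
  nonsquare, and so is \<open>1 + b\<^sup>2\<close> for a fixed \<open>b \<notin> F\<^sub>q\<close> with \<open>b\<^bsup>q+1\<^esup> = -1\<close>; hence \<open>v\<close> can be scaled to
  \<open>Q v = 1 + b\<^sup>2\<close>. Let \<open>\<langle>y\<rangle>\<close> be the point of \<open>\<ell>\<close> orthogonal to \<open>v\<close> for the polar form of \<open>Q\<close>. A change of
  coordinates over \<open>F\<^sub>q\<close> that preserves both forms and multiplies \<open>N\<close> by a nonzero element of \<open>F\<^sub>q\<close>
  then takes \<open>v\<close> to \<open>(1, 1, b, b, 0)\<close>, which forces \<open>y = (w, -w, u, -u, s)\<close>, and the equations of (C)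
  are those of \<open>S\<^sub>\<kappa>\<close> on \<open>\<ell>\<close>.\<close>

section \<open>Reflection for commutative ring identities\<close>

text \<open>Method \<open>reify\<close> needs the expression as the first argument and the valuation right after it.\<close>

primrec polex_val :: "polex \<Rightarrow> 'a list \<Rightarrow> ('a, 'm) ring_scheme \<Rightarrow> 'a" where
  "polex_val (Var n) l R = l ! n"
| "polex_val (Const i) l R = of_integer R i"
| "polex_val (Add P Q) l R = polex_val P l R \<oplus>\<^bsub>R\<^esub> polex_val Q l R"
| "polex_val (Sub P Q) l R = polex_val P l R \<ominus>\<^bsub>R\<^esub> polex_val Q l R"
| "polex_val (Mul P Q) l R = polex_val P l R \<otimes>\<^bsub>R\<^esub> polex_val Q l R"
| "polex_val (Pow P n) l R = polex_val P l R [^]\<^bsub>R\<^esub> n"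
| "polex_val (Neg P) l R = \<ominus>\<^bsub>R\<^esub> polex_val P l R"

text \<open>Past the end of the list, \<open>!\<close> and \<open>head (drop n l)\<close> need not
  agree, so the two interpretations are compared only on expressions whose variables are in
  range.\<close>

primrec vars_below :: "polex \<Rightarrow> nat \<Rightarrow> bool" where
  "vars_below (Var n) k \<longleftrightarrow> n < k"
| "vars_below (Const i) k \<longleftrightarrow> True"
| "vars_below (Add P Q) k \<longleftrightarrow> vars_below P k \<and> vars_below Q k"
| "vars_below (Sub P Q) k \<longleftrightarrow> vars_below P k \<and> vars_below Q k"
| "vars_below (Mul P Q) k \<longleftrightarrow> vars_below P k \<and> vars_below Q k"
| "vars_below (Pow P n) k \<longleftrightarrow> vars_below P k"
| "vars_below (Neg P) k \<longleftrightarrow> vars_below P k"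

text \<open>Both sides of an equation are reified as one object, so that they share a single list of
  variables.\<close>

datatype polex_eq = Polex_Eq polex polex

primrec polex_eq_val :: "polex_eq \<Rightarrow> 'a list \<Rightarrow> ('a, 'm) ring_scheme \<Rightarrow> bool" where
  "polex_eq_val (Polex_Eq P Q) l R \<longleftrightarrow> polex_val P l R = polex_val Q l R"

context cring
begin

lemma head_drop: "n < length l \<Longrightarrow> head (drop n l) = l ! n"
  by (metis Cons_nth_drop_Suc head.simps(2))

lemma polex_val_eq_Ipolex: "vars_below P (length l) \<Longrightarrow> polex_val P l R = Ipolex l P"
  by (induct P) (auto simp: head_drop)

text \<open>Equality of normal forms is a computation on closed terms, settled by
  \<open>code_simp\<close>; what then remains are range and membership conditions.\<close>

lemma polex_eqI:
  assumes "norm P = norm Q" "vars_below P (length l) \<and> vars_below Q (length l)"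
    and "set l \<subseteq> carrier R"
  shows "polex_eq_val (Polex_Eq P Q) l R"
proof -
  have "Ipolex l P = Ipolex l Q"
    using assms by (intro norm_eq) (auto simp: in_carrier_def)
  with assms(2) show ?thesis
    by (simp add: polex_val_eq_Ipolex)
qed

lemma polex_val_Const: "polex_val (Const 0) l R = \<zero>" "polex_val (Const 1) l R = \<one>"
  by simp_all

text \<open>A subterm that matches none of the operations listed here, such as \<open>cj x\<close>,
  becomes a variable; hence \<open>cj\<close> has to be distributed over sums and products before
  reification.\<close>

lemmas polex_eqs =
  polex_val.simps(3-5)[where R = R] polex_val.simps(7)[where R = R] polex_val_Const
  polex_val.simps(1)[where R = R] polex_eq_val.simps[where R = R]

end

section \<open>Finite fields of square order\<close>

context cring
begin

text \<open>The induction step is Pascal's rule: each new term \<open>S (Suc i)\<close> splits into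
  \<open>x\<close> times an old term and \<open>U (Suc i)\<close>, which is \<open>y\<close> times
  an old term, while the surplus \<open>U (Suc n)\<close> vanishes.\<close>

lemma binomial_expansion:
  assumes x: "x \<in> carrier R" and y: "y \<in> carrier R"
  shows "(x \<oplus> y) [^] (n::nat) =
    (\<Oplus>i\<in>{..n}. \<guillemotleft>n choose i\<guillemotright>\<^sub>\<nat> \<otimes> (x [^] i \<otimes> y [^] (n - i)))"
proof (induct n)
  case 0
  then show ?case using x y by simp
next
  case (Suc n)
  define T where "T i = \<guillemotleft>n choose i\<guillemotright>\<^sub>\<nat> \<otimes> (x [^] i \<otimes> y [^] (n - i))" for i
  define U where "U i = \<guillemotleft>n choose i\<guillemotright>\<^sub>\<nat> \<otimes> (x [^] i \<otimes> y [^] (Suc n - i))" for i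
  define S where "S i = \<guillemotleft>Suc n choose i\<guillemotright>\<^sub>\<nat> \<otimes> (x [^] i \<otimes> y [^] (Suc n - i))" for i
  have [simp]: "T i \<in> carrier R" "U i \<in> carrier R" "S i \<in> carrier R" for i
    using x y by (simp_all add: T_def U_def S_def)
  have S_Suc: "S (Suc i) = x \<otimes> T i \<oplus> U (Suc i)" for i
    using x y unfolding S_def T_def U_def
    by (simp add: l_distr r_distr m_ac)
  have S_0: "S 0 = U 0"
    by (simp add: S_def U_def)
  have U_Suc: "U (Suc n) = \<zero>"
    using x y by (simp add: U_def binomial_eq_0)
  have U_T: "U i = y \<otimes> T i" if "i \<le> n" for i
    using x y that by (simp add: U_def T_def Suc_diff_le m_ac)
  have "finsum R S {..Suc n} = finsum R (\<lambda>i. S (Suc i)) {..n} \<oplus> S 0"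
    by (rule finsum_Suc2) simp
  also have "finsum R (\<lambda>i. S (Suc i)) {..n} = finsum R (\<lambda>i. x \<otimes> T i) {..n} \<oplus> finsum R (\<lambda>i. U (Suc i)) {..n}"
    using x by (simp add: S_Suc finsum_addf)
  also have "\<dots> \<oplus> S 0 = finsum R (\<lambda>i. x \<otimes> T i) {..n} \<oplus> (finsum R (\<lambda>i. U (Suc i)) {..n} \<oplus> U 0)"
    using x by (simp add: S_0 a_assoc)
  also have "finsum R (\<lambda>i. U (Suc i)) {..n} \<oplus> U 0 = finsum R U {..Suc n}"
    by (rule finsum_Suc2[symmetric]) simp
  also have "\<dots> = finsum R U {..n}"
    by (simp add: U_Suc)
  also have "\<dots> = finsum R (\<lambda>i. y \<otimes> T i) {..n}"
    using y by (intro finsum_cong') (auto simp: U_T)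
  also have "finsum R (\<lambda>i. x \<otimes> T i) {..n} \<oplus> finsum R (\<lambda>i. y \<otimes> T i) {..n}
      = (x \<oplus> y) \<otimes> finsum R T {..n}"
    using x y by (simp add: finsum_rdistr l_distr)
  also have "\<dots> = (x \<oplus> y) [^] Suc n"
    using x y Suc unfolding T_def by (simp add: m_comm)
  finally show ?case
    by (simp add: S_def)
qed

text \<open>All binomial coefficients except the two outer ones are divisible by
  \<open>p\<close>.\<close>

lemma add_pow_prime_char:
  assumes p: "Factorial_Ring.prime p" "\<guillemotleft>p\<guillemotright>\<^sub>\<nat> = \<zero>"
    and x: "x \<in> carrier R" and y: "y \<in> carrier R"
  shows "(x \<oplus> y) [^] (p::nat) = x [^] p \<oplus> y [^] p"
proof -
  \<comment> \<open>With p = m + 2, the inner indices are exactly \<open>Suc i\<close> for i \<le>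
    m.\<close>
  obtain m where m: "p = Suc (Suc m)"
    using prime_ge_2_nat[OF p(1)] by (metis One_nat_def Suc_1 Suc_le_D Suc_le_mono)
  define T where "T i = \<guillemotleft>p choose i\<guillemotright>\<^sub>\<nat> \<otimes> (x [^] i \<otimes> y [^] (p - i))" for i
  have [simp]: "T i \<in> carrier R" for i
    using x y by (simp add: T_def)
  have T0: "T (Suc i) = \<zero>" if "i \<in> {..m}" for i
  proof -
    have "p dvd (p choose Suc i)"
      using that m p(1) by (intro dvd_choose_prime) auto
    then obtain k where "(p choose Suc i) = p * k" ..
    then show ?thesis
      using x y by (simp add: T_def p(2))
  qed
  have "(x \<oplus> y) [^] p = finsum R T {..Suc (Suc m)}"
    unfolding T_def m by (rule binomial_expansion[OF x y])
  also have "\<dots> = finsum R (\<lambda>i. T (Suc i)) {..Suc m} \<oplus> T 0"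
    by (rule finsum_Suc2) simp
  also have "finsum R (\<lambda>i. T (Suc i)) {..Suc m} = T p \<oplus> finsum R (\<lambda>i. T (Suc i)) {..m}"
    by (simp add: m)
  also have "finsum R (\<lambda>i. T (Suc i)) {..m} = finsum R (\<lambda>i. \<zero>) {..m}"
    by (intro finsum_cong') (auto simp: T0)
  also have "T p \<oplus> finsum R (\<lambda>i. \<zero>) {..m} \<oplus> T 0 = x [^] p \<oplus> y [^] p"
    using x y by (simp add: T_def)
  finally show ?thesis .
qed

end

locale square_order_field = field K for K :: "('a, 'm) ring_scheme" (structure) +
  fixes q :: nat
  assumes finite_carrier: "finite (carrier K)"
    and card_carrier: "card (carrier K) = q\<^sup>2"
    and primepow_q: "primepow q"
    and odd_q: "odd q"
begin

definition cj :: "'a \<Rightarrow> 'a" where "cj x = x [^] q"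

lemma q_ge_3: "q \<ge> 3"
proof -
  have "q \<noteq> 1" "q \<noteq> 0" "q \<noteq> 2" using primepow_gt_Suc_0[OF primepow_q] odd_q by auto
  then show ?thesis by linarith
qed

text \<open>The additive group has order q^2, a power of the prime \<open>p\<close>. So a power of
  \<open>p\<close> vanishes in the field, hence \<open>p\<close> itself does, and the Frobenius map
  for \<open>p\<close> can be iterated.\<close>

lemma add_pow_q:
  assumes "x \<in> carrier K" "y \<in> carrier K"
  shows "(x \<oplus> y) [^] q = x [^] q \<oplus> y [^] q"
proof -
  obtain p k where p: "Factorial_Ring.prime p" and q: "q = p ^ k"
    using primepow_q by (auto simp: primepow_def)
  have nat_pow_eq: "\<one> [^]\<^bsub>add_monoid K\<^esub> n = \<guillemotleft>n\<guillemotright>\<^sub>\<nat>" for n :: nat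
    by (induct n) (simp_all add: a_comm)
  have "\<guillemotleft>q\<^sup>2\<guillemotright>\<^sub>\<nat> = \<zero>"
    using group.pow_order_eq_1[OF a_group, of \<one>] nat_pow_eq[of "q\<^sup>2"] by (simp add: order_def card_carrier)
  moreover have "\<guillemotleft>n ^ j\<guillemotright>\<^sub>\<nat> = \<guillemotleft>n\<guillemotright>\<^sub>\<nat> [^] j" for n j :: nat
    by (induct j) (simp_all add: m_comm)
  moreover have "q\<^sup>2 = p ^ (2 * k)"
    by (simp add: q power_mult [symmetric] mult.commute)
  ultimately have "\<guillemotleft>p\<guillemotright>\<^sub>\<nat> [^] (2 * k) = \<zero>"
    by metis
  then have p0: "\<guillemotleft>p\<guillemotright>\<^sub>\<nat> = \<zero>"
    by simp
  have "(x \<oplus> y) [^] (p ^ j) = x [^] (p ^ j) \<oplus> y [^] (p ^ j)" for j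
  proof (induct j)
    case (Suc j)
    have "(x \<oplus> y) [^] (p ^ Suc j) = ((x \<oplus> y) [^] (p ^ j)) [^] p"
      using assms by (simp add: nat_pow_pow mult.commute)
    also have "\<dots> = (x [^] (p ^ j)) [^] p \<oplus> (y [^] (p ^ j)) [^] p"
      using assms by (simp add: Suc add_pow_prime_char[OF p p0])
    also have "\<dots> = x [^] (p ^ Suc j) \<oplus> y [^] (p ^ Suc j)"
      using assms by (simp add: nat_pow_pow mult.commute)
    finally show ?case .
  qed (use assms in simp)
  then show ?thesis by (simp add: q)
qed

lemma cj_closed [simp]: "x \<in> carrier K \<Longrightarrow> cj x \<in> carrier K"
  by (simp add: cj_def)

lemma cj_0 [simp]: "cj \<zero> = \<zero>"
  using q_ge_3 by (simp add: cj_def)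

lemma cj_1 [simp]: "cj \<one> = \<one>"
  by (simp add: cj_def)

lemma cj_add [simp]: "\<lbrakk>x \<in> carrier K; y \<in> carrier K\<rbrakk> \<Longrightarrow> cj (x \<oplus> y) = cj x \<oplus> cj y"
  by (simp add: cj_def add_pow_q)

lemma cj_mult [simp]: "\<lbrakk>x \<in> carrier K; y \<in> carrier K\<rbrakk> \<Longrightarrow> cj (x \<otimes> y) = cj x \<otimes> cj y"
  by (simp add: cj_def nat_pow_distrib)

lemma cj_neg [simp]: "x \<in> carrier K \<Longrightarrow> cj (\<ominus> x) = \<ominus> cj x"
  by (metis a_inv_closed cj_0 cj_add cj_closed minus_equality r_neg l_neg)

lemma cj_minus [simp]: "\<lbrakk>x \<in> carrier K; y \<in> carrier K\<rbrakk> \<Longrightarrow> cj (x \<ominus> y) = cj x \<ominus> cj y"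
  by (simp add: minus_eq)

lemma cj_pow: "x \<in> carrier K \<Longrightarrow> cj (x [^] (n::nat)) = cj x [^] n"
  by (simp add: cj_def nat_pow_pow mult.commute)

section \<open>The cyclic multiplicative group: squares, norms and -1\<close>

lemma mult_group: "group (Multiplicative_Group.mult_of K)"
  by (rule field_mult_group)

lemma pow_units:
  assumes "x \<in> carrier K" "x \<noteq> \<zero>"
  shows "x [^] (q\<^sup>2 - 1) = \<one>"
proof -
  interpret G: group "Multiplicative_Group.mult_of K" by (rule mult_group)
  have "x [^]\<^bsub>Multiplicative_Group.mult_of K\<^esub> order (Multiplicative_Group.mult_of K) = \<one>\<^bsub>Multiplicative_Group.mult_of K\<^esub>"
    using assms by (intro G.pow_order_eq_1) simp
  then show ?thesis
    using finite_carrier by (simp add: Multiplicative_Group.mult_of_simps order_def card_carrier)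
qed

text \<open>The unit group has order q^2 - 1, so x^(q^2) = x.\<close>

lemma cj_cj [simp]:
  assumes "x \<in> carrier K"
  shows "cj (cj x) = x"
proof (cases "x = \<zero>")
  case False
  have "q * q = q\<^sup>2 - 1 + 1"
    using q_ge_3 by (simp add: Power.power2_eq_square)
  then have "cj (cj x) = x [^] (q\<^sup>2 - 1 + 1)"
    using assms by (simp only: cj_def nat_pow_pow)
  also have "\<dots> = x"
    using assms False by (simp add: pow_units nat_pow_mult [symmetric] del: One_nat_def)
  finally show ?thesis .
qed simp

lemma cj_eq_0_iff [simp]: "x \<in> carrier K \<Longrightarrow> cj x = \<zero> \<longleftrightarrow> x = \<zero>"
  using q_ge_3 by (auto simp: cj_def)

lemma cj_inv [simp]: "x \<in> carrier K \<Longrightarrow> x \<noteq> \<zero> \<Longrightarrow> cj (inv x) = inv (cj x)"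
  by (metis cj_1 cj_closed cj_eq_0_iff cj_mult inv_closed inverse_unique r_inv)

text \<open>A generator turns questions about squares and norms into divisibility of exponents
  modulo q^2 - 1.\<close>

lemma generator_exists:
  "\<exists>g \<in> carrier K. g \<noteq> \<zero> \<and> (\<forall>x \<in> carrier K - {\<zero>}. \<exists>i::nat. x = g [^] i) \<and>
     (\<forall>i::nat. g [^] i = \<one> \<longleftrightarrow> (q\<^sup>2 - 1) dvd i)"
proof -
  interpret G: group "Multiplicative_Group.mult_of K" by (rule mult_group)
  obtain g where g: "g \<in> carrier (Multiplicative_Group.mult_of K)"
    and gen: "carrier (Multiplicative_Group.mult_of K) = {g [^] i | i::nat. i \<in> UNIV}"
    using finite_field_mult_group_has_gen[OF finite_carrier] by blast
  have fin: "finite (carrier (Multiplicative_Group.mult_of K))"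
    using finite_carrier by simp
  have "G.ord g = card (carrier (Multiplicative_Group.mult_of K))"
    using G.generate_pow_card[OF g] G.generate_pow_on_finite_carrier[OF fin g] gen
    by (simp add: Multiplicative_Group.mult_of_simps del: Multiplicative_Group.carrier_mult_of)
  also have "\<dots> = q\<^sup>2 - 1"
    using finite_carrier card_carrier by (simp add: card.remove)
  finally have "g [^] i = \<one> \<longleftrightarrow> (q\<^sup>2 - 1) dvd i" for i :: nat
    using G.pow_eq_id[OF g, of i] by (simp add: Multiplicative_Group.mult_of_simps)
  moreover have "\<exists>i::nat. x = g [^] i" if "x \<in> carrier K" "x \<noteq> \<zero>" for x
  proof -
    have "x \<in> carrier (Multiplicative_Group.mult_of K)" using that by simp
    then show ?thesis using gen by blast
  qed
  ultimately show ?thesis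
    using g by auto
qed

lemma q_square_minus_1: "q\<^sup>2 - 1 = (q - 1) * (q + 1)"
  by (cases q) (simp_all add: Power.power2_eq_square)

lemma two_half: "2 * ((q\<^sup>2 - 1) div 2) = q\<^sup>2 - 1"
  using odd_q by simp

lemma half_q: "2 * ((q + 1) div 2) = q + 1"
  using odd_q by simp

lemma half_half: "(q\<^sup>2 - 1) div 2 = (q - 1) * ((q + 1) div 2)"
  using half_q two_half q_square_minus_1
  by (metis div_mult_swap dvd_triv_left)

text \<open>Euler's criterion: with \<open>x\<close> written as \<open>g [^] i\<close>, the
  hypothesis on the half power makes \<open>i\<close> even.\<close>

lemma square_if_half_pow:
  assumes "x \<in> carrier K" "x \<noteq> \<zero>" "x [^] ((q\<^sup>2 - 1) div 2) = \<one>"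
  obtains z where "z \<in> carrier K" "z \<noteq> \<zero>" "z \<otimes> z = x"
proof -
  obtain g where g: "g \<in> carrier K" "g \<noteq> \<zero>"
    and gen: "\<And>x. \<lbrakk>x \<in> carrier K; x \<noteq> \<zero>\<rbrakk> \<Longrightarrow> \<exists>i::nat. x = g [^] i"
    and ord: "\<And>i::nat. g [^] i = \<one> \<longleftrightarrow> (q\<^sup>2 - 1) dvd i"
    using generator_exists by auto
  obtain i :: nat where i: "x = g [^] i" using gen assms by blast
  have "(q\<^sup>2 - 1) dvd i * ((q\<^sup>2 - 1) div 2)"
    using assms(3) g unfolding i by (simp add: nat_pow_pow ord)
  then have "2 * ((q\<^sup>2 - 1) div 2) dvd i * ((q\<^sup>2 - 1) div 2)"
    by (simp only: two_half)
  moreover have "(q\<^sup>2 - 1) div 2 \<noteq> 0"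
    using q_ge_3 half_half by simp
  ultimately have "2 dvd i" by simp
  then obtain j where j: "i = j + j" by (metis dvdE mult_2)
  have "g [^] j \<otimes> g [^] j = x"
    using g by (simp add: i j nat_pow_mult)
  then show ?thesis using that[of "g [^] j"] g by simp
qed

text \<open>A nonzero \<open>c\<close> fixed by \<open>cj\<close> satisfies c^(q-1) = 1, so its
  exponent is a multiple \<open>j * (q + 1)\<close>, and \<open>g [^] j\<close> has norm
  \<open>c\<close>.\<close>

lemma norm_surj:
  assumes c: "c \<in> carrier K" "cj c = c"
  obtains x where "x \<in> carrier K" "x \<otimes> cj x = c"
proof (cases "c = \<zero>")
  case True
  then show ?thesis using that[of \<zero>] by simp
next
  case False
  obtain g where g: "g \<in> carrier K" "g \<noteq> \<zero>"
    and gen: "\<And>x. \<lbrakk>x \<in> carrier K; x \<noteq> \<zero>\<rbrakk> \<Longrightarrow> \<exists>i::nat. x = g [^] i"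
    and ord: "\<And>i::nat. g [^] i = \<one> \<longleftrightarrow> (q\<^sup>2 - 1) dvd i"
    using generator_exists by auto
  obtain i :: nat where i: "c = g [^] i" using gen c False by blast
  have "c [^] (q - 1) \<otimes> c = \<one> \<otimes> c"
    using c q_ge_3 nat_pow_Suc[of c "q - 1"] by (simp add: cj_def)
  then have "c [^] (q - 1) = \<one>"
    using c False m_rcancel[of c "c [^] (q - 1)" \<one>] by simp
  then have "(q\<^sup>2 - 1) dvd i * (q - 1)"
    using g unfolding i by (simp add: nat_pow_pow ord)
  then have "(q + 1) * (q - 1) dvd i * (q - 1)"
    by (simp only: q_square_minus_1 mult.commute)
  then have "(q + 1) dvd i"
    using q_ge_3 dvd_times_right_cancel_iff[of "q - 1" "q + 1" i] by linarith
  then obtain j where j: "i = j * (q + 1)" by (metis dvdE mult.commute)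
  have "g [^] j \<otimes> cj (g [^] j) = c"
    using g by (simp add: i j cj_def nat_pow_pow nat_pow_mult)
  then show ?thesis using that[of "g [^] j"] g by simp
qed

text \<open>In characteristic 2 every odd multiple of one is one; but q^2 is odd, and its multiple
  of one vanishes by Lagrange's theorem in the additive group.\<close>

lemma two_neq_0: "\<one> \<oplus> \<one> \<noteq> \<zero>"
proof
  assume *: "\<one> \<oplus> \<one> = \<zero>"
  have "\<guillemotleft>2 * n\<guillemotright>\<^sub>\<nat> = \<zero>" for n
    using * by (induct n) (simp_all add: a_assoc[symmetric])
  then have even: "\<guillemotleft>2 * n + 1\<guillemotright>\<^sub>\<nat> = \<one>" for n
    by simp
  have nat_pow_eq: "\<one> [^]\<^bsub>add_monoid K\<^esub> n = \<guillemotleft>n\<guillemotright>\<^sub>\<nat>" for n :: nat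
    by (induct n) (simp_all add: a_comm)
  have "\<guillemotleft>q\<^sup>2\<guillemotright>\<^sub>\<nat> = \<zero>"
    using group.pow_order_eq_1[OF a_group, of \<one>] nat_pow_eq[of "q\<^sup>2"] by (simp add: order_def card_carrier)
  moreover have "odd (q\<^sup>2)" using odd_q by simp
  ultimately show False
    using even by (metis oddE one_not_zero)
qed

text \<open>The witness is \<open>g [^] ((q - 1) div 2)\<close>, whose norm is the element of order
  2 in a cyclic group. Lying outside the fixed field of \<open>cj\<close> is what later makes 1 and
  \<open>b\<close> a basis over that field and 1 + b^2 a nonsquare.\<close>

lemma norm_minus_one_exists:
  obtains b where "b \<in> carrier K" "b \<otimes> cj b = \<ominus> \<one>" "cj b \<noteq> b"
proof -
  obtain g where g: "g \<in> carrier K" "g \<noteq> \<zero>"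
    and ord: "\<And>i::nat. g [^] i = \<one> \<longleftrightarrow> (q\<^sup>2 - 1) dvd i"
    using generator_exists by auto
  define m where "m = (q - 1) div 2"
  have m: "2 * m = q - 1" using odd_q by (simp add: m_def)
  have m0: "m > 0" using m q_ge_3 by simp
  have pos: "(q\<^sup>2 - 1) div 2 > 0" using q_ge_3 half_half by simp
  define b where "b = g [^] m"
  have b: "b \<in> carrier K" "b \<noteq> \<zero>" using g by (simp_all add: b_def)
  have e: "b \<otimes> cj b = g [^] ((q\<^sup>2 - 1) div 2)"
  proof -
    have "m + m * q = (q\<^sup>2 - 1) div 2"
    proof -
      have "2 * (m + m * q) = 2 * m * (q + 1)" by simp
      then have "2 * (m + m * q) = 2 * ((q\<^sup>2 - 1) div 2)"
        by (simp only: m two_half) (simp only: q_square_minus_1)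
      then show ?thesis by (rule mult_left_cancel[THEN iffD1, rotated]) simp
    qed
    then show ?thesis using g by (simp add: b_def cj_def nat_pow_pow nat_pow_mult)
  qed
  have "(b \<otimes> cj b) \<otimes> (b \<otimes> cj b) = \<one>"
    unfolding e using g ord[of "q\<^sup>2 - 1"] two_half by (simp add: nat_pow_mult mult_2[symmetric])
  moreover have ne: "b \<otimes> cj b \<noteq> \<one>"
    unfolding e ord using pos two_half by (auto dest: dvd_imp_le)
  ultimately have "b \<otimes> cj b = \<ominus> \<one>"
    using b square_eq_iff[of "b \<otimes> cj b" \<one>] by simp
  \<comment> \<open>If \<open>b\<close> were fixed, q + 1 would divide \<open>m\<close>, which is
    positive and smaller than q + 1.\<close>
  moreover have "cj b \<noteq> b"
  proof
    assume "cj b = b"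
    then have "g [^] (m * q) = g [^] m" using g by (simp add: b_def cj_def nat_pow_pow)
    then have "g [^] (m * (q - 1)) \<otimes> g [^] m = \<one> \<otimes> g [^] m"
      using g q_ge_3 by (simp add: nat_pow_mult algebra_simps)
    then have "g [^] (m * (q - 1)) = \<one>"
      using g m_rcancel[of "g [^] m" "g [^] (m * (q - 1))" \<one>] by simp
    then have "(q - 1) * (q + 1) dvd (q - 1) * m"
      using q_square_minus_1 by (simp add: ord mult.commute)
    then have "(q + 1) dvd m"
      using q_ge_3 dvd_times_left_cancel_iff[of "q - 1" "q + 1" m] by linarith
    then have "q + 1 \<le> m" using m0 by (rule dvd_imp_le)
    then show False using m by simp
  qed
  ultimately show ?thesis using that b by blast
qed

end

section \<open>Transporting condition (C)\<close>

text \<open>Only ring operations occur in the equation, so \<open>f\<close> can be pulled out of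
  both sides and cancelled by injectivity; \<open>map_option f\<close> keeps the point at
  infinity.\<close>

lemma kappa_equation_iso:
  assumes "cring K" "cring L" and f: "f \<in> ring_iso K L"
    and abc: "b \<in> carrier K" "s \<in> carrier K" "u \<in> carrier K" "w \<in> carrier K" "\<kappa> \<in> carrier K"
    and l: "l \<in> insert None (Some ` carrier K)"
  shows "kappa_equation L q (f b) (f s) (f u) (f w) (f \<kappa>) (map_option f l) \<longleftrightarrow>
    kappa_equation K q b s u w \<kappa> l"
proof -
  interpret K: cring K by fact
  interpret L: cring L by fact
  interpret ring_hom_cring K L f
    using f K.is_cring L.is_cring by (intro ring_hom_cringI) (auto simp: ring_iso_def)
  have inj: "f x = f y \<longleftrightarrow> x = y" if "x \<in> carrier K" "y \<in> carrier K" for x y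
    using f that by (auto simp: ring_iso_def bij_betw_def inj_on_def)
  have minus: "f x \<ominus>\<^bsub>L\<^esub> f y = f (x \<ominus>\<^bsub>K\<^esub> y)" if "x \<in> carrier K" "y \<in> carrier K" for x y
    using that by (simp add: a_minus_def)
  have pow: "f x [^]\<^bsub>L\<^esub> n = f (x [^]\<^bsub>K\<^esub> n)" if "x \<in> carrier K" for x and n :: nat
    using that by simp
  note rls = pow minus hom_mult [symmetric] hom_add [symmetric] hom_one [symmetric] inj
  show ?thesis
  proof (cases l)
    case None
    then show ?thesis
      using abc by (simp only: kappa_equation.simps option.map rls K.m_closed K.minus_closed K.nat_pow_closed)
  next
    case (Some a)
    with l have "a \<in> carrier K" by auto
    with Some show ?thesis
      using abc
      by (simp only: kappa_equation.simps option.map rls K.m_closed K.a_closed K.minus_closed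
          K.nat_pow_closed K.one_closed)
  qed
qed

lemma kappa_count_iso:
  fixes K :: "('a, 'm) ring_scheme" and L :: "('b, 'n) ring_scheme"
  assumes "cring K" "cring L" and f: "f \<in> ring_iso K L"
    and abc: "b \<in> carrier K" "s \<in> carrier K" "u \<in> carrier K" "w \<in> carrier K" "\<kappa> \<in> carrier K"
  shows "kappa_count L q (f b) (f s) (f u) (f w) (f \<kappa>) = kappa_count K q b s u w \<kappa>"
proof -
  let ?S = "{l \<in> insert None (Some ` carrier K). kappa_equation K q b s u w \<kappa> l}"
  have inj: "inj_on f (carrier K)" and img: "f ` carrier K = carrier L"
    using f by (auto simp: ring_iso_def bij_betw_def)
  have img': "insert None (Some ` carrier L) = map_option f ` insert None (Some ` carrier K)"
    by (simp add: img[symmetric] image_image)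
  note eq = kappa_equation_iso[OF assms(1,2) f abc, where q = q]
  have "{l \<in> insert None (Some ` carrier L). kappa_equation L q (f b) (f s) (f u) (f w) (f \<kappa>) l}
    = map_option f ` ?S"
  proof -
    have "{x \<in> g ` A. P x} = g ` {x \<in> A. P (g x)}" for g :: "'a option \<Rightarrow> 'b option" and A P
      by blast
    then have "{l \<in> insert None (Some ` carrier L). kappa_equation L q (f b) (f s) (f u) (f w) (f \<kappa>) l}
      = map_option f ` {l \<in> insert None (Some ` carrier K).
          kappa_equation L q (f b) (f s) (f u) (f w) (f \<kappa>) (map_option f l)}"
      unfolding img' .
    also have "\<dots> = map_option f ` ?S"
      using eq by (intro arg_cong[where f = "(`) (map_option f)"] Collect_cong conj_cong refl)
    finally show ?thesis .
  qed
  moreover have "inj_on (map_option f) ?S"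
  proof (rule inj_onI)
    fix x y assume "x \<in> ?S" "y \<in> ?S" "map_option f x = map_option f y"
    then show "x = y"
      using inj by (cases x; cases y) (auto simp: inj_on_def)
  qed
  ultimately show ?thesis
    unfolding kappa_count_def by (simp add: card_image)
qed

context square_order_field
begin

text \<open>(C) speaks of rings on natural numbers and of (q+1)-st powers; this is its form for
  \<open>K\<close> itself, with norms written as \<open>x \<otimes> cj x\<close>.\<close>

lemma kappa_count_neg:
  assumes C: "condition_C"
    and c: "b \<in> carrier K" "s \<in> carrier K" "u \<in> carrier K" "w \<in> carrier K"
    and b: "b \<otimes> cj b = \<ominus> \<one>" and ne: "(s, u, w) \<noteq> (\<zero>, \<zero>, \<zero>)"
    and norms: "s \<otimes> cj s = u \<otimes> cj u \<oplus> w \<otimes> cj w"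
    and \<kappa>: "\<kappa> \<in> carrier K" "\<kappa> \<noteq> \<zero>" "cj \<kappa> = \<kappa>"
  shows "kappa_count K q b s u w (\<ominus> \<kappa>) = kappa_count K q b s u w \<kappa>"
proof -
  \<comment> \<open>Finiteness of the carrier gives an injection into the natural numbers, along
    which \<open>K\<close> is copied to a ring \<open>L\<close> that (C) covers.\<close>
  obtain f :: "'a \<Rightarrow> nat" where inj: "inj_on f (carrier K)"
    using finite_imp_inj_to_nat_seg[OF finite_carrier] by blast
  define L where "L = image_ring f K"
  have f: "f \<in> ring_iso K L"
    unfolding L_def by (rule inj_imp_image_ring_iso[OF inj])
  have L: "field L"
    unfolding L_def by (rule inj_imp_image_ring_is_field[OF inj])
  interpret L: field L by (rule L)
  interpret f: ring_hom_cring K L f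
    using f is_cring L.is_cring by (intro ring_hom_cringI) (auto simp: ring_iso_def)
  have f_inj: "f x = f y \<longleftrightarrow> x = y" if "x \<in> carrier K" "y \<in> carrier K" for x y
    using inj that by (auto simp: inj_on_def)
  have f_0: "f x = \<zero>\<^bsub>L\<^esub> \<longleftrightarrow> x = \<zero>" if "x \<in> carrier K" for x
    using f_inj[OF that zero_closed] by simp
  have pow: "x [^] (q + 1) = x \<otimes> cj x" if "x \<in> carrier K" for x
    using that by (simp add: cj_def m_comm)
  have f_pow: "f x [^]\<^bsub>L\<^esub> (q + 1) = f (x \<otimes> cj x)" if "x \<in> carrier K" for x
    using that by (simp only: f.hom_pow[symmetric] pow)
  have "field_of_order L (q\<^sup>2)"
    using L finite_carrier card_carrier inj
    by (simp add: field_of_order_def L_def image_ring_carrier card_image)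
  moreover have "f b [^]\<^bsub>L\<^esub> (q + 1) = \<ominus>\<^bsub>L\<^esub> \<one>\<^bsub>L\<^esub>"
    unfolding f_pow[OF c(1)] b by simp
  moreover have "(f s, f u, f w) \<noteq> (\<zero>\<^bsub>L\<^esub>, \<zero>\<^bsub>L\<^esub>, \<zero>\<^bsub>L\<^esub>)"
    using ne c by (simp add: f_0)
  moreover have "f s [^]\<^bsub>L\<^esub> (q + 1) = f u [^]\<^bsub>L\<^esub> (q + 1) \<oplus>\<^bsub>L\<^esub> f w [^]\<^bsub>L\<^esub> (q + 1)"
    unfolding f_pow[OF c(2)] f_pow[OF c(3)] f_pow[OF c(4)] norms using c by simp
  moreover have "f \<kappa> \<in> Fq_units L q"
    using \<kappa> by (simp add: Fq_units_def f_0 f.hom_pow[symmetric] cj_def del: f.hom_pow)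
  ultimately have "kappa_count L q (f b) (f s) (f u) (f w) (f \<kappa>) =
      kappa_count L q (f b) (f s) (f u) (f w) (\<ominus>\<^bsub>L\<^esub> f \<kappa>)"
    using C primepow_q odd_q c unfolding condition_C_def by simp
  moreover have "\<ominus>\<^bsub>L\<^esub> f \<kappa> = f (\<ominus> \<kappa>)"
    using \<kappa> by simp
  ultimately show ?thesis
    using kappa_count_iso[OF is_cring L.is_cring f c \<kappa>(1)]
      kappa_count_iso[OF is_cring L.is_cring f c a_inv_closed[OF \<kappa>(1)]]
    by (simp only:)
qed

end

section \<open>Isotropic lines in coordinates\<close>

context square_order_field
begin

lemma eq_if_diff_eq: "\<lbrakk>x \<in> carrier K; y \<in> carrier K; x \<ominus> y = \<zero>\<rbrakk> \<Longrightarrow> x = y"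
  using r_right_minus_eq by blast

lemma two_cancel:
  assumes "x \<in> carrier K" "x \<oplus> x = \<zero>"
  shows "x = \<zero>"
proof -
  have "x \<otimes> (\<one> \<oplus> \<one>) = \<zero>"
    using assms by (simp add: r_distr)
  then show ?thesis
    using assms(1) two_neq_0 by (simp add: integral_iff)
qed

text \<open>Here v = (1, v2, b, v4, 0). The equations for \<open>v\<close> leave one parameter
  \<open>k\<close> fixed by \<open>cj\<close>, with v = (1, 1 - b k, b, b + k, 0). Those for
  \<open>y\<close> then give y2 = -y1 - k y3 and y4 = k y1 - y3, and \<open>k\<close> cancels from
  the conclusions.\<close>

lemma line_coords_base:
  assumes c[simp]: "b \<in> carrier K" "v2 \<in> carrier K" "v4 \<in> carrier K"
    "y1 \<in> carrier K" "y2 \<in> carrier K" "y3 \<in> carrier K" "y4 \<in> carrier K" "y5 \<in> carrier K"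
    and b: "b \<otimes> cj b = \<ominus> \<one>" "cj b \<noteq> b"
    and Qv: "v2 \<oplus> b \<otimes> v4 = \<one> \<oplus> b \<otimes> b"
    and Hv: "v2 \<oplus> cj v2 \<oplus> b \<otimes> cj v4 \<oplus> cj b \<otimes> v4 = \<zero>"
    and Bvy: "y2 \<oplus> v2 \<otimes> y1 \<oplus> b \<otimes> y4 \<oplus> v4 \<otimes> y3 = \<zero>"
    and Hyv: "y2 \<oplus> cj v2 \<otimes> y1 \<oplus> cj b \<otimes> y4 \<oplus> cj v4 \<otimes> y3 = \<zero>"
    and Hy: "y1 \<otimes> cj y2 \<oplus> y2 \<otimes> cj y1 \<oplus> y3 \<otimes> cj y4 \<oplus> y4 \<otimes> cj y3 \<oplus> (y5 \<otimes> cj y5 \<oplus> y5 \<otimes> cj y5) = \<zero>"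
  shows "y5 \<otimes> cj y5 = y3 \<otimes> cj y3 \<oplus> y1 \<otimes> cj y1"
    and "y1 \<otimes> y2 \<oplus> y3 \<otimes> y4 = \<ominus> (y1 \<otimes> y1 \<oplus> y3 \<otimes> y3)"
    and "\<lbrakk>y1 = \<zero>; y3 = \<zero>\<rbrakk> \<Longrightarrow> y2 = \<zero> \<and> y4 = \<zero>"
proof -
  have nz: "b \<ominus> cj b \<noteq> \<zero>"
    using b(2) eq_if_diff_eq[of b "cj b"] by auto
  define k where "k = v4 \<ominus> b"
  have k[simp]: "k \<in> carrier K" by (simp add: k_def)
  have v4: "v4 = b \<oplus> k"
    unfolding k_def by (reify polex_eqs, rule polex_eqI) (code_simp, simp_all)
  have "v2 = (v2 \<oplus> b \<otimes> v4) \<ominus> b \<otimes> v4"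
    by (reify polex_eqs, rule polex_eqI) (code_simp, simp_all)
  also have "\<dots> = \<one> \<oplus> b \<otimes> b \<ominus> b \<otimes> (b \<oplus> k)"
    by (simp only: Qv) (simp only: v4)
  also have "\<dots> = \<one> \<ominus> b \<otimes> k"
    by (reify polex_eqs, rule polex_eqI) (code_simp, simp_all)
  finally have v2: "v2 = \<one> \<ominus> b \<otimes> k" .
  have "(b \<ominus> cj b) \<otimes> (cj k \<ominus> k) = \<zero>"
  proof -
    \<comment> \<open>After substitution this is the left side of \<open>Hv\<close> minus twice b
      cj(b) + 1, and both vanish.\<close>
    have "(b \<ominus> cj b) \<otimes> (cj k \<ominus> k) = (v2 \<oplus> cj v2 \<oplus> b \<otimes> cj v4 \<oplus> cj b \<otimes> v4)
       \<ominus> (b \<otimes> cj b \<ominus> \<ominus> \<one>) \<ominus> (b \<otimes> cj b \<ominus> \<ominus> \<one>)"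
      unfolding v2 v4
      by simp (reify polex_eqs, rule polex_eqI, code_simp, simp_all)
    then show ?thesis by (simp add: Hv b(1) minus_eq l_neg)
  qed
  then have "cj k \<ominus> k = \<zero>"
    using nz by (simp add: integral_iff)
  then have ck: "cj k = k"
    by (rule eq_if_diff_eq[rotated 2]) simp_all
  \<comment> \<open>The difference of \<open>Bvy\<close> and \<open>Hyv\<close> pairs
    \<open>y\<close> with v - cj(v), all of whose coordinates are multiples of b - cj(b).\<close>
  have "(b \<ominus> cj b) \<otimes> (y4 \<oplus> y3 \<ominus> k \<otimes> y1) =
      (y2 \<oplus> v2 \<otimes> y1 \<oplus> b \<otimes> y4 \<oplus> v4 \<otimes> y3) \<ominus> (y2 \<oplus> cj v2 \<otimes> y1 \<oplus> cj b \<otimes> y4 \<oplus> cj v4 \<otimes> y3)"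
    unfolding v2 v4
    by (simp add: ck) (reify polex_eqs, rule polex_eqI, code_simp, simp_all)
  then have *: "y4 \<oplus> y3 \<ominus> k \<otimes> y1 = \<zero>"
    using nz by (simp add: Bvy Hyv integral_iff)
  have "y4 = (y4 \<oplus> y3 \<ominus> k \<otimes> y1) \<oplus> (k \<otimes> y1 \<ominus> y3)"
    by (reify polex_eqs, rule polex_eqI) (code_simp, simp_all)
  also have "\<dots> = k \<otimes> y1 \<ominus> y3" unfolding * by simp
  finally have y4: "y4 = k \<otimes> y1 \<ominus> y3" .
  have "y2 = (y2 \<oplus> v2 \<otimes> y1 \<oplus> b \<otimes> y4 \<oplus> v4 \<otimes> y3) \<oplus> (\<ominus> y1 \<ominus> k \<otimes> y3)"
    unfolding v2 v4 y4
    by (reify polex_eqs, rule polex_eqI) (code_simp, simp_all)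
  also have "\<dots> = \<ominus> y1 \<ominus> k \<otimes> y3" unfolding Bvy by simp
  finally have y2: "y2 = \<ominus> y1 \<ominus> k \<otimes> y3" .
  show "y1 \<otimes> y2 \<oplus> y3 \<otimes> y4 = \<ominus> (y1 \<otimes> y1 \<oplus> y3 \<otimes> y3)"
    unfolding y2 y4 by (reify polex_eqs, rule polex_eqI) (code_simp, simp_all)
  show "y2 = \<zero> \<and> y4 = \<zero>" if "y1 = \<zero>" "y3 = \<zero>"
    unfolding y2 y4 that by (simp add: minus_eq)
  \<comment> \<open>After substitution the left side of \<open>Hy\<close> is twice
    \<open>?d\<close>, and 2 can be cancelled.\<close>
  let ?d = "y5 \<otimes> cj y5 \<ominus> (y3 \<otimes> cj y3 \<oplus> y1 \<otimes> cj y1)"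
  have "?d \<oplus> ?d = y1 \<otimes> cj y2 \<oplus> y2 \<otimes> cj y1 \<oplus> y3 \<otimes> cj y4 \<oplus> y4 \<otimes> cj y3 \<oplus> (y5 \<otimes> cj y5 \<oplus> y5 \<otimes> cj y5)"
    unfolding y2 y4
    by (simp add: ck) (reify polex_eqs, rule polex_eqI, code_simp, simp_all)
  then have "?d = \<zero>" unfolding Hy by (rule two_cancel[rotated]) simp_all
  then show "y5 \<otimes> cj y5 = y3 \<otimes> cj y3 \<oplus> y1 \<otimes> cj y1"
    by (rule eq_if_diff_eq[rotated 2]) simp_all
qed

lemma diff_neq_0: "\<lbrakk>x \<in> carrier K; y \<in> carrier K; x \<noteq> y\<rbrakk> \<Longrightarrow> x \<ominus> y \<noteq> \<zero>"
  using r_right_minus_eq by blast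

text \<open>1 and \<open>b\<close> form a basis over the fixed field of \<open>cj\<close>: the
  coefficient of \<open>b\<close> is (x - cj(x)) / (b - cj(b)), a quotient of two elements negated
  by \<open>cj\<close> and therefore fixed.\<close>

lemma real_basis:
  assumes c[simp]: "b \<in> carrier K" "x \<in> carrier K" and b: "cj b \<noteq> b"
  obtains r s where "r \<in> carrier K" "s \<in> carrier K" "cj r = r" "cj s = s" "x = r \<oplus> s \<otimes> b"
proof -
  define d where "d = b \<ominus> cj b"
  have d[simp]: "d \<in> carrier K" and d0: "d \<noteq> \<zero>"
    using b diff_neq_0[of b "cj b"] by (auto simp: d_def)
  have cd: "cj d = \<ominus> d"
    unfolding d_def by simp (reify polex_eqs, rule polex_eqI, code_simp, simp_all)
  define e where "e = inv d"
  have e[simp]: "e \<in> carrier K" and ed: "d \<otimes> e = \<one>"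
    using d0 by (simp_all add: e_def)
  have "cj d \<otimes> cj e = \<one>"
    using arg_cong[OF ed, of cj] by simp
  then have "e \<otimes> (\<ominus> d \<otimes> cj e) = e"
    by (simp add: cd)
  moreover have "e \<otimes> (\<ominus> d \<otimes> cj e) = \<ominus> ((d \<otimes> e) \<otimes> cj e)"
    by (reify polex_eqs, rule polex_eqI) (code_simp, simp_all)
  ultimately have "\<ominus> cj e = e"
    by (simp add: ed)
  then have ce: "cj e = \<ominus> e"
    using minus_minus[of "cj e"] by simp
  define s where "s = (x \<ominus> cj x) \<otimes> e"
  define r where "r = x \<ominus> s \<otimes> b"
  have cl[simp]: "s \<in> carrier K" "r \<in> carrier K"
    by (simp_all add: s_def r_def)
  have cs: "cj s = s"
    unfolding s_def by (simp add: ce) (reify polex_eqs, rule polex_eqI, code_simp, simp_all)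
  have "cj r \<ominus> r = (x \<ominus> cj x) \<otimes> (d \<otimes> e) \<ominus> (x \<ominus> cj x)"
    unfolding r_def by (simp add: cs) (unfold s_def d_def, reify polex_eqs, rule polex_eqI, code_simp, simp_all)
  also have "\<dots> = \<zero>" by (simp add: ed)
  finally have "cj r = r" by (rule eq_if_diff_eq[rotated 2]) simp_all
  moreover have "x = r \<oplus> s \<otimes> b"
    unfolding r_def by (reify polex_eqs, rule polex_eqI) (code_simp, simp_all)
  ultimately show ?thesis by (intro that[of r s] cl cs)
qed

text \<open>The unipotent change of coordinates \<open>x\<^sub>5 \<mapsto> x\<^sub>5 + a x\<^sub>1 + c x\<^sub>3\<close>, which preserves the polar
  form, kills the fifth coordinate of \<open>v\<close>.\<close>

lemma line_coords_normalized:
  assumes c[simp]: "b \<in> carrier K" "v2 \<in> carrier K" "v4 \<in> carrier K" "v5 \<in> carrier K"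
    "y1 \<in> carrier K" "y2 \<in> carrier K" "y3 \<in> carrier K" "y4 \<in> carrier K" "y5 \<in> carrier K"
    and b: "b \<otimes> cj b = \<ominus> \<one>" "cj b \<noteq> b"
    and Qv: "v2 \<oplus> b \<otimes> v4 \<oplus> v5 \<otimes> v5 = \<one> \<oplus> b \<otimes> b"
    and Hv: "v2 \<oplus> cj v2 \<oplus> b \<otimes> cj v4 \<oplus> cj b \<otimes> v4 \<oplus> (v5 \<otimes> cj v5 \<oplus> v5 \<otimes> cj v5) = \<zero>"
    and Bvy: "y2 \<oplus> v2 \<otimes> y1 \<oplus> b \<otimes> y4 \<oplus> v4 \<otimes> y3 \<oplus> (v5 \<otimes> y5 \<oplus> v5 \<otimes> y5) = \<zero>"
    and Hyv: "y2 \<oplus> cj v2 \<otimes> y1 \<oplus> cj b \<otimes> y4 \<oplus> cj v4 \<otimes> y3 \<oplus> (cj v5 \<otimes> y5 \<oplus> cj v5 \<otimes> y5) = \<zero>"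
    and Hy: "y1 \<otimes> cj y2 \<oplus> y2 \<otimes> cj y1 \<oplus> y3 \<otimes> cj y4 \<oplus> y4 \<otimes> cj y3 \<oplus> (y5 \<otimes> cj y5 \<oplus> y5 \<otimes> cj y5) = \<zero>"
  obtains s where "s \<in> carrier K" "s \<otimes> cj s = y3 \<otimes> cj y3 \<oplus> y1 \<otimes> cj y1"
    "y1 \<otimes> y2 \<oplus> y3 \<otimes> y4 \<oplus> y5 \<otimes> y5 = s \<otimes> s \<ominus> y3 \<otimes> y3 \<ominus> y1 \<otimes> y1"
    "\<lbrakk>s = \<zero>; y1 = \<zero>; y3 = \<zero>\<rbrakk> \<Longrightarrow> y2 = \<zero> \<and> y4 = \<zero> \<and> y5 = \<zero>"
proof -
  \<comment> \<open>Since v1 = 1 and v3 = b here, these \<open>a\<close> and \<open>c\<close> make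
    the new fifth coordinate v5 + a v1 + c v3 vanish.\<close>
  obtain a c where ac[simp]: "a \<in> carrier K" "c \<in> carrier K" "cj a = a" "cj c = c"
    and v5': "\<ominus> v5 = a \<oplus> c \<otimes> b"
    by (rule real_basis[of b "\<ominus> v5"]) (use b in auto)
  have v5: "v5 = \<ominus> (a \<oplus> c \<otimes> b)"
    using minus_minus[of v5] v5' by simp
  \<comment> \<open>With these new second and fourth coordinates the change preserves the polar form
    and, as \<open>a\<close> and \<open>c\<close> are fixed by \<open>cj\<close>, also the Hermitian
    form.\<close>
  define t2 where "t2 x1 x2 x3 x5 = x2 \<ominus> (a \<otimes> x5 \<oplus> a \<otimes> x5) \<ominus> a \<otimes> a \<otimes> x1 \<ominus> a \<otimes> c \<otimes> x3" for x1 x2 x3 x5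
  define t4 where "t4 x1 x3 x4 x5 = x4 \<ominus> (c \<otimes> x5 \<oplus> c \<otimes> x5) \<ominus> a \<otimes> c \<otimes> x1 \<ominus> c \<otimes> c \<otimes> x3" for x1 x3 x4 x5
  define V2 where "V2 = t2 \<one> v2 b v5"
  define V4 where "V4 = t4 \<one> b v4 v5"
  define Y2 where "Y2 = t2 y1 y2 y3 y5"
  define Y4 where "Y4 = t4 y1 y3 y4 y5"
  \<comment> \<open>The new fifth coordinate of \<open>y\<close>. With \<open>y1\<close> as w and
    \<open>y3\<close> as u it completes the triple to which (C) will be applied.\<close>
  define s where "s = y5 \<oplus> a \<otimes> y1 \<oplus> c \<otimes> y3"
  note defs = V2_def V4_def Y2_def Y4_def s_def t2_def t4_def
  have cl[simp]: "V2 \<in> carrier K" "V4 \<in> carrier K" "Y2 \<in> carrier K" "Y4 \<in> carrier K" "s \<in> carrier K"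
    by (simp_all add: defs)
  have 1: "V2 \<oplus> b \<otimes> V4 = \<one> \<oplus> b \<otimes> b"
    unfolding Qv[symmetric] defs v5
    by (reify polex_eqs, rule polex_eqI) (code_simp, simp_all)
  have 2: "V2 \<oplus> cj V2 \<oplus> b \<otimes> cj V4 \<oplus> cj b \<otimes> V4 = \<zero>"
    unfolding Hv[symmetric] defs v5
    by simp (reify polex_eqs, rule polex_eqI, code_simp, simp_all)
  have 3: "Y2 \<oplus> V2 \<otimes> y1 \<oplus> b \<otimes> Y4 \<oplus> V4 \<otimes> y3 = \<zero>"
    unfolding Bvy[symmetric] defs v5
    by (reify polex_eqs, rule polex_eqI) (code_simp, simp_all)
  have 4: "Y2 \<oplus> cj V2 \<otimes> y1 \<oplus> cj b \<otimes> Y4 \<oplus> cj V4 \<otimes> y3 = \<zero>"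
    unfolding Hyv[symmetric] defs v5
    by simp (reify polex_eqs, rule polex_eqI, code_simp, simp_all)
  have 5: "y1 \<otimes> cj Y2 \<oplus> Y2 \<otimes> cj y1 \<oplus> y3 \<otimes> cj Y4 \<oplus> Y4 \<otimes> cj y3 \<oplus> (s \<otimes> cj s \<oplus> s \<otimes> cj s) = \<zero>"
    unfolding Hy[symmetric] defs
    by simp (reify polex_eqs, rule polex_eqI, code_simp, simp_all)
  note base = line_coords_base[OF _ _ _ _ _ _ _ _ b 1 2 3 4 5, simplified]
  have "y1 \<otimes> y2 \<oplus> y3 \<otimes> y4 \<oplus> y5 \<otimes> y5 = (y1 \<otimes> Y2 \<oplus> y3 \<otimes> Y4) \<oplus> s \<otimes> s"
    unfolding defs by (reify polex_eqs, rule polex_eqI) (code_simp, simp_all)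
  also have "\<dots> = s \<otimes> s \<ominus> y3 \<otimes> y3 \<ominus> y1 \<otimes> y1"
    unfolding base(2) by (reify polex_eqs, rule polex_eqI) (code_simp, simp_all)
  finally have Q: "y1 \<otimes> y2 \<oplus> y3 \<otimes> y4 \<oplus> y5 \<otimes> y5 = s \<otimes> s \<ominus> y3 \<otimes> y3 \<ominus> y1 \<otimes> y1" .
  have "y2 = \<zero> \<and> y4 = \<zero> \<and> y5 = \<zero>" if "s = \<zero>" "y1 = \<zero>" "y3 = \<zero>"
  proof -
    have y5: "y5 = \<zero>" using that by (simp add: s_def)
    have "Y2 = y2" "Y4 = y4" using that by (simp_all add: y5 Y2_def Y4_def t2_def t4_def)
    then show ?thesis using base(3)[OF that(2,3)] y5 by simp
  qed
  then show ?thesis using that[OF cl(5) base(1) Q] by blast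
qed

text \<open>An alternating form over the fixed field of \<open>cj\<close>; it vanishes exactly when
  \<open>x\<close> and \<open>y\<close> are linearly dependent over that field.\<close>

abbreviation wedge :: "'a \<Rightarrow> 'a \<Rightarrow> 'a" where
  "wedge x y \<equiv> x \<otimes> cj y \<ominus> cj x \<otimes> y"

text \<open>Since \<open>v\<^sub>1\<close> and \<open>v\<^sub>3\<close> are independent over the subfield fixed by \<open>cj\<close>, a linear change of
  coordinates over that subfield makes them equal to \<open>1\<close> and \<open>b\<close>; \<open>D\<close> is its determinant.\<close>

lemma line_coords:
  assumes c[simp]: "b \<in> carrier K"
    "v1 \<in> carrier K" "v2 \<in> carrier K" "v3 \<in> carrier K" "v4 \<in> carrier K" "v5 \<in> carrier K"
    "y1 \<in> carrier K" "y2 \<in> carrier K" "y3 \<in> carrier K" "y4 \<in> carrier K" "y5 \<in> carrier K"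
    and b: "b \<otimes> cj b = \<ominus> \<one>" "cj b \<noteq> b"
    and wedge_v: "wedge v1 v3 \<noteq> \<zero>"
    and Qv: "v1 \<otimes> v2 \<oplus> v3 \<otimes> v4 \<oplus> v5 \<otimes> v5 = \<one> \<oplus> b \<otimes> b"
    and Hv: "v1 \<otimes> cj v2 \<oplus> v2 \<otimes> cj v1 \<oplus> v3 \<otimes> cj v4 \<oplus> v4 \<otimes> cj v3 \<oplus> (v5 \<otimes> cj v5 \<oplus> v5 \<otimes> cj v5) = \<zero>"
    and Bvy: "v1 \<otimes> y2 \<oplus> v2 \<otimes> y1 \<oplus> v3 \<otimes> y4 \<oplus> v4 \<otimes> y3 \<oplus> (v5 \<otimes> y5 \<oplus> v5 \<otimes> y5) = \<zero>"
    and Hyv: "y1 \<otimes> cj v2 \<oplus> y2 \<otimes> cj v1 \<oplus> y3 \<otimes> cj v4 \<oplus> y4 \<otimes> cj v3 \<oplus> (y5 \<otimes> cj v5 \<oplus> y5 \<otimes> cj v5) = \<zero>"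
    and Hy: "y1 \<otimes> cj y2 \<oplus> y2 \<otimes> cj y1 \<oplus> y3 \<otimes> cj y4 \<oplus> y4 \<otimes> cj y3 \<oplus> (y5 \<otimes> cj y5 \<oplus> y5 \<otimes> cj y5) = \<zero>"
  obtains s u w D where "s \<in> carrier K" "u \<in> carrier K" "w \<in> carrier K"
    "D \<in> carrier K" "D \<noteq> \<zero>" "cj D = D"
    "s \<otimes> cj s = u \<otimes> cj u \<oplus> w \<otimes> cj w"
    "y1 \<otimes> y2 \<oplus> y3 \<otimes> y4 \<oplus> y5 \<otimes> y5 = s \<otimes> s \<ominus> u \<otimes> u \<ominus> w \<otimes> w"
    "\<lbrakk>s = \<zero>; u = \<zero>; w = \<zero>\<rbrakk> \<Longrightarrow> y1 = \<zero> \<and> y2 = \<zero> \<and> y3 = \<zero> \<and> y4 = \<zero> \<and> y5 = \<zero>"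
    "\<And>l. l \<in> carrier K \<Longrightarrow> wedge (w \<otimes> l \<oplus> \<one>) (b \<oplus> u \<otimes> l) = D \<otimes> wedge (v1 \<oplus> l \<otimes> y1) (v3 \<oplus> l \<otimes> y3)"
    "wedge w u = D \<otimes> wedge y1 y3"
proof -
  define n where "n = wedge v1 v3"
  have n[simp]: "n \<in> carrier K" and n0: "n \<noteq> \<zero>"
    using wedge_v by (simp_all add: n_def)
  define e where "e = inv n"
  have e[simp]: "e \<in> carrier K" and ne: "e \<otimes> n = \<one>"
    using n0 by (simp_all add: e_def)
  have cn: "cj n = \<ominus> n"
    unfolding n_def by simp (reify polex_eqs, rule polex_eqI, code_simp, simp_all)
  have "cj e \<otimes> cj n = \<one>"
    using arg_cong[OF ne, of cj] by simp
  then have "e \<otimes> (cj e \<otimes> \<ominus> n) = e"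
    by (simp add: cn)
  moreover have "e \<otimes> (cj e \<otimes> \<ominus> n) = \<ominus> ((e \<otimes> n) \<otimes> cj e)"
    by (reify polex_eqs, rule polex_eqI) (code_simp, simp_all)
  ultimately have "\<ominus> cj e = e"
    by (simp add: ne)
  then have ce: "cj e = \<ominus> e"
    using minus_minus[of "cj e"] by simp
  \<comment> \<open>Cramer's rule for p v1 + p' v3 = 1 and r v1 + r' v3 = b together with the
    conjugate equations. As \<open>e\<close> is negated by \<open>cj\<close>, the solutions are
    fixed by it.\<close>
  define p where "p = e \<otimes> (cj v3 \<ominus> v3)"
  define p' where "p' = e \<otimes> (v1 \<ominus> cj v1)"
  define r where "r = e \<otimes> (b \<otimes> cj v3 \<ominus> cj b \<otimes> v3)"
  define r' where "r' = e \<otimes> (cj b \<otimes> v1 \<ominus> b \<otimes> cj v1)"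
  have cl[simp]: "p \<in> carrier K" "p' \<in> carrier K" "r \<in> carrier K" "r' \<in> carrier K"
    by (simp_all add: p_def p'_def r_def r'_def)
  have cp[simp]: "cj p = p" "cj p' = p'" "cj r = r" "cj r' = r'"
    unfolding p_def p'_def r_def r'_def
    by (simp add: ce, reify polex_eqs, rule polex_eqI, code_simp, simp, simp)+
  have "p \<otimes> v1 \<oplus> p' \<otimes> v3 = e \<otimes> n"
    unfolding p_def p'_def n_def by (reify polex_eqs, rule polex_eqI) (code_simp, simp_all)
  then have pv: "p \<otimes> v1 \<oplus> p' \<otimes> v3 = \<one>" by (simp add: ne)
  have "r \<otimes> v1 \<oplus> r' \<otimes> v3 = b \<otimes> (e \<otimes> n)"
    unfolding r_def r'_def n_def by (reify polex_eqs, rule polex_eqI) (code_simp, simp_all)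
  then have rv: "r \<otimes> v1 \<oplus> r' \<otimes> v3 = b" by (simp add: ne)
  define D where "D = p \<otimes> r' \<ominus> p' \<otimes> r"
  have D[simp]: "D \<in> carrier K" "cj D = D" by (simp_all add: D_def)
  have wedge_D: "wedge (p \<otimes> x \<oplus> p' \<otimes> z) (r \<otimes> x \<oplus> r' \<otimes> z) = D \<otimes> wedge x z"
    if [simp]: "x \<in> carrier K" "z \<in> carrier K" for x z
    unfolding D_def by simp (reify polex_eqs, rule polex_eqI, code_simp, simp_all)
  \<comment> \<open>Otherwise the wedge of 1 and \<open>b\<close>, which is cj(b) - b, would
    vanish.\<close>
  have D0: "D \<noteq> \<zero>"
  proof
    assume "D = \<zero>"
    then have "wedge \<one> b = \<zero>"
      using wedge_D[of v1 v3] by (simp add: pv rv)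
    then have "cj b \<ominus> b = \<zero>" by simp
    then show False using diff_neq_0[of "cj b" b] b(2) by simp
  qed
  define d where "d = inv D"
  have d[simp]: "d \<in> carrier K" and dD: "d \<otimes> D = \<one>"
    using D0 by (simp_all add: d_def)
  have cd[simp]: "cj d = d"
    unfolding d_def using D0 by simp
  \<comment> \<open>The second and fourth coordinates are changed by the inverse transpose of the
    matrix that acts on the first and third, which preserves x1 x2 + x3 x4.\<close>
  define t2 where "t2 x z = d \<otimes> (r' \<otimes> x \<ominus> r \<otimes> z)" for x z
  define t4 where "t4 x z = d \<otimes> (p \<otimes> z \<ominus> p' \<otimes> x)" for x z
  have t[simp]: "t2 x z \<in> carrier K" "t4 x z \<in> carrier K"
    and cj_t[simp]: "cj (t2 x z) = t2 (cj x) (cj z)" "cj (t4 x z) = t4 (cj x) (cj z)"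
    if "x \<in> carrier K" "z \<in> carrier K" for x z
    using that by (simp_all add: t2_def t4_def)
  have inv1: "(p \<otimes> x1 \<oplus> p' \<otimes> x3) \<otimes> t2 z2 z4 \<oplus> (r \<otimes> x1 \<oplus> r' \<otimes> x3) \<otimes> t4 z2 z4 = x1 \<otimes> z2 \<oplus> x3 \<otimes> z4"
    if [simp]: "x1 \<in> carrier K" "x3 \<in> carrier K" "z2 \<in> carrier K" "z4 \<in> carrier K" for x1 x3 z2 z4
  proof -
    have "(p \<otimes> x1 \<oplus> p' \<otimes> x3) \<otimes> t2 z2 z4 \<oplus> (r \<otimes> x1 \<oplus> r' \<otimes> x3) \<otimes> t4 z2 z4 =
        (d \<otimes> D) \<otimes> (x1 \<otimes> z2 \<oplus> x3 \<otimes> z4)"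
      unfolding t2_def t4_def D_def by (reify polex_eqs, rule polex_eqI) (code_simp, simp_all)
    then show ?thesis by (simp add: dD)
  qed
  \<comment> \<open>Taking the \<open>z\<close> arguments to be coordinates or their conjugates
    covers both the polar and the Hermitian form, since the matrix entries are fixed by
    \<open>cj\<close>.\<close>
  have inv: "(p \<otimes> x1 \<oplus> p' \<otimes> x3) \<otimes> t2 z2 z4 \<oplus> t2 x2 x4 \<otimes> (p \<otimes> z1 \<oplus> p' \<otimes> z3)
      \<oplus> (r \<otimes> x1 \<oplus> r' \<otimes> x3) \<otimes> t4 z2 z4 \<oplus> t4 x2 x4 \<otimes> (r \<otimes> z1 \<oplus> r' \<otimes> z3) \<oplus> (x5 \<otimes> z5 \<oplus> x5 \<otimes> z5)
    = x1 \<otimes> z2 \<oplus> x2 \<otimes> z1 \<oplus> x3 \<otimes> z4 \<oplus> x4 \<otimes> z3 \<oplus> (x5 \<otimes> z5 \<oplus> x5 \<otimes> z5)" (is "?L = ?R")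
    if [simp]: "x1 \<in> carrier K" "x2 \<in> carrier K" "x3 \<in> carrier K" "x4 \<in> carrier K" "x5 \<in> carrier K"
      "z1 \<in> carrier K" "z2 \<in> carrier K" "z3 \<in> carrier K" "z4 \<in> carrier K" "z5 \<in> carrier K"
    for x1 x2 x3 x4 x5 z1 z2 z3 z4 z5
  proof -
    have "?L = ((p \<otimes> x1 \<oplus> p' \<otimes> x3) \<otimes> t2 z2 z4 \<oplus> (r \<otimes> x1 \<oplus> r' \<otimes> x3) \<otimes> t4 z2 z4)
      \<oplus> ((p \<otimes> z1 \<oplus> p' \<otimes> z3) \<otimes> t2 x2 x4 \<oplus> (r \<otimes> z1 \<oplus> r' \<otimes> z3) \<otimes> t4 x2 x4) \<oplus> (x5 \<otimes> z5 \<oplus> x5 \<otimes> z5)"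
      by (reify polex_eqs, rule polex_eqI) (code_simp, simp_all)
    also have "\<dots> = ?R"
      by (simp only: inv1 that) (reify polex_eqs, rule polex_eqI, code_simp, simp_all)
    finally show ?thesis .
  qed
  define w where "w = p \<otimes> y1 \<oplus> p' \<otimes> y3"
  define u where "u = r \<otimes> y1 \<oplus> r' \<otimes> y3"
  have uw[simp]: "w \<in> carrier K" "u \<in> carrier K" by (simp_all add: w_def u_def)
  have cuw: "cj w = p \<otimes> cj y1 \<oplus> p' \<otimes> cj y3" "cj u = r \<otimes> cj y1 \<oplus> r' \<otimes> cj y3"
    by (simp_all add: w_def u_def)
  have cpv: "p \<otimes> cj v1 \<oplus> p' \<otimes> cj v3 = \<one>" "r \<otimes> cj v1 \<oplus> r' \<otimes> cj v3 = cj b"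
    using arg_cong[OF pv, of cj] arg_cong[OF rv, of cj] by simp_all
  have 1: "t2 v2 v4 \<oplus> b \<otimes> t4 v2 v4 \<oplus> v5 \<otimes> v5 = \<one> \<oplus> b \<otimes> b"
    using inv1[of v1 v3 v2 v4] Qv by (simp add: pv rv)
  have 2: "t2 v2 v4 \<oplus> cj (t2 v2 v4) \<oplus> b \<otimes> cj (t4 v2 v4) \<oplus> cj b \<otimes> t4 v2 v4 \<oplus> (v5 \<otimes> cj v5 \<oplus> v5 \<otimes> cj v5) = \<zero>"
    using inv[of v1 v2 v3 v4 v5 "cj v1" "cj v2" "cj v3" "cj v4" "cj v5"] Hv
    by (simp add: pv rv cpv a_ac m_comm)
  have 3: "t2 y2 y4 \<oplus> t2 v2 v4 \<otimes> w \<oplus> b \<otimes> t4 y2 y4 \<oplus> t4 v2 v4 \<otimes> u \<oplus> (v5 \<otimes> y5 \<oplus> v5 \<otimes> y5) = \<zero>"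
    using inv[of v1 v2 v3 v4 v5 y1 y2 y3 y4 y5] Bvy
    by (simp add: pv rv w_def[symmetric] u_def[symmetric])
  have 4: "t2 y2 y4 \<oplus> cj (t2 v2 v4) \<otimes> w \<oplus> cj b \<otimes> t4 y2 y4 \<oplus> cj (t4 v2 v4) \<otimes> u \<oplus> (cj v5 \<otimes> y5 \<oplus> cj v5 \<otimes> y5) = \<zero>"
    using inv[of y1 y2 y3 y4 y5 "cj v1" "cj v2" "cj v3" "cj v4" "cj v5"] Hyv
    by (simp add: cpv w_def[symmetric] u_def[symmetric] a_ac m_comm)
  have 5: "w \<otimes> cj (t2 y2 y4) \<oplus> t2 y2 y4 \<otimes> cj w \<oplus> u \<otimes> cj (t4 y2 y4) \<oplus> t4 y2 y4 \<otimes> cj u \<oplus> (y5 \<otimes> cj y5 \<oplus> y5 \<otimes> cj y5) = \<zero>"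
    using inv[of y1 y2 y3 y4 y5 "cj y1" "cj y2" "cj y3" "cj y4" "cj y5"] Hy
    by (simp add: cuw[symmetric] w_def[symmetric] u_def[symmetric])
  obtain s where s: "s \<in> carrier K" "s \<otimes> cj s = u \<otimes> cj u \<oplus> w \<otimes> cj w"
    "w \<otimes> t2 y2 y4 \<oplus> u \<otimes> t4 y2 y4 \<oplus> y5 \<otimes> y5 = s \<otimes> s \<ominus> u \<otimes> u \<ominus> w \<otimes> w"
    "\<lbrakk>s = \<zero>; w = \<zero>; u = \<zero>\<rbrakk> \<Longrightarrow> t2 y2 y4 = \<zero> \<and> t4 y2 y4 = \<zero> \<and> y5 = \<zero>"
    by (rule line_coords_normalized[OF _ _ _ _ _ _ _ _ _ b 1 2 3 4 5]) simp_all
  have Q: "y1 \<otimes> y2 \<oplus> y3 \<otimes> y4 \<oplus> y5 \<otimes> y5 = s \<otimes> s \<ominus> u \<otimes> u \<ominus> w \<otimes> w"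
    using s(3) inv1[of y1 y3 y2 y4] by (simp add: w_def[symmetric] u_def[symmetric])
  \<comment> \<open>The vanishing of the new coordinates is pulled back through the inverse of each
    matrix.\<close>
  have zero: "y1 = \<zero> \<and> y2 = \<zero> \<and> y3 = \<zero> \<and> y4 = \<zero> \<and> y5 = \<zero>" if 0: "s = \<zero>" "u = \<zero>" "w = \<zero>"
  proof -
    have "(d \<otimes> D) \<otimes> y1 = d \<otimes> (r' \<otimes> w \<ominus> p' \<otimes> u)" "(d \<otimes> D) \<otimes> y3 = d \<otimes> (p \<otimes> u \<ominus> r \<otimes> w)"
      unfolding D_def w_def u_def
      by (reify polex_eqs, rule polex_eqI, code_simp, simp, simp)+
    moreover have "(d \<otimes> D) \<otimes> y2 = p \<otimes> t2 y2 y4 \<oplus> r \<otimes> t4 y2 y4" "(d \<otimes> D) \<otimes> y4 = p' \<otimes> t2 y2 y4 \<oplus> r' \<otimes> t4 y2 y4"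
      unfolding D_def t2_def t4_def
      by (reify polex_eqs, rule polex_eqI, code_simp, simp, simp)+
    ultimately show ?thesis
      using s(4) 0 by (simp add: dD minus_eq)
  qed
  have line: "wedge (w \<otimes> l \<oplus> \<one>) (b \<oplus> u \<otimes> l) = D \<otimes> wedge (v1 \<oplus> l \<otimes> y1) (v3 \<oplus> l \<otimes> y3)"
    if [simp]: "l \<in> carrier K" for l
  proof -
    have "w \<otimes> l \<oplus> \<one> = p \<otimes> (v1 \<oplus> l \<otimes> y1) \<oplus> p' \<otimes> (v3 \<oplus> l \<otimes> y3)"
      unfolding w_def pv[symmetric] by (reify polex_eqs, rule polex_eqI) (code_simp, simp_all)
    moreover have "b \<oplus> u \<otimes> l = r \<otimes> (v1 \<oplus> l \<otimes> y1) \<oplus> r' \<otimes> (v3 \<oplus> l \<otimes> y3)"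
      unfolding u_def by (subst rv[symmetric]) (reify polex_eqs, rule polex_eqI, code_simp, simp_all)
    ultimately show ?thesis
      using wedge_D[of "v1 \<oplus> l \<otimes> y1" "v3 \<oplus> l \<otimes> y3"] by simp
  qed
  have inf: "wedge w u = D \<otimes> wedge y1 y3"
    unfolding w_def u_def by (rule wedge_D) simp_all
  show ?thesis
    by (rule that[of s u w D]) (use s Q zero line inf D0 in auto)
qed

end

section \<open>Hermitian spaces of dimension five\<close>

text \<open>Dimension five enters through the number of vectors, which is the form in which the
  pigeonhole and counting arguments use it.\<close>

locale hermitian_space = square_order_field K q + V: module K V
  for K :: "('a, 'm) ring_scheme" (structure) and q :: nat
    and V :: "('a, 'v, 'n) module_scheme" +
  fixes h :: "'v \<Rightarrow> 'v \<Rightarrow> 'a"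
  assumes hermitian: "hermitian_form K q V h"
    and nondeg: "nondegenerate K V h"
    and card_V: "card (carrier V) = card (carrier K) ^ 5"
begin

lemma finite_V: "finite (carrier V)"
proof (rule ccontr)
  assume "infinite (carrier V)"
  then have "card (carrier K) = 0" using card_V by simp
  then show False using card_carrier q_ge_3 by simp
qed

lemma h_closed [simp]: "\<lbrakk>x \<in> carrier V; y \<in> carrier V\<rbrakk> \<Longrightarrow> h x y \<in> carrier K"
  using hermitian unfolding hermitian_form_def by blast

lemma h_add_left [simp]:
  "\<lbrakk>x \<in> carrier V; y \<in> carrier V; z \<in> carrier V\<rbrakk> \<Longrightarrow> h (x \<oplus>\<^bsub>V\<^esub> y) z = h x z \<oplus> h y z"
  using hermitian unfolding hermitian_form_def by blast

lemma h_smult_left [simp]: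
  "\<lbrakk>c \<in> carrier K; x \<in> carrier V; y \<in> carrier V\<rbrakk> \<Longrightarrow> h (c \<odot>\<^bsub>V\<^esub> x) y = c \<otimes> h x y"
  using hermitian unfolding hermitian_form_def by blast

lemma h_swap: "\<lbrakk>x \<in> carrier V; y \<in> carrier V\<rbrakk> \<Longrightarrow> h y x = cj (h x y)"
  using hermitian unfolding hermitian_form_def cj_def by blast

lemma h_add_right [simp]:
  assumes "x \<in> carrier V" "y \<in> carrier V" "z \<in> carrier V"
  shows "h z (x \<oplus>\<^bsub>V\<^esub> y) = h z x \<oplus> h z y"
  using assms by (simp add: h_swap[of _ z])

lemma h_smult_right [simp]:
  assumes "c \<in> carrier K" "x \<in> carrier V" "y \<in> carrier V"
  shows "h y (c \<odot>\<^bsub>V\<^esub> x) = cj c \<otimes> h y x"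
  using assms by (simp add: h_swap[of _ y])

lemma h_zero_left [simp]: "y \<in> carrier V \<Longrightarrow> h \<zero>\<^bsub>V\<^esub> y = \<zero>"
  using h_smult_left[of \<zero> "\<zero>\<^bsub>V\<^esub>" y] by (simp del: h_smult_left)

lemma h_zero_right [simp]: "y \<in> carrier V \<Longrightarrow> h y \<zero>\<^bsub>V\<^esub> = \<zero>"
  by (simp add: h_swap[of "\<zero>\<^bsub>V\<^esub>" y])

lemma h_minus_left [simp]:
  assumes "x \<in> carrier V" "y \<in> carrier V" "z \<in> carrier V"
  shows "h (x \<ominus>\<^bsub>V\<^esub> y) z = h x z \<ominus> h y z"
proof -
  have "x \<ominus>\<^bsub>V\<^esub> y = x \<oplus>\<^bsub>V\<^esub> (\<ominus> \<one>) \<odot>\<^bsub>V\<^esub> y"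
    using assms V.smult_l_minus[of \<one> y] by (simp add: a_minus_def)
  then show ?thesis using assms by (simp add: l_minus minus_eq)
qed

lemma h_minus_right [simp]:
  assumes "x \<in> carrier V" "y \<in> carrier V" "z \<in> carrier V"
  shows "h z (x \<ominus>\<^bsub>V\<^esub> y) = h z x \<ominus> h z y"
  using assms by (simp add: h_swap[of _ z])

lemma h_self_real: "x \<in> carrier V \<Longrightarrow> cj (h x x) = h x x"
  using h_swap[of x x] by simp

lemma h_eq_0_swap: "\<lbrakk>x \<in> carrier V; y \<in> carrier V\<rbrakk> \<Longrightarrow> h x y = \<zero> \<longleftrightarrow> h y x = \<zero>"
  by (simp add: h_swap[of x y])

section \<open>Orthogonal families with prescribed values of the form\<close>

lemma V_minus_eq_0:
  assumes "x \<in> carrier V" "y \<in> carrier V" "x \<noteq> y"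
  shows "x \<ominus>\<^bsub>V\<^esub> y \<noteq> \<zero>\<^bsub>V\<^esub>"
  using assms V.add.inv_solve_right[of "\<zero>\<^bsub>V\<^esub>" x y] by (auto simp: a_minus_def)

text \<open>Pigeonhole: pairing with the \<open>k\<close> given vectors maps a set of size |K|^5 to
  one of size |K|^k, so two vectors have the same image, and their difference is orthogonal to every
  \<open>a i\<close>.\<close>

lemma perp_vector_exists:
  fixes a :: "nat \<Rightarrow> 'v"
  assumes k: "k < 5" and a: "\<And>i. i < k \<Longrightarrow> a i \<in> carrier V"
  shows "\<exists>x \<in> carrier V - {\<zero>\<^bsub>V\<^esub>}. \<forall>i<k. h x (a i) = \<zero>"
proof -
  define \<phi> where "\<phi> x = (\<lambda>i\<in>{..<k}. h x (a i))" for x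
  have "\<phi> ` carrier V \<subseteq> {..<k} \<rightarrow>\<^sub>E carrier K"
    using a by (auto simp: \<phi>_def split: if_splits)
  moreover have "finite ({..<k} \<rightarrow>\<^sub>E carrier K)"
    using finite_carrier by (intro finite_PiE) auto
  ultimately have "inj_on \<phi> (carrier V) \<Longrightarrow> card (carrier V) \<le> card ({..<k} \<rightarrow>\<^sub>E carrier K)"
    by (intro card_inj_on_le)
  moreover have "card ({..<k} \<rightarrow>\<^sub>E carrier K) = card (carrier K) ^ k"
    by (simp add: card_PiE)
  moreover have "card (carrier K) ^ k < card (carrier K) ^ 5"
  proof (rule power_strict_increasing[OF k])
    show "1 < card (carrier K)"
      using q_ge_3 one_less_power[of q 2] by (simp add: card_carrier)
  qed
  ultimately have "\<not> inj_on \<phi> (carrier V)"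
    using card_V by linarith
  then obtain x y where xy: "x \<in> carrier V" "y \<in> carrier V" "x \<noteq> y" "\<phi> x = \<phi> y"
    by (auto simp: inj_on_def)
  have "h (x \<ominus>\<^bsub>V\<^esub> y) (a i) = \<zero>" if "i < k" for i
  proof -
    have "h x (a i) = h y (a i)"
      using fun_cong[OF xy(4), of i] that by (simp add: \<phi>_def)
    then show ?thesis using xy a[OF that] by simp
  qed
  then show ?thesis
    using xy V_minus_eq_0 by (intro bexI[of _ "x \<ominus>\<^bsub>V\<^esub> y"]) auto
qed

definition orthogonal_family :: "nat \<Rightarrow> (nat \<Rightarrow> 'a) \<Rightarrow> (nat \<Rightarrow> 'v) \<Rightarrow> bool" where
  "orthogonal_family k d f \<longleftrightarrow>
     (\<forall>i<k. f i \<in> carrier V \<and> h (f i) (f i) = d i) \<and>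
     (\<forall>i<k. \<forall>j<k. i \<noteq> j \<longrightarrow> h (f i) (f j) = \<zero>)"

text \<open>Gram-Schmidt, one member of the family at a time: subtracting multiples of the
  \<open>f i\<close> leaves the pairings with their orthogonal complement unchanged.\<close>

lemma orthogonal_projection:
  assumes "orthogonal_family k d f" and d: "\<And>i. d i \<in> carrier K - {\<zero>}" and y: "y \<in> carrier V"
  shows "\<exists>y' \<in> carrier V. (\<forall>i<k. h y' (f i) = \<zero>) \<and>
    (\<forall>x \<in> carrier V. (\<forall>i<k. h x (f i) = \<zero>) \<longrightarrow> h x y' = h x y)"
  using assms(1)
proof (induct k)
  case 0
  then show ?case using y by auto
next
  case (Suc k)
  then have f: "\<And>i. i < Suc k \<Longrightarrow> f i \<in> carrier V" "h (f k) (f k) = d k"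
    "\<And>i. i < k \<Longrightarrow> h (f k) (f i) = \<zero>"
    by (auto simp: orthogonal_family_def)
  obtain y' where y': "y' \<in> carrier V" "\<And>i. i < k \<Longrightarrow> h y' (f i) = \<zero>"
    "\<And>x. \<lbrakk>x \<in> carrier V; \<forall>i<k. h x (f i) = \<zero>\<rbrakk> \<Longrightarrow> h x y' = h x y"
    using Suc by (auto simp: orthogonal_family_def)
  define c where "c = h y' (f k) \<otimes> inv (d k)"
  have dk: "d k \<in> carrier K" "d k \<noteq> \<zero>" using d[of k] by auto
  have c: "c \<in> carrier K" using y' f dk by (simp add: c_def)
  have "c \<otimes> d k = h y' (f k)"
    unfolding c_def using y' f dk by (simp add: m_assoc)
  then have "h (y' \<ominus>\<^bsub>V\<^esub> c \<odot>\<^bsub>V\<^esub> f k) (f i) = \<zero>" if "i < Suc k" for i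
    using that y' f c by (cases "i = k") auto
  moreover have "h x (y' \<ominus>\<^bsub>V\<^esub> c \<odot>\<^bsub>V\<^esub> f k) = h x y" if "x \<in> carrier V" "\<forall>i<Suc k. h x (f i) = \<zero>" for x
    using that y' y f c by simp
  ultimately show ?case
    using y' f c by (intro bexI[of _ "y' \<ominus>\<^bsub>V\<^esub> c \<odot>\<^bsub>V\<^esub> f k"]) auto
qed

text \<open>A nonzero \<open>x\<close> orthogonal to the family may be isotropic. Nondegeneracy and
  projection then give \<open>y'\<close> in the complement with h(x, y') = t nonzero, and if
  \<open>y'\<close> is isotropic too, x + t y' takes the value 2 t cj(t).\<close>

lemma anisotropic_vector_exists:
  assumes k: "k < 5" and f: "orthogonal_family k d f" and d: "\<And>i. d i \<in> carrier K - {\<zero>}"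
  shows "\<exists>x \<in> carrier V. (\<forall>i<k. h x (f i) = \<zero>) \<and> h x x \<noteq> \<zero>"
proof -
  have fV: "\<And>i. i < k \<Longrightarrow> f i \<in> carrier V"
    using f by (simp add: orthogonal_family_def)
  obtain x where x: "x \<in> carrier V" "x \<noteq> \<zero>\<^bsub>V\<^esub>" "\<And>i. i < k \<Longrightarrow> h x (f i) = \<zero>"
    using perp_vector_exists[OF k, of f] fV by auto
  obtain y where y: "y \<in> carrier V" "h x y \<noteq> \<zero>"
    using nondeg x by (auto simp: nondegenerate_def)
  obtain y' where y': "y' \<in> carrier V" "\<And>i. i < k \<Longrightarrow> h y' (f i) = \<zero>" "h x y' = h x y"
    using orthogonal_projection[OF f d y(1)] x by blast
  define t where "t = h x y"
  have t: "t \<in> carrier K" "t \<noteq> \<zero>" using x y by (simp_all add: t_def)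
  define z where "z = x \<oplus>\<^bsub>V\<^esub> t \<odot>\<^bsub>V\<^esub> y'"
  have z: "z \<in> carrier V" "\<And>i. i < k \<Longrightarrow> h z (f i) = \<zero>"
    using x y' t fV by (simp_all add: z_def)
  have "h x x \<noteq> \<zero> \<or> h y' y' \<noteq> \<zero> \<or> h z z \<noteq> \<zero>"
  proof (rule ccontr)
    assume "\<not> ?thesis"
    then have 0: "h x x = \<zero>" "h y' y' = \<zero>" "h z z = \<zero>" by auto
    have yx: "h y' x = cj t" using x y' h_swap[of x y'] by (simp add: t_def)
    have "t \<otimes> cj t \<oplus> t \<otimes> cj t = \<zero>"
      using 0(3) unfolding z_def using x y' t 0 yx by (simp add: t_def[symmetric] m_comm)
    then have "t \<otimes> cj t = \<zero>" by (rule two_cancel[rotated]) (use t in simp)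
    then show False using t by (simp add: integral_iff)
  qed
  then show ?thesis using x y' z by blast
qed

text \<open>An anisotropic vector in the complement can be rescaled to the prescribed value, because
  the norm map reaches every element fixed by \<open>cj\<close>.\<close>

lemma orthogonal_family_exists:
  assumes d: "\<And>i. d i \<in> carrier K - {\<zero>}" "\<And>i. cj (d i) = d i"
  shows "k \<le> 5 \<Longrightarrow> \<exists>f. orthogonal_family k d f"
proof (induct k)
  case 0
  then show ?case by (simp add: orthogonal_family_def)
next
  case (Suc k)
  then obtain f where f: "orthogonal_family k d f" by auto
  have fV: "\<And>i. i < k \<Longrightarrow> f i \<in> carrier V"
    using f by (simp add: orthogonal_family_def)
  obtain x where x: "x \<in> carrier V" "\<And>i. i < k \<Longrightarrow> h x (f i) = \<zero>" "h x x \<noteq> \<zero>"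
    using anisotropic_vector_exists[OF _ f d(1)] Suc by auto
  have dk: "d k \<in> carrier K" using d(1)[of k] by simp
  obtain c where c: "c \<in> carrier K" "c \<otimes> cj c = d k \<otimes> inv (h x x)"
    by (rule norm_surj[of "d k \<otimes> inv (h x x)"]) (use x dk d(2)[of k] h_self_real in auto)
  define g where "g = f(k := c \<odot>\<^bsub>V\<^esub> x)"
  have "h (c \<odot>\<^bsub>V\<^esub> x) (c \<odot>\<^bsub>V\<^esub> x) = (c \<otimes> cj c) \<otimes> h x x"
    using x c(1) by (simp add: m_ac)
  also have "\<dots> = d k"
    unfolding c(2) using x dk by (simp add: m_assoc)
  finally have "h (c \<odot>\<^bsub>V\<^esub> x) (c \<odot>\<^bsub>V\<^esub> x) = d k" .
  moreover have "h (f i) x = \<zero>" if "i < k" for i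
    using that x fV h_eq_0_swap by blast
  ultimately have "orthogonal_family (Suc k) d g"
    using f x c fV unfolding orthogonal_family_def g_def by (auto simp: less_Suc_eq)
  then show ?case by blast
qed

end

section \<open>Coordinates with respect to a hyperbolic frame\<close>

locale hyperbolic_frame = hermitian_space K q V h
  for K :: "('a, 'm) ring_scheme" (structure) and q :: nat
    and V :: "('a, 'v, 'n) module_scheme" and h :: "'v \<Rightarrow> 'v \<Rightarrow> 'a" +
  fixes e1 e2 e3 e4 e5 :: 'v
  assumes e_closed [simp]: "e1 \<in> carrier V" "e2 \<in> carrier V" "e3 \<in> carrier V"
      "e4 \<in> carrier V" "e5 \<in> carrier V"
    and h_pairs [simp]: "h e1 e2 = \<one>" "h e3 e4 = \<one>" "h e5 e5 = \<one> \<oplus> \<one>"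
    and h_isotropic [simp]: "h e1 e1 = \<zero>" "h e2 e2 = \<zero>" "h e3 e3 = \<zero>" "h e4 e4 = \<zero>"
    and h_orthogonal [simp]: "h e1 e3 = \<zero>" "h e1 e4 = \<zero>" "h e1 e5 = \<zero>" "h e2 e3 = \<zero>"
      "h e2 e4 = \<zero>" "h e2 e5 = \<zero>" "h e3 e5 = \<zero>" "h e4 e5 = \<zero>"

lemma (in hermitian_space) hyperbolic_frame_exists:
  "\<exists>e1 e2 e3 e4 e5. hyperbolic_frame K q V h e1 e2 e3 e4 e5"
proof -
  define t where "t = inv (\<one> \<oplus> \<one>)"
  have t: "t \<in> carrier K" "t \<noteq> \<zero>" "t \<oplus> t = \<one>" "cj t = t"
  proof -
    show "t \<in> carrier K" "cj t = t" using two_neq_0 by (simp_all add: t_def)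
    have "t \<oplus> t = t \<otimes> (\<one> \<oplus> \<one>)" using \<open>t \<in> carrier K\<close> by (simp add: r_distr)
    also have "\<dots> = \<one>" using two_neq_0 by (simp add: t_def)
    finally show "t \<oplus> t = \<one>" .
    then show "t \<noteq> \<zero>" by auto
  qed
  \<comment> \<open>The values are 1/2, -1/2, 1/2, -1/2, 2: the sum and the difference of orthogonal
    vectors with values 1/2 and -1/2 form a hyperbolic pair.\<close>
  define d where "d i = (if i = 4 then \<one> \<oplus> \<one> else if even i then t else \<ominus> t)" for i :: nat
  have "\<exists>f. orthogonal_family 5 d f"
    by (rule orthogonal_family_exists) (use t two_neq_0 in \<open>auto simp: d_def\<close>)
  then obtain f where f: "orthogonal_family 5 d f" by blast
  have fV[simp]: "f 0 \<in> carrier V" "f 1 \<in> carrier V" "f 2 \<in> carrier V" "f 3 \<in> carrier V" "f 4 \<in> carrier V"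
    and hd[simp]: "h (f 0) (f 0) = t" "h (f 1) (f 1) = \<ominus> t" "h (f 2) (f 2) = t" "h (f 3) (f 3) = \<ominus> t" "h (f 4) (f 4) = \<one> \<oplus> \<one>"
    using f by (simp_all add: orthogonal_family_def d_def)
  have ho[simp]: "h (f i) (f j) = \<zero>" if "i < 5" "j < 5" "i \<noteq> j" for i j
    using f that by (simp add: orthogonal_family_def)
  have "hyperbolic_frame K q V h (f 0 \<oplus>\<^bsub>V\<^esub> f 1) (f 0 \<ominus>\<^bsub>V\<^esub> f 1) (f 2 \<oplus>\<^bsub>V\<^esub> f 3) (f 2 \<ominus>\<^bsub>V\<^esub> f 3) (f 4)"
    by unfold_locales (use t(1,3) in \<open>simp_all add: minus_eq r_neg l_neg del: One_nat_def\<close>)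
  then show ?thesis by blast
qed

context hyperbolic_frame
begin

text \<open>A coordinate is read off by pairing with the other member of its hyperbolic pair. The
  fifth is halved because \<open>h e5 e5\<close> is 2, a value that gives \<open>h\<close> the Gram
  matrix of the polar form of Q.\<close>

definition "X1 x = h x e2"
definition "X2 x = h x e1"
definition "X3 x = h x e4"
definition "X4 x = h x e3"
definition "X5 x = h x e5 \<otimes> inv (\<one> \<oplus> \<one>)"

lemmas X_defs = X1_def X2_def X3_def X4_def X5_def

lemma X_closed [simp]:
  assumes "x \<in> carrier V"
  shows "X1 x \<in> carrier K" "X2 x \<in> carrier K" "X3 x \<in> carrier K" "X4 x \<in> carrier K" "X5 x \<in> carrier K"
  using assms two_neq_0 by (simp_all add: X_defs)

lemma X_add [simp]:
  assumes "x \<in> carrier V" "y \<in> carrier V"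
  shows "X1 (x \<oplus>\<^bsub>V\<^esub> y) = X1 x \<oplus> X1 y" "X2 (x \<oplus>\<^bsub>V\<^esub> y) = X2 x \<oplus> X2 y" "X3 (x \<oplus>\<^bsub>V\<^esub> y) = X3 x \<oplus> X3 y"
    "X4 (x \<oplus>\<^bsub>V\<^esub> y) = X4 x \<oplus> X4 y" "X5 (x \<oplus>\<^bsub>V\<^esub> y) = X5 x \<oplus> X5 y"
  using assms two_neq_0 by (simp_all add: X_defs l_distr)

lemma X_smult [simp]:
  assumes "c \<in> carrier K" "x \<in> carrier V"
  shows "X1 (c \<odot>\<^bsub>V\<^esub> x) = c \<otimes> X1 x" "X2 (c \<odot>\<^bsub>V\<^esub> x) = c \<otimes> X2 x" "X3 (c \<odot>\<^bsub>V\<^esub> x) = c \<otimes> X3 x"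
    "X4 (c \<odot>\<^bsub>V\<^esub> x) = c \<otimes> X4 x" "X5 (c \<odot>\<^bsub>V\<^esub> x) = c \<otimes> X5 x"
  using assms two_neq_0 by (simp_all add: X_defs m_assoc)

lemma h_e_swapped [simp]:
  "h e2 e1 = \<one>" "h e4 e3 = \<one>" "h e3 e1 = \<zero>" "h e4 e1 = \<zero>" "h e5 e1 = \<zero>" "h e3 e2 = \<zero>"
  "h e4 e2 = \<zero>" "h e5 e2 = \<zero>" "h e5 e3 = \<zero>" "h e5 e4 = \<zero>"
  using h_swap[of e1 e2] h_swap[of e3 e4] h_swap[of e1 e3] h_swap[of e1 e4] h_swap[of e1 e5]
    h_swap[of e2 e3] h_swap[of e2 e4] h_swap[of e2 e5] h_swap[of e3 e5] h_swap[of e4 e5]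
  by simp_all

definition vec :: "'a \<Rightarrow> 'a \<Rightarrow> 'a \<Rightarrow> 'a \<Rightarrow> 'a \<Rightarrow> 'v" where
  "vec c1 c2 c3 c4 c5 = c1 \<odot>\<^bsub>V\<^esub> e1 \<oplus>\<^bsub>V\<^esub> c2 \<odot>\<^bsub>V\<^esub> e2 \<oplus>\<^bsub>V\<^esub> c3 \<odot>\<^bsub>V\<^esub> e3 \<oplus>\<^bsub>V\<^esub> c4 \<odot>\<^bsub>V\<^esub> e4 \<oplus>\<^bsub>V\<^esub> c5 \<odot>\<^bsub>V\<^esub> e5"

lemma vec_closed [simp]:
  "\<lbrakk>c1 \<in> carrier K; c2 \<in> carrier K; c3 \<in> carrier K; c4 \<in> carrier K; c5 \<in> carrier K\<rbrakk>
    \<Longrightarrow> vec c1 c2 c3 c4 c5 \<in> carrier V"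
  by (simp add: vec_def)

lemma X_vec [simp]:
  assumes "c1 \<in> carrier K" "c2 \<in> carrier K" "c3 \<in> carrier K" "c4 \<in> carrier K" "c5 \<in> carrier K"
  shows "X1 (vec c1 c2 c3 c4 c5) = c1" "X2 (vec c1 c2 c3 c4 c5) = c2" "X3 (vec c1 c2 c3 c4 c5) = c3"
    "X4 (vec c1 c2 c3 c4 c5) = c4" "X5 (vec c1 c2 c3 c4 c5) = c5"
  using assms two_neq_0 by (simp_all add: X_defs vec_def m_assoc)

text \<open>\<open>vec\<close> is injective, as \<open>X1\<close> to \<open>X5\<close> recover its
  arguments, and its domain has as many elements as \<open>carrier V\<close>; so it is onto, which
  makes the frame a basis.\<close>

lemma vec_X [simp]:
  assumes x: "x \<in> carrier V"
  shows "vec (X1 x) (X2 x) (X3 x) (X4 x) (X5 x) = x"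
proof -
  define C where "C = carrier K \<times> carrier K \<times> carrier K \<times> carrier K \<times> carrier K"
  define F where "F = (\<lambda>(c1, c2, c3, c4, c5). vec c1 c2 c3 c4 c5)"
  have "inj_on F C"
  proof (rule inj_onI, clarsimp simp: F_def C_def)
    fix a1 a2 a3 a4 a5 c1 c2 c3 c4 c5
    assume c: "a1 \<in> carrier K" "a2 \<in> carrier K" "a3 \<in> carrier K" "a4 \<in> carrier K" "a5 \<in> carrier K"
      "c1 \<in> carrier K" "c2 \<in> carrier K" "c3 \<in> carrier K" "c4 \<in> carrier K" "c5 \<in> carrier K"
      and eq: "vec a1 a2 a3 a4 a5 = vec c1 c2 c3 c4 c5"
    show "a1 = c1 \<and> a2 = c2 \<and> a3 = c3 \<and> a4 = c4 \<and> a5 = c5"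
      using arg_cong[OF eq, of X1] arg_cong[OF eq, of X2] arg_cong[OF eq, of X3]
        arg_cong[OF eq, of X4] arg_cong[OF eq, of X5] c by simp
  qed
  then have "card (F ` C) = card C" by (rule card_image)
  also have "\<dots> = card (carrier V)"
    by (simp add: C_def card_cartesian_product card_V eval_nat_numeral)
  finally have "F ` C = carrier V"
    by (intro card_subset_eq finite_V) (auto simp: F_def C_def)
  with x obtain p where "p \<in> C" "x = F p" by blast
  then show ?thesis by (auto simp: F_def C_def)
qed

lemma h_coords:
  assumes x: "x \<in> carrier V" and y: "y \<in> carrier V"
  shows "h x y = X1 x \<otimes> cj (X2 y) \<oplus> X2 x \<otimes> cj (X1 y) \<oplus> X3 x \<otimes> cj (X4 y) \<oplus> X4 x \<otimes> cj (X3 y)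
    \<oplus> (X5 x \<otimes> cj (X5 y) \<oplus> X5 x \<otimes> cj (X5 y))"
proof -
  have "h y e5 = X5 y \<otimes> (\<one> \<oplus> \<one>)"
    using y two_neq_0 by (simp add: X5_def m_assoc)
  then have e5: "h e5 y = cj (X5 y) \<oplus> cj (X5 y)"
    using y h_swap[of y e5] by (simp add: r_distr)
  have "h (vec (X1 x) (X2 x) (X3 x) (X4 x) (X5 x)) y = X1 x \<otimes> h e1 y \<oplus> X2 x \<otimes> h e2 y \<oplus> X3 x \<otimes> h e3 y
      \<oplus> X4 x \<otimes> h e4 y \<oplus> X5 x \<otimes> h e5 y"
    unfolding vec_def using x y by simp
  then show ?thesis
    using x y h_swap[of y e1] h_swap[of y e2] h_swap[of y e3] h_swap[of y e4]
    by (simp add: e5 r_distr X_defs[symmetric] del: cj_add cj_mult)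
qed

end

section \<open>Half powers and nonsquares\<close>

context square_order_field
begin

definition m :: nat where "m = (q + 1) div 2"

lemma m_pos: "m > 0"
  using q_ge_3 by (simp add: m_def)

text \<open>Because of this, the \<open>m\<close>-th power of a quadratic form scales by the norm of
  the scalar.\<close>

lemma sq_pow_m:
  assumes "x \<in> carrier K"
  shows "(x \<otimes> x) [^] m = x \<otimes> cj x"
proof -
  have "(x \<otimes> x) [^] m = x [^] (2 * m)"
    using assms by (simp add: nat_pow_distrib nat_pow_mult mult_2)
  also have "2 * m = Suc q" using half_q by (simp add: m_def)
  finally show ?thesis using assms by (simp add: cj_def m_comm)
qed

text \<open>For y = x^m one has cj(y) = y^(q-1) y, so y^(q-1) = -1, and (q - 1) m is half of q^2 -
  1.\<close>

lemma half_pow_if_cj_neg: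
  assumes x: "x \<in> carrier K" "x \<noteq> \<zero>" and cj: "cj (x [^] m) = \<ominus> (x [^] m)"
  shows "x [^] ((q\<^sup>2 - 1) div 2) = \<ominus> \<one>"
proof -
  define y where "y = x [^] m"
  have y: "y \<in> carrier K" "y \<noteq> \<zero>" using x by (simp_all add: y_def)
  have "y [^] (q - 1) \<otimes> y = y [^] Suc (q - 1)" by simp
  also have "\<dots> = cj y" using q_ge_3 by (simp add: cj_def)
  also have "\<dots> = (\<ominus> \<one>) \<otimes> y" using cj y by (simp add: y_def[symmetric] l_minus)
  finally have "y [^] (q - 1) = \<ominus> \<one>"
    using y m_rcancel[of y "y [^] (q - 1)" "\<ominus> \<one>"] by simp
  then show ?thesis
    unfolding half_half using x by (simp add: y_def nat_pow_pow m_def mult.commute)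
qed

text \<open>Replacing 1 by -b cj(b) gives 1 + b^2 = b (b - cj(b)). Moreover b^2 cj(1 + b^2) = 1 +
  b^2, and taking \<open>m\<close>-th powers turns the factor b^2 into the norm -1.\<close>

lemma one_plus_square_nonsquare:
  assumes b: "b \<in> carrier K" "b \<otimes> cj b = \<ominus> \<one>" "cj b \<noteq> b"
  shows "\<one> \<oplus> b \<otimes> b \<noteq> \<zero>" "cj ((\<one> \<oplus> b \<otimes> b) [^] m) = \<ominus> ((\<one> \<oplus> b \<otimes> b) [^] m)"
proof -
  define t where "t = \<one> \<oplus> b \<otimes> b"
  have b0: "b \<noteq> \<zero>" using b by auto
  have t: "t \<in> carrier K" using b by (simp add: t_def)
  have "t = b \<otimes> b \<ominus> b \<otimes> cj b"
    using b by (simp add: t_def minus_eq a_comm)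
  also have "\<dots> = b \<otimes> (b \<ominus> cj b)"
    using b by (simp add: minus_eq r_distr r_minus)
  finally show "\<one> \<oplus> b \<otimes> b \<noteq> \<zero>"
    using b b0 diff_neq_0[of b "cj b"] by (auto simp: t_def[symmetric] integral_iff)
  have "(b \<otimes> b) \<otimes> cj t = b \<otimes> b \<oplus> (b \<otimes> cj b) \<otimes> (b \<otimes> cj b)"
    using b(1) by (simp add: t_def r_distr m_ac)
  also have "\<dots> = t" using b by (simp add: t_def a_comm l_minus)
  finally have "t [^] m = ((b \<otimes> b) \<otimes> cj t) [^] m" by simp
  also have "\<dots> = (b \<otimes> cj b) \<otimes> cj (t [^] m)"
    using b(1) t by (simp add: nat_pow_distrib[of "b \<otimes> b"] sq_pow_m cj_pow)
  also have "\<dots> = \<ominus> cj (t [^] m)" using b t by (simp add: l_minus)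
  finally have "t [^] m = \<ominus> cj (t [^] m)" .
  then show "cj ((\<one> \<oplus> b \<otimes> b) [^] m) = \<ominus> ((\<one> \<oplus> b \<otimes> b) [^] m)"
    using t minus_minus[of "cj (t [^] m)"] by (simp add: t_def[symmetric])
qed

text \<open>The product of two nonsquares is a square, say z^2 = x t, and z / x is the required
  factor.\<close>

lemma nonsquare_ratio:
  assumes x: "x \<in> carrier K" "x \<noteq> \<zero>" "cj (x [^] m) = \<ominus> (x [^] m)"
    and t: "t \<in> carrier K" "t \<noteq> \<zero>" "cj (t [^] m) = \<ominus> (t [^] m)"
  obtains z where "z \<in> carrier K" "z \<noteq> \<zero>" "z \<otimes> z \<otimes> x = t"
proof -
  have "(x \<otimes> t) [^] ((q\<^sup>2 - 1) div 2) = \<one>"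
    using half_pow_if_cj_neg[OF x] half_pow_if_cj_neg[OF t] x t
    by (simp add: nat_pow_distrib l_minus r_minus)
  then obtain z where z: "z \<in> carrier K" "z \<noteq> \<zero>" "z \<otimes> z = x \<otimes> t"
    using square_if_half_pow[of "x \<otimes> t"] x t by (metis integral m_closed)
  define z' where "z' = z \<otimes> inv x"
  have ix: "inv x \<in> carrier K" "x \<otimes> inv x = \<one>" "inv x \<noteq> \<zero>"
    using x nonzero_imp_inverse_nonzero by auto
  have "z' \<otimes> z' \<otimes> x = (z \<otimes> z) \<otimes> (inv x \<otimes> (x \<otimes> inv x))"
    using x(1) z(1) ix(1) by (simp add: z'_def m_ac)
  also have "\<dots> = t \<otimes> (x \<otimes> inv x) \<otimes> (x \<otimes> inv x)"
    using x(1) t(1) ix(1) unfolding z(3) by (simp add: m_ac)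
  also have "\<dots> = t" using t ix by simp
  finally show ?thesis
    using that[of z'] z ix by (simp add: z'_def integral_iff)
qed

end

section \<open>Points and totally isotropic lines\<close>

context hermitian_space
begin

definition pt :: "'v \<Rightarrow> 'v set" where "pt v = {c \<odot>\<^bsub>V\<^esub> v | c. c \<in> carrier K}"

lemma one_spaces_eq: "one_spaces K V = pt ` (carrier V - {\<zero>\<^bsub>V\<^esub>})"
  by (auto simp: one_spaces_def pt_def)

lemma mem_pt: "v \<in> carrier V \<Longrightarrow> v \<in> pt v"
  unfolding pt_def by (metis (mono_tags, lifting) V.smult_one mem_Collect_eq one_closed)

lemma pt_smult:
  assumes c: "c \<in> carrier K" "c \<noteq> \<zero>" and v: "v \<in> carrier V"
  shows "pt (c \<odot>\<^bsub>V\<^esub> v) = pt v"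
proof -
  have "a \<odot>\<^bsub>V\<^esub> v = (a \<otimes> inv c) \<odot>\<^bsub>V\<^esub> (c \<odot>\<^bsub>V\<^esub> v)" if "a \<in> carrier K" for a
    using that c v by (simp add: V.smult_assoc1[symmetric] m_assoc)
  moreover have "a \<odot>\<^bsub>V\<^esub> (c \<odot>\<^bsub>V\<^esub> v) = (a \<otimes> c) \<odot>\<^bsub>V\<^esub> v" if "a \<in> carrier K" for a
    using that c v by (simp add: V.smult_assoc1)
  ultimately show ?thesis
    using c unfolding pt_def by (safe; metis inv_closed m_closed)
qed

lemma pt_eqD: "\<lbrakk>pt v = pt w; v \<in> carrier V\<rbrakk> \<Longrightarrow> \<exists>c \<in> carrier K. v = c \<odot>\<^bsub>V\<^esub> w"
  using mem_pt[of v] by (auto simp: pt_def)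

lemma smult_eq_0_iff:
  assumes "c \<in> carrier K" "v \<in> carrier V"
  shows "c \<odot>\<^bsub>V\<^esub> v = \<zero>\<^bsub>V\<^esub> \<longleftrightarrow> c = \<zero> \<or> v = \<zero>\<^bsub>V\<^esub>"
proof -
  have "v = \<zero>\<^bsub>V\<^esub>" if "c \<odot>\<^bsub>V\<^esub> v = \<zero>\<^bsub>V\<^esub>" "c \<noteq> \<zero>"
  proof -
    have "v = inv c \<odot>\<^bsub>V\<^esub> (c \<odot>\<^bsub>V\<^esub> v)"
      using assms that(2) by (simp add: V.smult_assoc1[symmetric])
    then show ?thesis using assms that by simp
  qed
  then show ?thesis using assms by auto
qed

lemma smult_diff:
  assumes "a \<in> carrier K" "c \<in> carrier K" "v \<in> carrier V"
  shows "(a \<ominus> c) \<odot>\<^bsub>V\<^esub> v = a \<odot>\<^bsub>V\<^esub> v \<ominus>\<^bsub>V\<^esub> c \<odot>\<^bsub>V\<^esub> v"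
  using assms by (simp add: minus_eq V.minus_eq V.smult_l_distr V.smult_l_minus)

lemma V_transpose:
  assumes "a \<in> carrier V" "b \<in> carrier V" "c \<in> carrier V" "d \<in> carrier V"
    and "a \<oplus>\<^bsub>V\<^esub> b = c \<oplus>\<^bsub>V\<^esub> d"
  shows "a \<ominus>\<^bsub>V\<^esub> c = d \<ominus>\<^bsub>V\<^esub> b"
proof -
  have "a \<ominus>\<^bsub>V\<^esub> c = (a \<oplus>\<^bsub>V\<^esub> b) \<oplus>\<^bsub>V\<^esub> (\<ominus>\<^bsub>V\<^esub> b \<oplus>\<^bsub>V\<^esub> \<ominus>\<^bsub>V\<^esub> c)"
    using assms(1-4) by (simp add: V.minus_eq V.a_assoc V.r_neg2)
  also have "\<dots> = (\<ominus>\<^bsub>V\<^esub> c \<oplus>\<^bsub>V\<^esub> c) \<oplus>\<^bsub>V\<^esub> (d \<oplus>\<^bsub>V\<^esub> \<ominus>\<^bsub>V\<^esub> b)"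
    using assms(1-4) unfolding assms(5) by (simp add: V.a_ac)
  finally show ?thesis using assms(1-4) by (simp add: V.minus_eq V.l_neg)
qed

definition span2 :: "'v \<Rightarrow> 'v \<Rightarrow> 'v set" where
  "span2 v y = {a \<odot>\<^bsub>V\<^esub> v \<oplus>\<^bsub>V\<^esub> b \<odot>\<^bsub>V\<^esub> y | a b. a \<in> carrier K \<and> b \<in> carrier K}"

definition line :: "'v \<Rightarrow> 'v \<Rightarrow> 'v set set" where
  "line v y = pt ` (span2 v y - {\<zero>\<^bsub>V\<^esub>})"

text \<open>An ordered basis of a totally isotropic 2-space; the last two conditions express linear
  independence.\<close>

definition isotropic_pair :: "'v \<Rightarrow> 'v \<Rightarrow> bool" where
  "isotropic_pair v y \<longleftrightarrow> v \<in> carrier V \<and> y \<in> carrier V \<and> h v v = \<zero> \<and> h y y = \<zero> \<and> h v y = \<zero> \<and>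
     y \<noteq> \<zero>\<^bsub>V\<^esub> \<and> (\<forall>c \<in> carrier K. v \<noteq> c \<odot>\<^bsub>V\<^esub> y)"

lemma isotropic_pairD:
  assumes "isotropic_pair v y"
  shows "v \<in> carrier V" "y \<in> carrier V" "h v v = \<zero>" "h y y = \<zero>" "h v y = \<zero>" "h y v = \<zero>"
    "y \<noteq> \<zero>\<^bsub>V\<^esub>" "\<And>c. c \<in> carrier K \<Longrightarrow> v \<noteq> c \<odot>\<^bsub>V\<^esub> y"
  using assms h_eq_0_swap unfolding isotropic_pair_def by auto

text \<open>Transposing gives (a - c) v = (d - b) y, and a nonzero a - c would make \<open>v\<close>
  a multiple of \<open>y\<close>.\<close>

lemma isotropic_pair_unique:
  assumes vy: "isotropic_pair v y"
    and c: "a \<in> carrier K" "b \<in> carrier K" "c \<in> carrier K" "d \<in> carrier K"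
    and eq: "a \<odot>\<^bsub>V\<^esub> v \<oplus>\<^bsub>V\<^esub> b \<odot>\<^bsub>V\<^esub> y = c \<odot>\<^bsub>V\<^esub> v \<oplus>\<^bsub>V\<^esub> d \<odot>\<^bsub>V\<^esub> y"
  shows "a = c" "b = d"
proof -
  note vyD = isotropic_pairD[OF vy]
  have *: "(a \<ominus> c) \<odot>\<^bsub>V\<^esub> v = (d \<ominus> b) \<odot>\<^bsub>V\<^esub> y"
    using V_transpose[OF _ _ _ _ eq] vyD c by (simp add: smult_diff)
  show "a = c"
  proof (rule ccontr)
    assume "a \<noteq> c"
    then have ac: "a \<ominus> c \<in> carrier K" "a \<ominus> c \<noteq> \<zero>"
      using c diff_neq_0 by auto
    have "v = inv (a \<ominus> c) \<odot>\<^bsub>V\<^esub> ((a \<ominus> c) \<odot>\<^bsub>V\<^esub> v)"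
      using ac vyD by (simp add: V.smult_assoc1[symmetric])
    also have "\<dots> = (inv (a \<ominus> c) \<otimes> (d \<ominus> b)) \<odot>\<^bsub>V\<^esub> y"
      unfolding * using ac vyD c by (simp add: V.smult_assoc1)
    finally show False using vyD(8) ac c by auto
  qed
  then have "(d \<ominus> b) \<odot>\<^bsub>V\<^esub> y = \<zero>\<^bsub>V\<^esub>"
    using * c vyD(1,2) by (simp add: minus_eq r_neg)
  then have "d \<ominus> b = \<zero>"
    using c vyD(2,7) smult_eq_0_iff[of "d \<ominus> b" y] by simp
  then show "b = d"
    using c by simp
qed

lemma isotropic_pair_swap:
  assumes vy: "isotropic_pair v y"
  shows "isotropic_pair y v"
proof -
  note vyD = isotropic_pairD[OF vy]
  have "v \<noteq> \<zero>\<^bsub>V\<^esub>" using vyD(8)[of \<zero>] vyD(2) by simp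
  moreover have "y \<noteq> c \<odot>\<^bsub>V\<^esub> v" if "c \<in> carrier K" for c
    using isotropic_pair_unique[OF vy, of \<zero> \<one> c \<zero>] vyD(1,2) that by auto
  ultimately show ?thesis using vyD by (simp add: isotropic_pair_def)
qed

lemma isotropic_pair_scale:
  assumes vy: "isotropic_pair v y" and c: "c \<in> carrier K" "c \<noteq> \<zero>"
  shows "isotropic_pair (c \<odot>\<^bsub>V\<^esub> v) y"
proof -
  note vyD = isotropic_pairD[OF vy]
  have "c \<odot>\<^bsub>V\<^esub> v \<noteq> d \<odot>\<^bsub>V\<^esub> y" if "d \<in> carrier K" for d
    using isotropic_pair_unique[OF vy, of c \<zero> \<zero> d] vyD(1,2) that c by auto
  then show ?thesis using vyD c by (simp add: isotropic_pair_def)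
qed

lemma isotropic_pair_add:
  assumes vy: "isotropic_pair v y" and c: "c \<in> carrier K"
  shows "isotropic_pair (v \<oplus>\<^bsub>V\<^esub> c \<odot>\<^bsub>V\<^esub> y) y"
proof -
  note vyD = isotropic_pairD[OF vy]
  have "v \<oplus>\<^bsub>V\<^esub> c \<odot>\<^bsub>V\<^esub> y \<noteq> d \<odot>\<^bsub>V\<^esub> y" if "d \<in> carrier K" for d
    using isotropic_pair_unique[OF vy, of \<one> c \<zero> d] vyD(1,2) that c by auto
  then show ?thesis using vyD c by (simp add: isotropic_pair_def)
qed

lemma span2_swap:
  assumes "v \<in> carrier V" "y \<in> carrier V"
  shows "span2 y v = span2 v y"
proof -
  have "span2 y v \<subseteq> span2 v y" if "v \<in> carrier V" "y \<in> carrier V" for v y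
    using that by (auto simp: span2_def) (metis V.a_comm V.smult_closed)
  then show ?thesis using assms by blast
qed

lemma span2_scale:
  assumes "v \<in> carrier V" "y \<in> carrier V" and c: "c \<in> carrier K" "c \<noteq> \<zero>"
  shows "span2 (c \<odot>\<^bsub>V\<^esub> v) y = span2 v y"
proof -
  have *: "span2 (c \<odot>\<^bsub>V\<^esub> v) y \<subseteq> span2 v y" if "v \<in> carrier V" "c \<in> carrier K" for v c
  proof
    fix x assume "x \<in> span2 (c \<odot>\<^bsub>V\<^esub> v) y"
    then obtain a b where "a \<in> carrier K" "b \<in> carrier K" "x = a \<odot>\<^bsub>V\<^esub> (c \<odot>\<^bsub>V\<^esub> v) \<oplus>\<^bsub>V\<^esub> b \<odot>\<^bsub>V\<^esub> y"
      by (auto simp: span2_def)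
    then have "x = (a \<otimes> c) \<odot>\<^bsub>V\<^esub> v \<oplus>\<^bsub>V\<^esub> b \<odot>\<^bsub>V\<^esub> y" "a \<otimes> c \<in> carrier K" "b \<in> carrier K"
      using that by (simp_all add: V.smult_assoc1)
    then show "x \<in> span2 v y" unfolding span2_def by blast
  qed
  have "v = inv c \<odot>\<^bsub>V\<^esub> (c \<odot>\<^bsub>V\<^esub> v)"
    using assms by (simp add: V.smult_assoc1[symmetric])
  then have "span2 v y \<subseteq> span2 (c \<odot>\<^bsub>V\<^esub> v) y"
    using *[of "c \<odot>\<^bsub>V\<^esub> v" "inv c"] assms by simp
  then show ?thesis using * assms by blast
qed

lemma span2_add:
  assumes "v \<in> carrier V" "y \<in> carrier V" and c: "c \<in> carrier K"
  shows "span2 (v \<oplus>\<^bsub>V\<^esub> c \<odot>\<^bsub>V\<^esub> y) y = span2 v y"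
proof -
  have *: "span2 (v \<oplus>\<^bsub>V\<^esub> c \<odot>\<^bsub>V\<^esub> y) y \<subseteq> span2 v y" if "v \<in> carrier V" "c \<in> carrier K" for v c
  proof
    fix x assume "x \<in> span2 (v \<oplus>\<^bsub>V\<^esub> c \<odot>\<^bsub>V\<^esub> y) y"
    then obtain a b where ab: "a \<in> carrier K" "b \<in> carrier K"
      and x: "x = a \<odot>\<^bsub>V\<^esub> (v \<oplus>\<^bsub>V\<^esub> c \<odot>\<^bsub>V\<^esub> y) \<oplus>\<^bsub>V\<^esub> b \<odot>\<^bsub>V\<^esub> y"
      by (auto simp: span2_def)
    have "x = a \<odot>\<^bsub>V\<^esub> v \<oplus>\<^bsub>V\<^esub> (a \<otimes> c \<oplus> b) \<odot>\<^bsub>V\<^esub> y"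
      unfolding x using that ab assms(2)
      by (simp add: V.smult_assoc1 V.smult_l_distr V.smult_r_distr V.a_assoc)
    moreover have "a \<otimes> c \<oplus> b \<in> carrier K" using ab that by simp
    ultimately show "x \<in> span2 v y" using ab unfolding span2_def by blast
  qed
  have "v = (v \<oplus>\<^bsub>V\<^esub> c \<odot>\<^bsub>V\<^esub> y) \<oplus>\<^bsub>V\<^esub> (\<ominus> c) \<odot>\<^bsub>V\<^esub> y"
    using assms by (simp add: V.smult_l_minus V.a_assoc V.r_neg)
  then have "span2 v y \<subseteq> span2 (v \<oplus>\<^bsub>V\<^esub> c \<odot>\<^bsub>V\<^esub> y) y"
    using *[of "v \<oplus>\<^bsub>V\<^esub> c \<odot>\<^bsub>V\<^esub> y" "\<ominus> c"] assms by simp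
  then show ?thesis using * assms by blast
qed

text \<open>Exchange: a nonzero vector of the 2-space is completed to a basis by \<open>y\<close>
  or, if it is a multiple of \<open>y\<close>, by \<open>v\<close>.\<close>

lemma isotropic_pair_replace:
  assumes vy: "isotropic_pair v y" and x: "x \<in> span2 v y" "x \<noteq> \<zero>\<^bsub>V\<^esub>"
  obtains y' where "isotropic_pair x y'" "span2 x y' = span2 v y"
proof -
  note vyD = isotropic_pairD[OF vy]
  obtain a b where ab: "a \<in> carrier K" "b \<in> carrier K" and x_eq: "x = a \<odot>\<^bsub>V\<^esub> v \<oplus>\<^bsub>V\<^esub> b \<odot>\<^bsub>V\<^esub> y"
    using x by (auto simp: span2_def)
  show ?thesis
  proof (cases "a = \<zero>")
    case False
    show ?thesis
    proof (rule that[of y])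
      show "isotropic_pair x y"
        unfolding x_eq by (intro isotropic_pair_add isotropic_pair_scale vy ab False)
      show "span2 x y = span2 v y"
        unfolding x_eq using vyD ab False by (simp add: span2_add span2_scale)
    qed
  next
    case True
    then have x_eq: "x = b \<odot>\<^bsub>V\<^esub> y" using x_eq vyD ab by simp
    then have "b \<noteq> \<zero>" using x vyD by auto
    then show ?thesis
      using that[of v] isotropic_pair_scale[OF isotropic_pair_swap[OF vy] ab(2)] vyD ab
      by (simp add: x_eq span2_scale span2_swap[of v y])
  qed
qed

text \<open>The parameter on the line, with \<open>None\<close> for the point of \<open>y\<close>,
  is chosen to match the unknown of \<open>kappa_equation\<close>.\<close>

definition line_point :: "'v \<Rightarrow> 'v \<Rightarrow> 'a option \<Rightarrow> 'v set" where
  "line_point v y l = (case l of None \<Rightarrow> pt y | Some c \<Rightarrow> pt (v \<oplus>\<^bsub>V\<^esub> c \<odot>\<^bsub>V\<^esub> y))"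

lemma inj_on_line_point:
  assumes vy: "isotropic_pair v y"
  shows "inj_on (line_point v y) (insert None (Some ` carrier K))"
proof -
  note vyD = isotropic_pairD[OF vy]
  have 1: "c = d" if c: "c \<in> carrier K" "d \<in> carrier K" and eq: "pt (v \<oplus>\<^bsub>V\<^esub> c \<odot>\<^bsub>V\<^esub> y) = pt (v \<oplus>\<^bsub>V\<^esub> d \<odot>\<^bsub>V\<^esub> y)" for c d
  proof -
    obtain a where a: "a \<in> carrier K" "v \<oplus>\<^bsub>V\<^esub> c \<odot>\<^bsub>V\<^esub> y = a \<odot>\<^bsub>V\<^esub> (v \<oplus>\<^bsub>V\<^esub> d \<odot>\<^bsub>V\<^esub> y)"
      using pt_eqD[OF eq] vyD c by auto
    then have "\<one> \<odot>\<^bsub>V\<^esub> v \<oplus>\<^bsub>V\<^esub> c \<odot>\<^bsub>V\<^esub> y = a \<odot>\<^bsub>V\<^esub> v \<oplus>\<^bsub>V\<^esub> (a \<otimes> d) \<odot>\<^bsub>V\<^esub> y"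
      using vyD c by (simp add: V.smult_r_distr V.smult_assoc1)
    then have "\<one> = a" "c = a \<otimes> d"
      using isotropic_pair_unique[OF vy, of \<one> c a "a \<otimes> d"] a c by simp_all
    then show ?thesis using c by (metis l_one)
  qed
  have 2: "pt (v \<oplus>\<^bsub>V\<^esub> c \<odot>\<^bsub>V\<^esub> y) \<noteq> pt y" if c: "c \<in> carrier K" for c
  proof
    assume "pt (v \<oplus>\<^bsub>V\<^esub> c \<odot>\<^bsub>V\<^esub> y) = pt y"
    then obtain a where a: "a \<in> carrier K" "v \<oplus>\<^bsub>V\<^esub> c \<odot>\<^bsub>V\<^esub> y = a \<odot>\<^bsub>V\<^esub> y"
      using pt_eqD vyD c by blast
    then show False
      using isotropic_pair_unique(1)[OF vy, of \<one> c \<zero> a] vyD c by simp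
  qed
  show ?thesis
    by (rule inj_onI) (use 1 2 in \<open>auto simp: line_point_def dest: sym\<close>)
qed

text \<open>A nonzero combination of \<open>v\<close> and \<open>y\<close> can be rescaled to have
  first coefficient 1, unless it is a multiple of \<open>y\<close>, the point at infinity.\<close>

lemma line_eq:
  assumes vy: "isotropic_pair v y"
  shows "line v y = line_point v y ` insert None (Some ` carrier K)"
proof (intro equalityI subsetI)
  note vyD = isotropic_pairD[OF vy]
  fix U assume "U \<in> line v y"
  then obtain a b where ab: "a \<in> carrier K" "b \<in> carrier K"
    and ne: "a \<odot>\<^bsub>V\<^esub> v \<oplus>\<^bsub>V\<^esub> b \<odot>\<^bsub>V\<^esub> y \<noteq> \<zero>\<^bsub>V\<^esub>" and U: "U = pt (a \<odot>\<^bsub>V\<^esub> v \<oplus>\<^bsub>V\<^esub> b \<odot>\<^bsub>V\<^esub> y)"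
    by (auto simp: line_def span2_def)
  show "U \<in> line_point v y ` insert None (Some ` carrier K)"
  proof (cases "a = \<zero>")
    case True
    then have "b \<noteq> \<zero>" using ne vyD by auto
    then have "U = line_point v y None"
      using True U ab vyD by (simp add: line_point_def pt_smult)
    then show ?thesis by blast
  next
    case False
    have "a \<odot>\<^bsub>V\<^esub> v \<oplus>\<^bsub>V\<^esub> b \<odot>\<^bsub>V\<^esub> y = a \<odot>\<^bsub>V\<^esub> (v \<oplus>\<^bsub>V\<^esub> (inv a \<otimes> b) \<odot>\<^bsub>V\<^esub> y)"
      using ab vyD False by (simp add: V.smult_r_distr V.smult_assoc1[symmetric] m_assoc[symmetric])
    then have "U = line_point v y (Some (inv a \<otimes> b))"
      using U ab vyD False by (simp add: line_point_def pt_smult)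
    then show ?thesis using ab False by simp
  qed
next
  note vyD = isotropic_pairD[OF vy]
  fix U assume "U \<in> line_point v y ` insert None (Some ` carrier K)"
  then consider "U = pt y" | c where "c \<in> carrier K" "U = pt (v \<oplus>\<^bsub>V\<^esub> c \<odot>\<^bsub>V\<^esub> y)"
    by (auto simp: line_point_def)
  then show "U \<in> line v y"
  proof cases
    case 1
    have "y = \<zero> \<odot>\<^bsub>V\<^esub> v \<oplus>\<^bsub>V\<^esub> \<one> \<odot>\<^bsub>V\<^esub> y" using vyD by simp
    then have "y \<in> span2 v y" unfolding span2_def by blast
    then show ?thesis using 1 vyD by (auto simp: line_def)
  next
    case 2
    have "v \<oplus>\<^bsub>V\<^esub> c \<odot>\<^bsub>V\<^esub> y = \<one> \<odot>\<^bsub>V\<^esub> v \<oplus>\<^bsub>V\<^esub> c \<odot>\<^bsub>V\<^esub> y" using vyD by simp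
    then have "v \<oplus>\<^bsub>V\<^esub> c \<odot>\<^bsub>V\<^esub> y \<in> span2 v y" using 2(1) unfolding span2_def by blast
    moreover have "v \<oplus>\<^bsub>V\<^esub> c \<odot>\<^bsub>V\<^esub> y \<noteq> \<zero>\<^bsub>V\<^esub>"
      using isotropic_pair_unique(1)[OF vy, of \<one> c \<zero> \<zero>] vyD 2 by auto
    ultimately show ?thesis using 2 by (auto simp: line_def)
  qed
qed

end

section \<open>The forms Q and N on a totally isotropic line\<close>

context hyperbolic_frame
begin

definition Qf :: "'v \<Rightarrow> 'a" where
  "Qf x = X1 x \<otimes> X2 x \<oplus> X3 x \<otimes> X4 x \<oplus> X5 x \<otimes> X5 x"

text \<open>The polar form of \<open>Qf\<close>: the bilinear form with the same Gram matrix as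
  \<open>h\<close>.\<close>

definition Bf :: "'v \<Rightarrow> 'v \<Rightarrow> 'a" where
  "Bf x y = X1 x \<otimes> X2 y \<oplus> X2 x \<otimes> X1 y \<oplus> X3 x \<otimes> X4 y \<oplus> X4 x \<otimes> X3 y \<oplus> (X5 x \<otimes> X5 y \<oplus> X5 x \<otimes> X5 y)"

definition Nf :: "'v \<Rightarrow> 'a" where
  "Nf x = wedge (X1 x) (X3 x)"

text \<open>Demanding the equation of every vector in \<open>U\<close> avoids the choice of a
  representative; for a point, a single spanning vector decides.\<close>

definition level :: "'a \<Rightarrow> 'v set \<Rightarrow> bool" where
  "level \<kappa> U \<longleftrightarrow> (\<forall>x \<in> U. Nf x = \<kappa> \<otimes> Qf x [^] m)"

lemma Qf_closed [simp]: "x \<in> carrier V \<Longrightarrow> Qf x \<in> carrier K"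
  by (simp add: Qf_def)

lemma Bf_closed [simp]: "\<lbrakk>x \<in> carrier V; y \<in> carrier V\<rbrakk> \<Longrightarrow> Bf x y \<in> carrier K"
  by (simp add: Bf_def)

lemma Nf_closed [simp]: "x \<in> carrier V \<Longrightarrow> Nf x \<in> carrier K"
  by (simp add: Nf_def)

lemma Qf_smult:
  assumes [simp]: "c \<in> carrier K" "x \<in> carrier V"
  shows "Qf (c \<odot>\<^bsub>V\<^esub> x) = (c \<otimes> c) \<otimes> Qf x"
  unfolding Qf_def by simp (reify polex_eqs, rule polex_eqI, code_simp, simp_all)

lemma Qf_add:
  assumes [simp]: "c \<in> carrier K" "x \<in> carrier V" "y \<in> carrier V"
  shows "Qf (x \<oplus>\<^bsub>V\<^esub> c \<odot>\<^bsub>V\<^esub> y) = Qf x \<oplus> c \<otimes> Bf x y \<oplus> (c \<otimes> c) \<otimes> Qf y"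
  unfolding Qf_def Bf_def by simp (reify polex_eqs, rule polex_eqI, code_simp, simp_all)

lemma Bf_add_right:
  assumes [simp]: "c \<in> carrier K" "x \<in> carrier V" "y \<in> carrier V"
  shows "Bf x (y \<oplus>\<^bsub>V\<^esub> c \<odot>\<^bsub>V\<^esub> x) = Bf x y \<oplus> c \<otimes> (Qf x \<oplus> Qf x)"
  unfolding Qf_def Bf_def by simp (reify polex_eqs, rule polex_eqI, code_simp, simp_all)

lemma Nf_smult:
  assumes [simp]: "c \<in> carrier K" "x \<in> carrier V"
  shows "Nf (c \<odot>\<^bsub>V\<^esub> x) = (c \<otimes> cj c) \<otimes> Nf x"
  unfolding Nf_def by simp (reify polex_eqs, rule polex_eqI, code_simp, simp_all)

lemma cj_Nf:
  assumes [simp]: "x \<in> carrier V"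
  shows "cj (Nf x) = \<ominus> Nf x"
  unfolding Nf_def by simp (reify polex_eqs, rule polex_eqI, code_simp, simp_all)

lemma level_pt:
  assumes x: "x \<in> carrier V" and \<kappa>: "\<kappa> \<in> carrier K"
  shows "level \<kappa> (pt x) \<longleftrightarrow> Nf x = \<kappa> \<otimes> Qf x [^] m"
proof
  assume "level \<kappa> (pt x)"
  then show "Nf x = \<kappa> \<otimes> Qf x [^] m"
    using mem_pt[OF x] by (simp add: level_def)
next
  assume *: "Nf x = \<kappa> \<otimes> Qf x [^] m"
  have "Nf (c \<odot>\<^bsub>V\<^esub> x) = \<kappa> \<otimes> Qf (c \<odot>\<^bsub>V\<^esub> x) [^] m" if c: "c \<in> carrier K" for c
  proof -
    have "Qf (c \<odot>\<^bsub>V\<^esub> x) [^] m = (c \<otimes> cj c) \<otimes> Qf x [^] m"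
      using x c by (simp add: Qf_smult nat_pow_distrib[of "c \<otimes> c"] sq_pow_m)
    then show ?thesis
      using x c \<kappa> by (simp add: Nf_smult * m_ac)
  qed
  then show "level \<kappa> (pt x)"
    by (auto simp: level_def pt_def)
qed

lemma V_eq_0:
  assumes "x \<in> carrier V" "X1 x = \<zero>" "X2 x = \<zero>" "X3 x = \<zero>" "X4 x = \<zero>" "X5 x = \<zero>"
  shows "x = \<zero>\<^bsub>V\<^esub>"
  using vec_X[OF assms(1)] assms by (simp add: vec_def)

text \<open>As \<open>Bf v y\<close> vanishes, Q takes the value 1 + b^2 + a^2 Q(y) at v + a y, and
  \<open>line_coords\<close> turns the level condition at each point of the line into the equation
  of (C) with D \<kappa> in place of \<kappa>.\<close>

lemma card_line_level_normalized:
  assumes C: "condition_C"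
    and b: "b \<in> carrier K" "b \<otimes> cj b = \<ominus> \<one>" "cj b \<noteq> b"
    and \<kappa>: "\<kappa> \<in> carrier K" "\<kappa> \<noteq> \<zero>" "cj \<kappa> = \<kappa>"
    and vy: "isotropic_pair v y"
    and Qv: "Qf v = \<one> \<oplus> b \<otimes> b" and Nv: "Nf v \<noteq> \<zero>" and Bvy: "Bf v y = \<zero>"
  shows "card {U \<in> line v y. level (\<ominus> \<kappa>) U} = card {U \<in> line v y. level \<kappa> U}"
proof -
  note vyD = isotropic_pairD[OF vy]
  note [simp] = vyD(1,2) b(1) \<kappa>(1)
  obtain s u w D where c[simp]: "s \<in> carrier K" "u \<in> carrier K" "w \<in> carrier K"
    and D: "D \<in> carrier K" "D \<noteq> \<zero>" "cj D = D"
    and norms: "s \<otimes> cj s = u \<otimes> cj u \<oplus> w \<otimes> cj w"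
    and Qy: "X1 y \<otimes> X2 y \<oplus> X3 y \<otimes> X4 y \<oplus> X5 y \<otimes> X5 y = s \<otimes> s \<ominus> u \<otimes> u \<ominus> w \<otimes> w"
    and zero: "\<lbrakk>s = \<zero>; u = \<zero>; w = \<zero>\<rbrakk> \<Longrightarrow> X1 y = \<zero> \<and> X2 y = \<zero> \<and> X3 y = \<zero> \<and> X4 y = \<zero> \<and> X5 y = \<zero>"
    and N_line: "\<And>l. l \<in> carrier K \<Longrightarrow>
        wedge (w \<otimes> l \<oplus> \<one>) (b \<oplus> u \<otimes> l) = D \<otimes> wedge (X1 v \<oplus> l \<otimes> X1 y) (X3 v \<oplus> l \<otimes> X3 y)"
    and N_inf: "wedge w u = D \<otimes> wedge (X1 y) (X3 y)"
  proof (rule line_coords[of b "X1 v" "X2 v" "X3 v" "X4 v" "X5 v" "X1 y" "X2 y" "X3 y" "X4 y" "X5 y"])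
    show "X1 v \<otimes> cj (X2 v) \<oplus> X2 v \<otimes> cj (X1 v) \<oplus> X3 v \<otimes> cj (X4 v) \<oplus> X4 v \<otimes> cj (X3 v)
      \<oplus> (X5 v \<otimes> cj (X5 v) \<oplus> X5 v \<otimes> cj (X5 v)) = \<zero>"
      using h_coords[of v v] vyD(3) by simp
    show "X1 y \<otimes> cj (X2 v) \<oplus> X2 y \<otimes> cj (X1 v) \<oplus> X3 y \<otimes> cj (X4 v) \<oplus> X4 y \<otimes> cj (X3 v)
      \<oplus> (X5 y \<otimes> cj (X5 v) \<oplus> X5 y \<otimes> cj (X5 v)) = \<zero>"
      using h_coords[of y v] vyD(6) by simp
    show "X1 y \<otimes> cj (X2 y) \<oplus> X2 y \<otimes> cj (X1 y) \<oplus> X3 y \<otimes> cj (X4 y) \<oplus> X4 y \<otimes> cj (X3 y)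
      \<oplus> (X5 y \<otimes> cj (X5 y) \<oplus> X5 y \<otimes> cj (X5 y)) = \<zero>"
      using h_coords[of y y] vyD(4) by simp
  qed (use b Qv Nv Bvy in \<open>simp_all add: Qf_def Nf_def Bf_def\<close>)
  have ne: "(s, u, w) \<noteq> (\<zero>, \<zero>, \<zero>)"
    using zero V_eq_0[of y] vyD(7) by auto
  have level_iff: "level \<mu> (line_point v y l) \<longleftrightarrow> kappa_equation K q b s u w (D \<otimes> \<mu>) l"
    if \<mu>[simp]: "\<mu> \<in> carrier K" and l: "l \<in> insert None (Some ` carrier K)" for \<mu> l
  proof -
    \<comment> \<open>\<open>D\<close> is nonzero, so multiplying the level equation by it is
      reversible.\<close>
    have cancel: "D \<otimes> x = (D \<otimes> \<mu>) \<otimes> z \<longleftrightarrow> x = \<mu> \<otimes> z" if "x \<in> carrier K" "z \<in> carrier K" for x z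
      using that D m_lcancel[of D x "\<mu> \<otimes> z"] by (simp add: m_assoc)
    have Qy': "s [^] (2::nat) \<ominus> u [^] (2::nat) \<ominus> w [^] (2::nat) = Qf y"
      by (simp add: Qf_def Qy power2_eq_square)
    show ?thesis
    proof (cases l)
      case None
      have "level \<mu> (line_point v y l) \<longleftrightarrow> Nf y = \<mu> \<otimes> Qf y [^] m"
        by (simp add: None line_point_def level_pt)
      also have "\<dots> \<longleftrightarrow> wedge w u = (D \<otimes> \<mu>) \<otimes> Qf y [^] m"
        unfolding N_inf Nf_def[symmetric] by (rule cancel[symmetric]) simp_all
      finally show ?thesis
        by (simp only: None kappa_equation.simps Qy' m_def cj_def)
    next
      case (Some a)
      with l have a[simp]: "a \<in> carrier K" by auto
      have Q: "b [^] (2::nat) \<oplus> \<one> \<oplus> a [^] (2::nat) \<otimes> Qf y = Qf (v \<oplus>\<^bsub>V\<^esub> a \<odot>\<^bsub>V\<^esub> y)"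
        by (simp add: Qf_add Qv Bvy power2_eq_square a_comm)
      have N: "Nf (v \<oplus>\<^bsub>V\<^esub> a \<odot>\<^bsub>V\<^esub> y) = wedge (X1 v \<oplus> a \<otimes> X1 y) (X3 v \<oplus> a \<otimes> X3 y)"
        by (simp add: Nf_def)
      have "level \<mu> (line_point v y l) \<longleftrightarrow>
          Nf (v \<oplus>\<^bsub>V\<^esub> a \<odot>\<^bsub>V\<^esub> y) = \<mu> \<otimes> Qf (v \<oplus>\<^bsub>V\<^esub> a \<odot>\<^bsub>V\<^esub> y) [^] m"
        by (simp add: Some line_point_def level_pt)
      also have "\<dots> \<longleftrightarrow> wedge (w \<otimes> a \<oplus> \<one>) (b \<oplus> u \<otimes> a) = (D \<otimes> \<mu>) \<otimes> Qf (v \<oplus>\<^bsub>V\<^esub> a \<odot>\<^bsub>V\<^esub> y) [^] m"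
        unfolding N_line[OF a] N[symmetric] by (rule cancel[symmetric]) simp_all
      finally show ?thesis
        by (simp only: Some kappa_equation.simps Qy' Q m_def cj_def)
    qed
  qed
  have card_level: "card {U \<in> line v y. level \<mu> U} = kappa_count K q b s u w (D \<otimes> \<mu>)"
    if \<mu>: "\<mu> \<in> carrier K" for \<mu>
  proof -
    let ?O = "insert None (Some ` carrier K)"
    have "{U \<in> line v y. level \<mu> U} = line_point v y ` {l \<in> ?O. level \<mu> (line_point v y l)}"
      unfolding line_eq[OF vy] by blast
    also have "{l \<in> ?O. level \<mu> (line_point v y l)} = {l \<in> ?O. kappa_equation K q b s u w (D \<otimes> \<mu>) l}"
      using level_iff[OF \<mu>] by blast
    finally have "{U \<in> line v y. level \<mu> U} =
        line_point v y ` {l \<in> ?O. kappa_equation K q b s u w (D \<otimes> \<mu>) l}" .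
    moreover have "inj_on (line_point v y) {l \<in> ?O. kappa_equation K q b s u w (D \<otimes> \<mu>) l}"
      by (rule inj_on_subset[OF inj_on_line_point[OF vy]]) blast
    ultimately show ?thesis
      by (simp only: kappa_count_def card_image)
  qed
  \<comment> \<open>\<open>D\<close> is a unit fixed by \<open>cj\<close>, so (C) applies to D
    \<kappa>, and negating \<kappa> negates this product.\<close>
  have "D \<otimes> \<ominus> \<kappa> = \<ominus> (D \<otimes> \<kappa>)"
    using D by (simp add: r_minus)
  moreover have "D \<otimes> \<kappa> \<in> carrier K" "D \<otimes> \<kappa> \<noteq> \<zero>" "cj (D \<otimes> \<kappa>) = D \<otimes> \<kappa>"
    using D \<kappa> by (simp_all add: integral_iff)
  ultimately show ?thesis
    using kappa_count_neg[OF C b(1) c b(2) ne norms, of "D \<otimes> \<kappa>"] D by (simp add: card_level)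
qed

text \<open>Either the two level sets agree on the line, or some point of it allows a basis as in
  \<open>card_line_level_normalized\<close>.\<close>

lemma card_line_level:
  assumes C: "condition_C"
    and \<kappa>: "\<kappa> \<in> carrier K" "\<kappa> \<noteq> \<zero>" "cj \<kappa> = \<kappa>"
    and vy: "isotropic_pair v y"
  shows "card {U \<in> line v y. level (\<ominus> \<kappa>) U} = card {U \<in> line v y. level \<kappa> U}"
proof (cases "\<exists>x \<in> span2 v y - {\<zero>\<^bsub>V\<^esub>}. Nf x \<noteq> \<zero> \<and> (level \<kappa> (pt x) \<or> level (\<ominus> \<kappa>) (pt x))")
  case False
  note vyD = isotropic_pairD[OF vy]
  have "level (\<ominus> \<kappa>) (pt x) \<longleftrightarrow> level \<kappa> (pt x)" if x: "x \<in> span2 v y - {\<zero>\<^bsub>V\<^esub>}" for x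
  proof -
    have xV: "x \<in> carrier V" using x vyD by (auto simp: span2_def)
    \<comment> \<open>At a point with N = 0 the two level conditions are the two sides of this
      equivalence, with Q^m for \<open>z\<close>.\<close>
    have "\<kappa> \<otimes> z = \<zero> \<longleftrightarrow> \<ominus> \<kappa> \<otimes> z = \<zero>" if "z \<in> carrier K" for z
      using that \<kappa> by (simp add: l_minus integral_iff)
    then have "Nf x = \<zero> \<Longrightarrow> ?thesis"
      using xV \<kappa> by (metis level_pt a_inv_closed Qf_closed nat_pow_closed)
    then show ?thesis using False x by blast
  qed
  then have "{U \<in> line v y. level (\<ominus> \<kappa>) U} = {U \<in> line v y. level \<kappa> U}"
    by (auto simp: line_def)
  then show ?thesis by simp
next
  case True
  note vyD = isotropic_pairD[OF vy]
  \<comment> \<open>\<open>\<mu>\<close> is whichever of \<kappa> and -\<kappa> has the point in its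
    level set.\<close>
  obtain x \<mu> where x: "x \<in> span2 v y" "x \<noteq> \<zero>\<^bsub>V\<^esub>" "Nf x \<noteq> \<zero>"
    and \<mu>: "\<mu> \<in> carrier K" "cj \<mu> = \<mu>" "level \<mu> (pt x)"
    using True \<kappa> by (metis DiffE a_inv_closed cj_neg insertI1)
  have xV[simp]: "x \<in> carrier V" using x vyD by (auto simp: span2_def)
  have Nx: "Nf x = \<mu> \<otimes> Qf x [^] m"
    using \<mu> level_pt by simp
  have Qx0: "Qf x \<noteq> \<zero>"
    using x(3) Nx \<mu> m_pos by (auto simp: nat_pow_zero)
  \<comment> \<open>\<open>cj\<close> negates N and fixes \<mu>, hence it negates Q^m; this is how
    \<open>Qf x\<close> is recognised as a nonsquare.\<close>
  have "\<mu> \<otimes> cj (Qf x [^] m) = \<mu> \<otimes> \<ominus> (Qf x [^] m)"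
    using cj_Nf[of x] Nx \<mu> by (simp add: r_minus)
  moreover have "\<mu> \<noteq> \<zero>" using x(3) Nx by auto
  ultimately have Qx: "cj (Qf x [^] m) = \<ominus> (Qf x [^] m)"
    using \<mu> m_lcancel[of \<mu> "cj (Qf x [^] m)" "\<ominus> (Qf x [^] m)"] by simp
  obtain b where b: "b \<in> carrier K" "b \<otimes> cj b = \<ominus> \<one>" "cj b \<noteq> b"
    by (rule norm_minus_one_exists)
  define t where "t = \<one> \<oplus> b \<otimes> b"
  have t: "t \<in> carrier K" "t \<noteq> \<zero>" "cj (t [^] m) = \<ominus> (t [^] m)"
    using one_plus_square_nonsquare[OF b] b by (simp_all add: t_def)
  obtain z where z: "z \<in> carrier K" "z \<noteq> \<zero>" "z \<otimes> z \<otimes> Qf x = t"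
    by (rule nonsquare_ratio[OF _ Qx0 Qx t]) auto
  obtain y1 where y1: "isotropic_pair x y1" "span2 x y1 = span2 v y"
    by (rule isotropic_pair_replace[OF vy x(1,2)])
  define v' where "v' = z \<odot>\<^bsub>V\<^esub> x"
  have v'y1: "isotropic_pair v' y1"
    unfolding v'_def by (rule isotropic_pair_scale[OF y1(1) z(1,2)])
  note v'D = isotropic_pairD[OF v'y1]
  have Qv': "Qf v' = t" using z by (simp add: v'_def Qf_smult)
  have Nv': "Nf v' \<noteq> \<zero>" using z x(3) by (simp add: v'_def Nf_smult integral_iff)
  have tt: "t \<oplus> t \<in> carrier K" "t \<oplus> t \<noteq> \<zero>" using t two_cancel[of t] by auto
  \<comment> \<open>The coefficient solves B(v', y1) + 2 c Q(v') = 0, so that y1 + c v' is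
    orthogonal to \<open>v'\<close> for \<open>Bf\<close>.\<close>
  define c where "c = \<ominus> (Bf v' y1 \<otimes> inv (t \<oplus> t))"
  have c: "c \<in> carrier K" using tt v'D by (simp add: c_def)
  define y' where "y' = y1 \<oplus>\<^bsub>V\<^esub> c \<odot>\<^bsub>V\<^esub> v'"
  have v'y': "isotropic_pair v' y'"
    unfolding y'_def by (rule isotropic_pair_swap[OF isotropic_pair_add[OF isotropic_pair_swap[OF v'y1] c]])
  have "c \<otimes> (t \<oplus> t) = \<ominus> Bf v' y1"
    using tt v'D t(1) by (simp add: c_def l_minus m_assoc)
  then have B: "Bf v' y' = \<zero>"
    using v'D c by (simp add: y'_def Bf_add_right Qv' r_neg)
  \<comment> \<open>Rescaling \<open>x\<close>, exchanging and orthogonalising only change the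
    basis, not the line.\<close>
  have "span2 v' y' = span2 y' v'"
    using isotropic_pairD(1,2)[OF v'y'] by (rule span2_swap[symmetric])
  also have "\<dots> = span2 y1 v'" unfolding y'_def by (rule span2_add) (use v'D c in auto)
  also have "\<dots> = span2 v' y1" using v'D(1,2) by (rule span2_swap)
  also have "\<dots> = span2 v y" unfolding v'_def y1(2)[symmetric]
    by (rule span2_scale) (use isotropic_pairD[OF y1(1)] z in auto)
  finally have "line v' y' = line v y" by (simp add: line_def)
  then show ?thesis
    using card_line_level_normalized[OF C b \<kappa> v'y' _ Nv' B] Qv' by (simp add: t_def)
qed

end

section \<open>The projective semisimilarity group\<close>

context hermitian_space
begin

lemma semisimilarityE:
  assumes "semisimilarity K V h g"
  obtains \<theta> \<alpha> where "bij_betw g (carrier V) (carrier V)"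
    "\<And>x y. \<lbrakk>x \<in> carrier V; y \<in> carrier V\<rbrakk> \<Longrightarrow> g (x \<oplus>\<^bsub>V\<^esub> y) = g x \<oplus>\<^bsub>V\<^esub> g y"
    "\<theta> \<in> ring_iso K K" "\<alpha> \<in> carrier K" "\<alpha> \<noteq> \<zero>"
    "\<And>c x. \<lbrakk>c \<in> carrier K; x \<in> carrier V\<rbrakk> \<Longrightarrow> g (c \<odot>\<^bsub>V\<^esub> x) = \<theta> c \<odot>\<^bsub>V\<^esub> g x"
    "\<And>x y. \<lbrakk>x \<in> carrier V; y \<in> carrier V\<rbrakk> \<Longrightarrow> h (g x) (g y) = \<alpha> \<otimes> \<theta> (h x y)"
  using assms unfolding semisimilarity_def by blast

lemma semisimilarityI:
  assumes "bij_betw g (carrier V) (carrier V)"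
    "\<And>x y. \<lbrakk>x \<in> carrier V; y \<in> carrier V\<rbrakk> \<Longrightarrow> g (x \<oplus>\<^bsub>V\<^esub> y) = g x \<oplus>\<^bsub>V\<^esub> g y"
    "\<theta> \<in> ring_iso K K" "\<alpha> \<in> carrier K" "\<alpha> \<noteq> \<zero>"
    "\<And>c x. \<lbrakk>c \<in> carrier K; x \<in> carrier V\<rbrakk> \<Longrightarrow> g (c \<odot>\<^bsub>V\<^esub> x) = \<theta> c \<odot>\<^bsub>V\<^esub> g x"
    "\<And>x y. \<lbrakk>x \<in> carrier V; y \<in> carrier V\<rbrakk> \<Longrightarrow> h (g x) (g y) = \<alpha> \<otimes> \<theta> (h x y)"
  shows "semisimilarity K V h g"
  unfolding semisimilarity_def using assms by blast

lemma iso_facts: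
  assumes "\<theta> \<in> ring_iso K K"
  shows "\<And>x. x \<in> carrier K \<Longrightarrow> \<theta> x \<in> carrier K"
    "\<And>x y. \<lbrakk>x \<in> carrier K; y \<in> carrier K\<rbrakk> \<Longrightarrow> \<theta> (x \<otimes> y) = \<theta> x \<otimes> \<theta> y"
    "\<theta> \<one> = \<one>" "\<theta> \<zero> = \<zero>"
    "bij_betw \<theta> (carrier K) (carrier K)"
    "\<And>x. \<lbrakk>x \<in> carrier K; x \<noteq> \<zero>\<rbrakk> \<Longrightarrow> \<theta> x \<noteq> \<zero>"
proof -
  show cl: "\<theta> x \<in> carrier K" if "x \<in> carrier K" for x
    using assms that by (auto simp: ring_iso_def dest: ring_hom_closed)
  show mult: "\<theta> (x \<otimes> y) = \<theta> x \<otimes> \<theta> y" if "x \<in> carrier K" "y \<in> carrier K" for x y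
    using assms that by (auto simp: ring_iso_def dest: ring_hom_mult)
  show one: "\<theta> \<one> = \<one>"
    using assms by (auto simp: ring_iso_def dest: ring_hom_one)
  show bij: "bij_betw \<theta> (carrier K) (carrier K)"
    using assms by (auto simp: ring_iso_def)
  have "\<theta> (\<zero> \<oplus> \<zero>) = \<theta> \<zero> \<oplus> \<theta> \<zero>"
    using assms unfolding ring_iso_def by (metis (no_types, lifting) mem_Collect_eq ring_hom_add zero_closed)
  then show zero: "\<theta> \<zero> = \<zero>"
    using cl by simp
  show "\<theta> x \<noteq> \<zero>" if "x \<in> carrier K" "x \<noteq> \<zero>" for x
    using bij that zero by (metis bij_betw_inv_into_left zero_closed)
qed

lemma semisimilarity_id: "semisimilarity K V h id"
  by (rule semisimilarityI[where \<theta> = id and \<alpha> = \<one>]) (auto simp: ring_iso_set_refl)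

lemma semisimilarity_comp:
  assumes "semisimilarity K V h f" "semisimilarity K V h g"
  shows "semisimilarity K V h (f \<circ> g)"
  using assms(1)
proof (rule semisimilarityE)
  fix \<theta> \<alpha> assume f: "bij_betw f (carrier V) (carrier V)"
    "\<And>x y. \<lbrakk>x \<in> carrier V; y \<in> carrier V\<rbrakk> \<Longrightarrow> f (x \<oplus>\<^bsub>V\<^esub> y) = f x \<oplus>\<^bsub>V\<^esub> f y"
    "\<theta> \<in> ring_iso K K" "\<alpha> \<in> carrier K" "\<alpha> \<noteq> \<zero>"
    "\<And>c x. \<lbrakk>c \<in> carrier K; x \<in> carrier V\<rbrakk> \<Longrightarrow> f (c \<odot>\<^bsub>V\<^esub> x) = \<theta> c \<odot>\<^bsub>V\<^esub> f x"
    "\<And>x y. \<lbrakk>x \<in> carrier V; y \<in> carrier V\<rbrakk> \<Longrightarrow> h (f x) (f y) = \<alpha> \<otimes> \<theta> (h x y)"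
  show ?thesis
    using assms(2)
  proof (rule semisimilarityE)
    fix \<tau> \<beta> assume g: "bij_betw g (carrier V) (carrier V)"
      "\<And>x y. \<lbrakk>x \<in> carrier V; y \<in> carrier V\<rbrakk> \<Longrightarrow> g (x \<oplus>\<^bsub>V\<^esub> y) = g x \<oplus>\<^bsub>V\<^esub> g y"
      "\<tau> \<in> ring_iso K K" "\<beta> \<in> carrier K" "\<beta> \<noteq> \<zero>"
      "\<And>c x. \<lbrakk>c \<in> carrier K; x \<in> carrier V\<rbrakk> \<Longrightarrow> g (c \<odot>\<^bsub>V\<^esub> x) = \<tau> c \<odot>\<^bsub>V\<^esub> g x"
      "\<And>x y. \<lbrakk>x \<in> carrier V; y \<in> carrier V\<rbrakk> \<Longrightarrow> h (g x) (g y) = \<beta> \<otimes> \<tau> (h x y)"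
    note \<theta> = iso_facts[OF f(3)] and \<tau> = iso_facts[OF g(3)]
    have gV: "g x \<in> carrier V" if "x \<in> carrier V" for x
      using g(1) that by (auto simp: bij_betw_def)
    show ?thesis
    proof (rule semisimilarityI[where \<theta> = "\<theta> \<circ> \<tau>" and \<alpha> = "\<alpha> \<otimes> \<theta> \<beta>"])
      show "bij_betw (f \<circ> g) (carrier V) (carrier V)"
        by (rule bij_betw_trans[OF g(1) f(1)])
      show "\<theta> \<circ> \<tau> \<in> ring_iso K K"
        by (rule ring_iso_set_trans[OF g(3) f(3)])
    qed (use f g gV \<theta> \<tau> in \<open>auto simp: integral_iff m_assoc\<close>)
  qed
qed

text \<open>Solving h(g x, g y) = \<alpha> \<theta>(h(x, y)) for the form at the preimages shows
  that the inverse has field automorphism \<open>?\<tau>\<close> and multiplier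
  \<open>?\<tau> (inv \<alpha>)\<close>.\<close>

lemma semisimilarity_inv:
  assumes "semisimilarity K V h g"
  shows "semisimilarity K V h (inv_into (carrier V) g)"
  using assms
proof (rule semisimilarityE)
  fix \<theta> \<alpha> assume g: "bij_betw g (carrier V) (carrier V)"
    "\<And>x y. \<lbrakk>x \<in> carrier V; y \<in> carrier V\<rbrakk> \<Longrightarrow> g (x \<oplus>\<^bsub>V\<^esub> y) = g x \<oplus>\<^bsub>V\<^esub> g y"
    "\<theta> \<in> ring_iso K K" "\<alpha> \<in> carrier K" "\<alpha> \<noteq> \<zero>"
    "\<And>c x. \<lbrakk>c \<in> carrier K; x \<in> carrier V\<rbrakk> \<Longrightarrow> g (c \<odot>\<^bsub>V\<^esub> x) = \<theta> c \<odot>\<^bsub>V\<^esub> g x"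
    "\<And>x y. \<lbrakk>x \<in> carrier V; y \<in> carrier V\<rbrakk> \<Longrightarrow> h (g x) (g y) = \<alpha> \<otimes> \<theta> (h x y)"
  let ?f = "inv_into (carrier V) g" and ?\<tau> = "inv_into (carrier K) \<theta>"
  note \<theta> = iso_facts[OF g(3)]
  have \<tau>: "?\<tau> \<in> ring_iso K K"
    by (rule ring_iso_set_sym[OF ring_axioms g(3)])
  note \<tau>' = iso_facts[OF \<tau>]
  have f: "?f x \<in> carrier V" "g (?f x) = x" if "x \<in> carrier V" for x
    using g(1) that by (auto simp: bij_betw_def inv_into_into f_inv_into_f)
  have fg: "?f (g x) = x" if "x \<in> carrier V" for x
    using g(1) that by (simp add: bij_betw_def)
  have s: "\<theta> (?\<tau> x) = x" if "x \<in> carrier K" for x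
    using \<theta>(5) that by (simp add: bij_betw_inv_into_right)
  have t: "?\<tau> (\<theta> x) = x" if "x \<in> carrier K" for x
    using \<theta>(5) that by (simp add: bij_betw_def)
  show ?thesis
  proof (rule semisimilarityI[where \<theta> = ?\<tau> and \<alpha> = "?\<tau> (inv \<alpha>)"])
    show "bij_betw ?f (carrier V) (carrier V)"
      by (rule bij_betw_inv_into[OF g(1)])
    show "?f (x \<oplus>\<^bsub>V\<^esub> y) = ?f x \<oplus>\<^bsub>V\<^esub> ?f y" if "x \<in> carrier V" "y \<in> carrier V" for x y
      using fg[of "?f x \<oplus>\<^bsub>V\<^esub> ?f y"] g(2)[of "?f x" "?f y"] f that by simp
    show "?f (c \<odot>\<^bsub>V\<^esub> x) = ?\<tau> c \<odot>\<^bsub>V\<^esub> ?f x" if "c \<in> carrier K" "x \<in> carrier V" for c x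
      using fg[of "?\<tau> c \<odot>\<^bsub>V\<^esub> ?f x"] g(6)[of "?\<tau> c" "?f x"] f that \<tau>'(1) s by simp
    show "h (?f x) (?f y) = ?\<tau> (inv \<alpha>) \<otimes> ?\<tau> (h x y)" if xy: "x \<in> carrier V" "y \<in> carrier V" for x y
    proof -
      have "inv \<alpha> \<otimes> h x y = (inv \<alpha> \<otimes> \<alpha>) \<otimes> \<theta> (h (?f x) (?f y))"
        using g(7)[of "?f x" "?f y"] f xy \<theta>(1) g(4,5) by (simp add: m_assoc[symmetric])
      then have "?\<tau> (inv \<alpha> \<otimes> h x y) = h (?f x) (?f y)"
        using f xy \<theta>(1) g(4,5) t by simp
      then show ?thesis using xy g(4,5) \<tau>'(2) by simp
    qed
  qed (use \<tau> \<tau>' g(4,5) nonzero_imp_inverse_nonzero in auto)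
qed

lemma semisimilarity_facts:
  assumes "semisimilarity K V h g"
  shows "inj_on g (carrier V)" "g ` carrier V = carrier V"
    "\<And>v. v \<in> carrier V \<Longrightarrow> g v \<in> carrier V"
    "\<And>v. v \<in> carrier V \<Longrightarrow> g v = \<zero>\<^bsub>V\<^esub> \<longleftrightarrow> v = \<zero>\<^bsub>V\<^esub>"
    "\<And>v w. \<lbrakk>v \<in> carrier V; w \<in> carrier V\<rbrakk> \<Longrightarrow> h (g v) (g w) = \<zero> \<longleftrightarrow> h v w = \<zero>"
    "\<And>v. v \<in> carrier V \<Longrightarrow> g ` pt v = pt (g v)"
    "\<And>v y. \<lbrakk>v \<in> carrier V; y \<in> carrier V\<rbrakk> \<Longrightarrow> g ` span2 v y = span2 (g v) (g y)"
proof -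
  obtain \<theta> \<alpha> where g: "bij_betw g (carrier V) (carrier V)"
    "\<And>x y. \<lbrakk>x \<in> carrier V; y \<in> carrier V\<rbrakk> \<Longrightarrow> g (x \<oplus>\<^bsub>V\<^esub> y) = g x \<oplus>\<^bsub>V\<^esub> g y"
    "\<theta> \<in> ring_iso K K" "\<alpha> \<in> carrier K" "\<alpha> \<noteq> \<zero>"
    "\<And>c x. \<lbrakk>c \<in> carrier K; x \<in> carrier V\<rbrakk> \<Longrightarrow> g (c \<odot>\<^bsub>V\<^esub> x) = \<theta> c \<odot>\<^bsub>V\<^esub> g x"
    "\<And>x y. \<lbrakk>x \<in> carrier V; y \<in> carrier V\<rbrakk> \<Longrightarrow> h (g x) (g y) = \<alpha> \<otimes> \<theta> (h x y)"
    using semisimilarityE[OF assms] by metis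
  note \<theta> = iso_facts[OF g(3)]
  have \<theta>_img: "\<theta> ` carrier K = carrier K" using \<theta>(5) by (simp add: bij_betw_def)
  show inj: "inj_on g (carrier V)" and "g ` carrier V = carrier V"
    using g(1) by (auto simp: bij_betw_def)
  then show gV: "g v \<in> carrier V" if "v \<in> carrier V" for v
    using that by blast
  have g0: "g \<zero>\<^bsub>V\<^esub> = \<zero>\<^bsub>V\<^esub>"
    using g(6)[of \<zero> "\<zero>\<^bsub>V\<^esub>"] \<theta>(4) gV by simp
  show "g v = \<zero>\<^bsub>V\<^esub> \<longleftrightarrow> v = \<zero>\<^bsub>V\<^esub>" if "v \<in> carrier V" for v
    using inj_on_eq_iff[OF inj that V.zero_closed] g0 by simp
  show "h (g v) (g w) = \<zero> \<longleftrightarrow> h v w = \<zero>" if "v \<in> carrier V" "w \<in> carrier V" for v w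
  proof -
    have "\<theta> (h v w) = \<zero> \<longleftrightarrow> h v w = \<zero>"
      using that \<theta>(4,6) h_closed by metis
    then show ?thesis
      using that g(4,5) \<theta>(1) by (simp add: g(7) integral_iff)
  qed
  show "g ` pt v = pt (g v)" if v: "v \<in> carrier V" for v
  proof -
    \<comment> \<open>\<theta> permutes the scalars, so multiples by \<theta>(c) exhaust the point
      just as multiples by c do.\<close>
    have "pt v = (\<lambda>c. c \<odot>\<^bsub>V\<^esub> v) ` carrier K" "pt (g v) = (\<lambda>c. c \<odot>\<^bsub>V\<^esub> g v) ` (\<theta> ` carrier K)"
      by (auto simp: pt_def \<theta>_img)
    then show ?thesis using v g(6) by (simp add: image_image cong: image_cong)
  qed
  show "g ` span2 v y = span2 (g v) (g y)" if v: "v \<in> carrier V" "y \<in> carrier V" for v y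
  proof -
    have 1: "span2 v y = (\<lambda>(a, b). a \<odot>\<^bsub>V\<^esub> v \<oplus>\<^bsub>V\<^esub> b \<odot>\<^bsub>V\<^esub> y) ` (carrier K \<times> carrier K)" for v y
      by (auto simp: span2_def)
    have 2: "carrier K \<times> carrier K = map_prod \<theta> \<theta> ` (carrier K \<times> carrier K)"
      by (simp add: \<theta>_img flip: map_prod_surj_on)
    have "span2 (g v) (g y) = (\<lambda>(a, b). a \<odot>\<^bsub>V\<^esub> g v \<oplus>\<^bsub>V\<^esub> b \<odot>\<^bsub>V\<^esub> g y) ` (map_prod \<theta> \<theta> ` (carrier K \<times> carrier K))"
      using 1 2 by metis
    also have "\<dots> = g ` span2 v y"
      unfolding 1[of v y] image_image using v g(2,6) by (intro image_cong refl) auto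
    finally show ?thesis ..
  qed
qed

text \<open>Nondegeneracy makes a linear isometry injective, and finiteness of
  \<open>carrier V\<close> then makes it onto.\<close>

lemma isometry_semisimilarity:
  assumes gV: "\<And>x. x \<in> carrier V \<Longrightarrow> g x \<in> carrier V"
    and add: "\<And>x y. \<lbrakk>x \<in> carrier V; y \<in> carrier V\<rbrakk> \<Longrightarrow> g (x \<oplus>\<^bsub>V\<^esub> y) = g x \<oplus>\<^bsub>V\<^esub> g y"
    and smult: "\<And>c x. \<lbrakk>c \<in> carrier K; x \<in> carrier V\<rbrakk> \<Longrightarrow> g (c \<odot>\<^bsub>V\<^esub> x) = c \<odot>\<^bsub>V\<^esub> g x"
    and iso: "\<And>x y. \<lbrakk>x \<in> carrier V; y \<in> carrier V\<rbrakk> \<Longrightarrow> h (g x) (g y) = h x y"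
  shows "semisimilarity K V h g"
proof (rule semisimilarityI[where \<theta> = id and \<alpha> = \<one>])
  have "inj_on g (carrier V)"
  proof (rule inj_onI, rule ccontr)
    fix x y assume xy: "x \<in> carrier V" "y \<in> carrier V" "g x = g y" "x \<noteq> y"
    have "h (x \<ominus>\<^bsub>V\<^esub> y) z = \<zero>" if z: "z \<in> carrier V" for z
      using xy z iso[of x z] iso[of y z] by (simp add: r_neg minus_eq)
    then show False
      using nondeg xy V_minus_eq_0[of x y] unfolding nondegenerate_def by blast
  qed
  moreover from this have "g ` carrier V = carrier V"
    using gV by (intro endo_inj_surj finite_V) auto
  ultimately show "bij_betw g (carrier V) (carrier V)"
    by (simp add: bij_betw_def)
qed (use assms ring_iso_set_refl in auto)

section \<open>The group of induced permutations of the points\<close>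

definition point_map :: "('v \<Rightarrow> 'v) \<Rightarrow> 'v set \<Rightarrow> 'v set" where
  "point_map g = (\<lambda>U \<in> one_spaces K V. g ` U)"

abbreviation "\<Omega> \<equiv> isotropic_one_spaces K V h"

lemma \<Omega>_eq: "\<Omega> = pt ` {v \<in> carrier V. v \<noteq> \<zero>\<^bsub>V\<^esub> \<and> h v v = \<zero>}"
proof -
  have "(\<forall>x \<in> pt v. \<forall>y \<in> pt v. h x y = \<zero>) \<longleftrightarrow> h v v = \<zero>" if "v \<in> carrier V" for v
    using that mem_pt[OF that] by (auto simp: pt_def)
  then show ?thesis
    by (auto simp: isotropic_one_spaces_def one_spaces_eq)
qed

lemma \<Omega>_subset: "\<Omega> \<subseteq> one_spaces K V"
  by (auto simp: isotropic_one_spaces_def)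

lemma finite_\<Omega>: "finite \<Omega>"
  using finite_V by (simp add: \<Omega>_eq)

lemma image_bij_betw:
  assumes g: "semisimilarity K V h g"
  shows "bij_betw ((`) g) (one_spaces K V) (one_spaces K V)" "bij_betw ((`) g) \<Omega> \<Omega>"
proof -
  note gD = semisimilarity_facts[OF g]
  have sub: "U \<subseteq> carrier V" if "U \<in> one_spaces K V" for U
    using that by (auto simp: one_spaces_eq pt_def)
  have inj: "inj_on ((`) g) (one_spaces K V)"
    by (rule inj_on_subset[OF inj_on_image_Pow[OF gD(1)]]) (use sub in blast)
  have surj: "((`) g) ` (pt ` S) = pt ` (g ` S)" if "S \<subseteq> carrier V" for S
    unfolding image_image by (rule image_cong[OF refl]) (use that gD(6) in blast)
  have "g ` (carrier V - {\<zero>\<^bsub>V\<^esub>}) = carrier V - {\<zero>\<^bsub>V\<^esub>}"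
    using inj_on_image_set_diff[OF gD(1), of "carrier V" "{\<zero>\<^bsub>V\<^esub>}"] gD(2) gD(4)[of "\<zero>\<^bsub>V\<^esub>"] by simp
  then show "bij_betw ((`) g) (one_spaces K V) (one_spaces K V)"
    using inj surj[of "carrier V - {\<zero>\<^bsub>V\<^esub>}"] by (simp add: bij_betw_def one_spaces_eq)
  have "g ` {v \<in> carrier V. v \<noteq> \<zero>\<^bsub>V\<^esub> \<and> h v v = \<zero>} = {v \<in> carrier V. v \<noteq> \<zero>\<^bsub>V\<^esub> \<and> h v v = \<zero>}" (is "g ` ?S = ?S")
  proof (intro equalityI subsetI)
    fix w assume "w \<in> ?S"
    moreover from this obtain v where "v \<in> carrier V" "w = g v" using gD(2) by blast
    ultimately show "w \<in> g ` ?S" using gD(4,5) by auto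
  qed (use gD(3-5) in auto)
  moreover have "((`) g) ` (pt ` ?S) = pt ` (g ` ?S)"
    by (rule surj) blast
  ultimately have "((`) g) ` \<Omega> = \<Omega>"
    unfolding \<Omega>_eq by simp
  then show "bij_betw ((`) g) \<Omega> \<Omega>"
    using inj_on_subset[OF inj \<Omega>_subset] by (simp add: bij_betw_def)
qed

text \<open>\<open>Bij\<close> asks for extensional functions, which is why \<open>point_map\<close>
  is restricted to the points.\<close>

lemma point_map_Bij: "semisimilarity K V h g \<Longrightarrow> point_map g \<in> Bij (one_spaces K V)"
  using image_bij_betw(1)[of g]
  by (auto simp: Bij_def point_map_def cong: bij_betw_cong)

lemma compose_point_map:
  assumes f: "semisimilarity K V h f" and g: "semisimilarity K V h g"
  shows "compose (one_spaces K V) (point_map f) (point_map g) = point_map (f \<circ> g)"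
proof
  fix U
  have "g ` U \<in> one_spaces K V" if "U \<in> one_spaces K V"
    using that image_bij_betw(1)[OF g] by (auto simp: bij_betw_def)
  then show "compose (one_spaces K V) (point_map f) (point_map g) U = point_map (f \<circ> g) U"
    by (auto simp: compose_def point_map_def image_comp)
qed

lemma point_map_id: "point_map id = (\<lambda>U \<in> one_spaces K V. U)"
  by (auto simp: point_map_def)

lemma carrier_PGammaU: "carrier (PGammaU K V h) = {point_map g | g. semisimilarity K V h g}"
  by (simp add: PGammaU_def point_map_def)

text \<open>The group is a subgroup of all permutations of the points: composites and inverses of
  semisimilarities induce the products and inverses.\<close>

lemma PGammaU_group: "group (PGammaU K V h)"
proof -
  interpret B: group "BijGroup (one_spaces K V)" by (rule group_BijGroup)
  have mult: "point_map f \<otimes>\<^bsub>BijGroup (one_spaces K V)\<^esub> point_map g = point_map (f \<circ> g)"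
    if "semisimilarity K V h f" "semisimilarity K V h g" for f g
    using that by (simp add: BijGroup_def point_map_Bij compose_point_map)
  have "subgroup {point_map g | g. semisimilarity K V h g} (BijGroup (one_spaces K V))"
  proof (rule B.subgroupI)
    show "{point_map g | g. semisimilarity K V h g} \<subseteq> carrier (BijGroup (one_spaces K V))"
      by (auto simp: BijGroup_def point_map_Bij)
    show "{point_map g | g. semisimilarity K V h g} \<noteq> {}"
      using semisimilarity_id by blast
  next
    fix a assume "a \<in> {point_map g | g. semisimilarity K V h g}"
    then obtain g where g: "semisimilarity K V h g" "a = point_map g" by blast
    let ?f = "inv_into (carrier V) g"
    have f: "semisimilarity K V h ?f" by (rule semisimilarity_inv[OF g(1)])
    have "point_map (?f \<circ> g) = point_map id"
    proof
      fix U
      have "(?f \<circ> g) ` U = id ` U" if "U \<in> one_spaces K V"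
      proof (rule image_cong[OF refl])
        fix x assume "x \<in> U"
        then have "x \<in> carrier V" using that by (auto simp: one_spaces_eq pt_def)
        then show "(?f \<circ> g) x = id x" using semisimilarity_facts(1)[OF g(1)] by simp
      qed
      then show "point_map (?f \<circ> g) U = point_map id U" by (simp add: point_map_def)
    qed
    then have "point_map ?f \<otimes>\<^bsub>BijGroup (one_spaces K V)\<^esub> a = \<one>\<^bsub>BijGroup (one_spaces K V)\<^esub>"
      unfolding g(2) mult[OF f g(1)] by (simp only: point_map_id) (simp add: BijGroup_def)
    then have "inv\<^bsub>BijGroup (one_spaces K V)\<^esub> a = point_map ?f"
      using f g by (intro B.inv_equality) (auto simp: BijGroup_def point_map_Bij)
    then show "inv\<^bsub>BijGroup (one_spaces K V)\<^esub> a \<in> {point_map g | g. semisimilarity K V h g}"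
      using f by blast
  next
    fix a b assume "a \<in> {point_map g | g. semisimilarity K V h g}" "b \<in> {point_map g | g. semisimilarity K V h g}"
    then show "a \<otimes>\<^bsub>BijGroup (one_spaces K V)\<^esub> b \<in> {point_map g | g. semisimilarity K V h g}"
      using mult semisimilarity_comp by blast
  qed
  then show ?thesis
    using B.subgroup_imp_group by (simp add: PGammaU_def point_map_def)
qed

lemma PGammaU_action: "group_action (PGammaU K V h) \<Omega> (\<lambda>\<pi>. restrict \<pi> \<Omega>)"
proof -
  have Bij: "restrict (point_map g) \<Omega> \<in> Bij \<Omega>" if "semisimilarity K V h g" for g
  proof -
    have "restrict (point_map g) \<Omega> U = g ` U" if "U \<in> \<Omega>" for U
      using that \<Omega>_subset by (auto simp: point_map_def)
    then have "bij_betw (restrict (point_map g) \<Omega>) \<Omega> \<Omega>"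
      using image_bij_betw(2)[OF that] by (simp cong: bij_betw_cong)
    then show ?thesis by (simp add: Bij_def)
  qed
  have "(\<lambda>\<pi>. restrict \<pi> \<Omega>) \<in> hom (PGammaU K V h) (BijGroup \<Omega>)"
  proof (rule homI)
    fix \<pi> assume "\<pi> \<in> carrier (PGammaU K V h)"
    then show "restrict \<pi> \<Omega> \<in> carrier (BijGroup \<Omega>)"
      using Bij by (auto simp: carrier_PGammaU BijGroup_def)
  next
    fix \<pi> \<rho> assume "\<pi> \<in> carrier (PGammaU K V h)" "\<rho> \<in> carrier (PGammaU K V h)"
    then obtain f g where f: "semisimilarity K V h f" "\<pi> = point_map f"
      and g: "semisimilarity K V h g" "\<rho> = point_map g"
      by (auto simp: carrier_PGammaU)
    have "\<pi> \<otimes>\<^bsub>PGammaU K V h\<^esub> \<rho> = compose (one_spaces K V) (point_map f) (point_map g)"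
      using f g by (simp add: PGammaU_def BijGroup_def point_map_Bij)
    moreover have "restrict (compose (one_spaces K V) (point_map f) (point_map g)) \<Omega> =
        compose \<Omega> (restrict (point_map f) \<Omega>) (restrict (point_map g) \<Omega>)"
    proof
      fix U
      have "point_map g U \<in> \<Omega>" if "U \<in> \<Omega>"
        using that image_bij_betw(2)[OF g(1)] \<Omega>_subset by (auto simp: bij_betw_def point_map_def)
      then show "restrict (compose (one_spaces K V) (point_map f) (point_map g)) \<Omega> U =
        compose \<Omega> (restrict (point_map f) \<Omega>) (restrict (point_map g) \<Omega>) U"
        using \<Omega>_subset by (auto simp: compose_def)
    qed
    ultimately show "restrict (\<pi> \<otimes>\<^bsub>PGammaU K V h\<^esub> \<rho>) \<Omega> =
        restrict \<pi> \<Omega> \<otimes>\<^bsub>BijGroup \<Omega>\<^esub> restrict \<rho> \<Omega>"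
      using f g Bij by (simp add: BijGroup_def)
  qed
  then show ?thesis
    using PGammaU_group group_BijGroup
    by (intro group_action.intro group_hom.intro group_hom_axioms.intro)
qed

section \<open>Transitivity on isotropic points\<close>

text \<open>A quasi-reflection along \<open>x - y\<close> is an isometry because
  \<open>h d d = h x d + cj (h x d)\<close> for \<open>d = x - y\<close>.\<close>

lemma isometry_exists:
  assumes [simp]: "x \<in> carrier V" "y \<in> carrier V" and xx: "h x x = \<zero>" "h y y = \<zero>" and xy: "h x y \<noteq> \<zero>"
  shows "\<exists>g. semisimilarity K V h g \<and> g x = y"
proof -
  define d where "d = x \<ominus>\<^bsub>V\<^esub> y"
  have d[simp]: "d \<in> carrier V" by (simp add: d_def)
  define k where "k = h x d"
  have k: "k = \<ominus> h x y" by (simp add: k_def d_def xx)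
  have "\<ominus> k = h x y" unfolding k by simp
  then have k0: "k \<in> carrier K" "k \<noteq> \<zero>"
    using xy by (auto simp: k)
  define e where "e = inv k"
  have e[simp]: "k \<in> carrier K" "e \<in> carrier K" and ek: "e \<otimes> k = \<one>"
    using k0 by (simp_all add: e_def)
  have ek': "cj e \<otimes> cj k = \<one>"
    using arg_cong[OF ek, of cj] by simp
  have "h y d = \<ominus> cj k"
    unfolding k using h_swap[of x y] by (simp add: d_def xx)
  then have dd: "h d d = k \<oplus> cj k"
    unfolding k_def by (subst d_def) (simp add: minus_eq)
  \<comment> \<open>Dividing by k = h(x, d) makes the coefficient of \<open>d\<close> at
    \<open>x\<close> equal to 1, so that g(x) = x - d = y.\<close>
  define g where "g z = z \<ominus>\<^bsub>V\<^esub> (h z d \<otimes> e) \<odot>\<^bsub>V\<^esub> d" for z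
  have "h (g z) (g u) = h z u" if [simp]: "z \<in> carrier V" "u \<in> carrier V" for z u
  proof -
    have du: "h d u = cj (h u d)" by (rule h_swap) simp_all
    \<comment> \<open>With h(d, d) = k + cj(k), the deviation from an isometry is grouped into
      multiples of e k - 1 and of its conjugate.\<close>
    have "h (g z) (g u) = h z u
        \<oplus> (h z d \<otimes> cj (h u d) \<otimes> cj e) \<otimes> (e \<otimes> k \<ominus> \<one>)
        \<oplus> (h z d \<otimes> cj (h u d) \<otimes> e) \<otimes> (cj e \<otimes> cj k \<ominus> \<one>)"
      unfolding g_def by (simp add: dd du) (reify polex_eqs, rule polex_eqI, code_simp, simp_all)
    then show ?thesis by (simp add: ek ek' minus_eq r_neg)
  qed
  moreover have "g (z \<oplus>\<^bsub>V\<^esub> u) = g z \<oplus>\<^bsub>V\<^esub> g u" if "z \<in> carrier V" "u \<in> carrier V" for z u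
    using that by (simp add: g_def l_distr V.smult_l_distr V.minus_eq V.minus_add V.a_ac)
  moreover have "g (c \<odot>\<^bsub>V\<^esub> z) = c \<odot>\<^bsub>V\<^esub> g z" if "c \<in> carrier K" "z \<in> carrier V" for c z
    using that by (simp add: g_def m_assoc V.smult_assoc1 V.minus_eq V.smult_r_distr V.smult_r_minus)
  moreover have "g z \<in> carrier V" if "z \<in> carrier V" for z
    using that by (simp add: g_def)
  ultimately have "semisimilarity K V h g"
    by (intro isometry_semisimilarity)
  moreover have "g x = y"
  proof -
    have "g x = x \<ominus>\<^bsub>V\<^esub> d"
      unfolding g_def k_def[symmetric] using ek by (simp add: m_comm)
    also have "\<dots> = y"
      by (simp add: d_def V.minus_eq V.minus_add V.r_neg V.r_neg2 V.a_assoc[symmetric])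
    finally show ?thesis .
  qed
  ultimately show ?thesis by blast
qed

text \<open>A vector \<open>v\<close> orthogonal to neither \<open>x\<close> nor \<open>y\<close> is
  made isotropic by adding a multiple of \<open>x\<close>; this affects neither pairing, because
  \<open>x\<close> is orthogonal to itself and to \<open>y\<close>.\<close>

lemma isotropic_connector:
  assumes [simp]: "x \<in> carrier V" "y \<in> carrier V" and xx: "h x x = \<zero>" and xy: "h x y = \<zero>"
    and ne: "x \<noteq> \<zero>\<^bsub>V\<^esub>" "y \<noteq> \<zero>\<^bsub>V\<^esub>"
  shows "\<exists>z \<in> carrier V. h z z = \<zero> \<and> h x z \<noteq> \<zero> \<and> h z y \<noteq> \<zero>"
proof -
  obtain a where a[simp]: "a \<in> carrier V" and xa: "h x a \<noteq> \<zero>"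
    using nondeg ne(1) assms(1) unfolding nondegenerate_def by blast
  obtain b where b[simp]: "b \<in> carrier V" and yb: "h y b \<noteq> \<zero>"
    using nondeg ne(2) assms(2) unfolding nondegenerate_def by blast
  have "\<exists>v \<in> carrier V. h x v \<noteq> \<zero> \<and> h y v \<noteq> \<zero>"
  \<comment> \<open>If \<open>a\<close> is orthogonal to \<open>y\<close> and \<open>b\<close> to
    \<open>x\<close>, their sum works; otherwise one of them does.\<close>
  proof (cases "h y a = \<zero> \<and> h x b = \<zero>")
    case True
    then have "h x (a \<oplus>\<^bsub>V\<^esub> b) \<noteq> \<zero>" "h y (a \<oplus>\<^bsub>V\<^esub> b) \<noteq> \<zero>" using xa yb by simp_all
    then show ?thesis by (meson V.a_closed a b)
  next
    case False
    then show ?thesis using xa yb a b by blast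
  qed
  then obtain v where v[simp]: "v \<in> carrier V" and xv: "h x v \<noteq> \<zero>" and yv: "h y v \<noteq> \<zero>" by blast
  define r where "r = inv (\<one> \<oplus> \<one>)"
  have r[simp]: "r \<in> carrier K" "cj r = r" and rr: "r \<oplus> r = \<one>"
  proof -
    show "r \<in> carrier K" "cj r = r" using two_neq_0 by (simp_all add: r_def)
    then have "r \<oplus> r = r \<otimes> (\<one> \<oplus> \<one>)" by (simp add: r_distr)
    also have "\<dots> = \<one>" using two_neq_0 by (simp add: r_def)
    finally show "r \<oplus> r = \<one>" .
  qed
  \<comment> \<open>Chosen so that c h(x, v) and its conjugate each contribute -h(v, v)/2 to
    \<open>h z z\<close>.\<close>
  define c where "c = \<ominus> (h v v \<otimes> r \<otimes> inv (h x v))"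
  have c[simp]: "c \<in> carrier K" using xv by (simp add: c_def)
  have cx: "c \<otimes> h x v = \<ominus> (h v v \<otimes> r)"
    using xv by (simp add: c_def l_minus m_assoc)
  define z where "z = v \<oplus>\<^bsub>V\<^esub> c \<odot>\<^bsub>V\<^esub> x"
  have z: "z \<in> carrier V" by (simp add: z_def)
  have "cj c \<otimes> h v x = cj (c \<otimes> h x v)"
    using h_swap[of x v] by simp
  also have "\<dots> = \<ominus> (h v v \<otimes> r)"
    unfolding cx using h_self_real[of v] by simp
  finally have cx': "cj c \<otimes> h v x = \<ominus> (h v v \<otimes> r)" .
  have "h z z = h v v \<otimes> (\<one> \<ominus> (r \<oplus> r))"
    unfolding z_def
    by (simp add: cx cx' xx) (reify polex_eqs, rule polex_eqI, code_simp, simp_all)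
  then have zz: "h z z = \<zero>" by (simp add: rr minus_eq r_neg)
  have "h x z \<noteq> \<zero>" using xv xx by (simp add: z_def)
  moreover have "h z y \<noteq> \<zero>"
    using yv xy h_eq_0_swap[of v y] by (simp add: z_def)
  ultimately show ?thesis using z zz by blast
qed

text \<open>Vectors that are orthogonal are joined by two isometries, through an isotropic vector
  orthogonal to neither.\<close>

lemma isotropic_transitive:
  assumes x: "x \<in> carrier V" "x \<noteq> \<zero>\<^bsub>V\<^esub>" "h x x = \<zero>"
    and y: "y \<in> carrier V" "y \<noteq> \<zero>\<^bsub>V\<^esub>" "h y y = \<zero>"
  shows "\<exists>g. semisimilarity K V h g \<and> g x = y"
proof (cases "h x y = \<zero>")
  case False
  then show ?thesis using isometry_exists x y by blast
next
  case True
  obtain z where z: "z \<in> carrier V" "h z z = \<zero>" "h x z \<noteq> \<zero>" "h z y \<noteq> \<zero>"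
    using isotropic_connector[OF x(1) y(1) x(3) True x(2) y(2)] by blast
  obtain f g where "semisimilarity K V h f" "f x = z" "semisimilarity K V h g" "g z = y"
    using isometry_exists[of x z] isometry_exists[of z y] x y z by blast
  then have "semisimilarity K V h (g \<circ> f)" "(g \<circ> f) x = y"
    by (auto intro: semisimilarity_comp)
  then show ?thesis by blast
qed

lemma PGammaU_transitive: "transitive_action (PGammaU K V h) \<Omega> (\<lambda>\<pi>. restrict \<pi> \<Omega>)"
proof (rule transitive_action.intro[OF PGammaU_action], rule transitive_action_axioms.intro)
  fix U W assume UW: "U \<in> \<Omega>" "W \<in> \<Omega>"
  then obtain x y where x: "x \<in> carrier V" "x \<noteq> \<zero>\<^bsub>V\<^esub>" "h x x = \<zero>" "U = pt x"
    and y: "y \<in> carrier V" "y \<noteq> \<zero>\<^bsub>V\<^esub>" "h y y = \<zero>" "W = pt y"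
    by (auto simp: \<Omega>_eq)
  obtain g where g: "semisimilarity K V h g" "g x = y"
    using isotropic_transitive[OF x(1-3) y(1-3)] by blast
  have "restrict (point_map g) \<Omega> U = g ` U"
    using UW \<Omega>_subset by (auto simp: point_map_def)
  then have "restrict (point_map g) \<Omega> U = W"
    using semisimilarity_facts(6)[OF g(1) x(1)] g x y by simp
  then show "\<exists>\<pi> \<in> carrier (PGammaU K V h). restrict \<pi> \<Omega> U = W"
    using g by (auto simp: carrier_PGammaU)
qed

end

section \<open>The nontrivial multiset and set\<close>

context hyperbolic_frame
begin

definition swap :: "'v \<Rightarrow> 'v" where
  "swap x = vec (X3 x) (X4 x) (X1 x) (X2 x) (X5 x)"

lemma swap_closed [simp]: "x \<in> carrier V \<Longrightarrow> swap x \<in> carrier V"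
  by (simp add: swap_def)

lemma X_swap [simp]:
  assumes "x \<in> carrier V"
  shows "X1 (swap x) = X3 x" "X2 (swap x) = X4 x" "X3 (swap x) = X1 x" "X4 (swap x) = X2 x"
    "X5 (swap x) = X5 x"
  using assms by (simp_all add: swap_def)

lemma V_eqI:
  assumes "x \<in> carrier V" "y \<in> carrier V" "X1 x = X1 y" "X2 x = X2 y" "X3 x = X3 y" "X4 x = X4 y"
    "X5 x = X5 y"
  shows "x = y"
  using vec_X[OF assms(1)] unfolding assms(3-) vec_X[OF assms(2)] by (rule sym)

lemma swap_semisimilarity: "semisimilarity K V h swap"
proof (rule isometry_semisimilarity)
  show "swap (x \<oplus>\<^bsub>V\<^esub> y) = swap x \<oplus>\<^bsub>V\<^esub> swap y" if "x \<in> carrier V" "y \<in> carrier V" for x y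
    by (rule V_eqI) (use that in simp_all)
  show "swap (c \<odot>\<^bsub>V\<^esub> x) = c \<odot>\<^bsub>V\<^esub> swap x" if "c \<in> carrier K" "x \<in> carrier V" for c x
    by (rule V_eqI) (use that in simp_all)
  show "h (swap x) (swap y) = h x y" if [simp]: "x \<in> carrier V" "y \<in> carrier V" for x y
    by (simp add: h_coords) (reify polex_eqs, rule polex_eqI, code_simp, simp_all)
qed simp

lemma Qf_swap: "x \<in> carrier V \<Longrightarrow> Qf (swap x) = Qf x"
  by (simp add: Qf_def a_ac)

lemma Nf_swap:
  assumes [simp]: "x \<in> carrier V"
  shows "Nf (swap x) = \<ominus> Nf x"
  unfolding Nf_def by simp (reify polex_eqs, rule polex_eqI, code_simp, simp_all)

lemma level_swap:
  assumes U: "U \<in> \<Omega>" and \<kappa>: "\<kappa> \<in> carrier K"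
  shows "level \<kappa> (swap ` U) \<longleftrightarrow> level (\<ominus> \<kappa>) U"
proof -
  obtain x where x: "x \<in> carrier V" "U = pt x"
    using U by (auto simp: \<Omega>_eq)
  have "swap ` U = pt (swap x)"
    using semisimilarity_facts(6)[OF swap_semisimilarity] x by simp
  moreover have "\<ominus> Nf x = \<kappa> \<otimes> Qf x [^] m \<longleftrightarrow> Nf x = \<ominus> \<kappa> \<otimes> Qf x [^] m"
    using x \<kappa> minus_minus by (metis Nf_closed Qf_closed l_minus m_closed nat_pow_closed)
  ultimately show ?thesis
    using x \<kappa> by (simp add: level_pt Qf_swap Nf_swap)
qed

text \<open>The isometry \<open>swap\<close> permutes the isotropic points and exchanges the two
  level sets.\<close>

lemma card_\<Omega>_level:
  assumes \<kappa>: "\<kappa> \<in> carrier K"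
  shows "card {U \<in> \<Omega>. level (\<ominus> \<kappa>) U} = card {U \<in> \<Omega>. level \<kappa> U}"
proof -
  have bij: "bij_betw ((`) swap) \<Omega> \<Omega>"
    by (rule image_bij_betw(2)[OF swap_semisimilarity])
  have "{U \<in> ((`) swap) ` \<Omega>. level \<kappa> U} = ((`) swap) ` {U \<in> \<Omega>. level \<kappa> (swap ` U)}"
    by blast
  then have "{U \<in> \<Omega>. level \<kappa> U} = ((`) swap) ` {U \<in> \<Omega>. level \<kappa> (swap ` U)}"
    by (simp only: bij_betw_imp_surj_on[OF bij])
  also have "{U \<in> \<Omega>. level \<kappa> (swap ` U)} = {U \<in> \<Omega>. level (\<ominus> \<kappa>) U}"
    using level_swap \<kappa> by blast
  finally have "{U \<in> \<Omega>. level \<kappa> U} = ((`) swap) ` {U \<in> \<Omega>. level (\<ominus> \<kappa>) U}" .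
  moreover have "inj_on ((`) swap) {U \<in> \<Omega>. level (\<ominus> \<kappa>) U}"
    by (rule inj_on_subset[OF bij_betw_imp_inj_on[OF bij]]) blast
  ultimately show ?thesis
    by (simp add: card_image)
qed

text \<open>The truncated subtraction is exact, since at most 1 is taken from at least 1; the
  possible values are 0, 1 and 2.\<close>

definition mult :: "'a \<Rightarrow> 'v set \<Rightarrow> nat" where
  "mult \<kappa> U = 1 + of_bool (level \<kappa> U) - of_bool (level (\<ominus> \<kappa>) U)"

text \<open>Serves both for the set of all isotropic points and for a single line.\<close>

lemma sum_mult:
  assumes fin: "finite S"
    and card: "card {U \<in> S. level (\<ominus> \<kappa>) U} = card {U \<in> S. level \<kappa> U}"
  shows "(\<Sum>U\<in>S. mult \<kappa> U) = card S"
proof -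
  have sum_of_bool: "(\<Sum>U\<in>S. of_bool (P U)) = card {U \<in> S. P U}" for P
    using fin by (simp add: Collect_conj_eq)
  \<comment> \<open>The subtracted term is added back, which leaves an identity between sums of
    natural numbers.\<close>
  have "(\<Sum>U\<in>S. mult \<kappa> U + of_bool (level (\<ominus> \<kappa>) U)) = (\<Sum>U\<in>S. 1 + of_bool (level \<kappa> U))"
    by (rule sum.cong) (auto simp: mult_def)
  then show ?thesis
    by (simp only: sum.distrib sum_of_bool card card_eq_sum[of S])
qed

lemma card_line:
  assumes "isotropic_pair v y"
  shows "card (line v y) = card (carrier K) + 1"
proof -
  have "card (line v y) = card (insert None (Some ` carrier K))"
    unfolding line_eq[OF assms] by (rule card_image[OF inj_on_line_point[OF assms]])
  then show ?thesis
    using finite_carrier by (simp add: card_image)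
qed

lemma line_subset_\<Omega>:
  assumes "isotropic_pair v y"
  shows "line v y \<subseteq> \<Omega>"
proof -
  note D = isotropic_pairD[OF assms]
  have "h x x = \<zero>" "x \<in> carrier V" if "x \<in> span2 v y" for x
    using that D by (auto simp: span2_def)
  then show ?thesis
    by (auto simp: line_def \<Omega>_eq)
qed

text \<open>By this, each translate of \<open>Y\<close> is again a totally isotropic line, to which
  \<open>card_line_level\<close> applies.\<close>

lemma semisimilarity_line:
  assumes g: "semisimilarity K V h g" and vy: "isotropic_pair v y"
  shows "isotropic_pair (g v) (g y)" "((`) g) ` line v y = line (g v) (g y)"
proof -
  note D = isotropic_pairD[OF vy] and gD = semisimilarity_facts[OF g]
  have span: "x \<in> carrier V" if "x \<in> span2 v y" for x
    using that D by (auto simp: span2_def)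
  have zero: "g \<zero>\<^bsub>V\<^esub> = \<zero>\<^bsub>V\<^esub>" using gD(4)[of "\<zero>\<^bsub>V\<^esub>"] by simp
  have "g v \<noteq> c \<odot>\<^bsub>V\<^esub> g y" if c: "c \<in> carrier K" for c
  proof
    assume "g v = c \<odot>\<^bsub>V\<^esub> g y"
    then have "g v \<in> pt (g y)"
      using c by (auto simp: pt_def)
    then have "g v \<in> g ` pt y"
      by (simp only: gD(6)[OF D(2)])
    then obtain d where "d \<in> carrier K" "g v = g (d \<odot>\<^bsub>V\<^esub> y)"
      by (auto simp: pt_def)
    then show False
      using inj_onD[OF gD(1), of v "d \<odot>\<^bsub>V\<^esub> y"] D(1,2,8) by auto
  qed
  then show "isotropic_pair (g v) (g y)"
    using D gD(3-5) by (simp add: isotropic_pair_def)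
  have "((`) g) ` line v y = (\<lambda>x. pt (g x)) ` (span2 v y - {\<zero>\<^bsub>V\<^esub>})"
    unfolding line_def image_image
    by (rule image_cong[OF refl]) (use gD(6) span in blast)
  also have "\<dots> = pt ` (g ` (span2 v y - {\<zero>\<^bsub>V\<^esub>}))"
    by (simp add: image_image)
  also have "g ` (span2 v y - {\<zero>\<^bsub>V\<^esub>}) = g ` span2 v y - {\<zero>\<^bsub>V\<^esub>}"
    using inj_on_image_set_diff[OF gD(1), of "span2 v y" "{\<zero>\<^bsub>V\<^esub>}"] span zero by auto
  also have "g ` span2 v y = span2 (g v) (g y)"
    by (rule gD(7)[OF D(1,2)])
  finally show "((`) g) ` line v y = line (g v) (g y)"
    by (simp add: line_def)
qed

lemma e1_e3: "isotropic_pair e1 e3"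
proof -
  have "e1 \<noteq> c \<odot>\<^bsub>V\<^esub> e3" if "c \<in> carrier K" for c
  proof
    assume "e1 = c \<odot>\<^bsub>V\<^esub> e3"
    then have "h e1 e2 = h (c \<odot>\<^bsub>V\<^esub> e3) e2" by simp
    then show False using that by simp
  qed
  moreover have "e3 \<noteq> \<zero>\<^bsub>V\<^esub>"
  proof
    assume "e3 = \<zero>\<^bsub>V\<^esub>"
    then have "h e3 e4 = \<zero>" by simp
    then show False by simp
  qed
  ultimately show ?thesis by (simp add: isotropic_pair_def)
qed

lemma pt_e2_notin_line: "pt e2 \<in> \<Omega>" "pt e2 \<notin> line e1 e3"
proof -
  have "e2 \<noteq> \<zero>\<^bsub>V\<^esub>"
  proof
    assume "e2 = \<zero>\<^bsub>V\<^esub>"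
    then have "h e2 e1 = \<zero>" by simp
    then show False by simp
  qed
  then show "pt e2 \<in> \<Omega>" by (auto simp: \<Omega>_eq)
  show "pt e2 \<notin> line e1 e3"
  proof
    assume "pt e2 \<in> line e1 e3"
    then obtain a b where ab: "a \<in> carrier K" "b \<in> carrier K"
      and "pt e2 = pt (a \<odot>\<^bsub>V\<^esub> e1 \<oplus>\<^bsub>V\<^esub> b \<odot>\<^bsub>V\<^esub> e3)"
      by (auto simp: line_def span2_def)
    then obtain c where c: "c \<in> carrier K" "e2 = c \<odot>\<^bsub>V\<^esub> (a \<odot>\<^bsub>V\<^esub> e1 \<oplus>\<^bsub>V\<^esub> b \<odot>\<^bsub>V\<^esub> e3)"
      using pt_eqD[of e2 "a \<odot>\<^bsub>V\<^esub> e1 \<oplus>\<^bsub>V\<^esub> b \<odot>\<^bsub>V\<^esub> e3"] by auto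
    have "h e2 e1 = h (c \<odot>\<^bsub>V\<^esub> (a \<odot>\<^bsub>V\<^esub> e1 \<oplus>\<^bsub>V\<^esub> b \<odot>\<^bsub>V\<^esub> e3)) e1"
      by (simp only: c(2)[symmetric])
    then show False using ab c(1) by simp
  qed
qed

text \<open>At \<open>e1\<close> both \<open>Nf\<close> and \<open>Qf\<close> vanish; as m > 0, the
  point lies in both level sets and the two contributions cancel.\<close>

lemma mult_e1: "\<kappa> \<in> carrier K \<Longrightarrow> mult \<kappa> (pt e1) = 1"
  using m_pos by (simp add: mult_def level_pt Nf_def Qf_def X_defs two_neq_0 nat_pow_zero)

text \<open>The witness is (1, 1, b, b, 0), with N = cj(b) - b and Q = 1 + b^2. Both N and Q^m are
  negated by \<open>cj\<close>, so their quotient \<kappa> is fixed by it; the point is not in the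
  level set of -\<kappa>, because N differs from -N.\<close>

lemma mult_eq_2_exists:
  "\<exists>\<kappa> \<in> carrier K. \<exists>U \<in> \<Omega>. \<kappa> \<noteq> \<zero> \<and> cj \<kappa> = \<kappa> \<and> mult \<kappa> U = 2"
proof -
  obtain b where b: "b \<in> carrier K" "b \<otimes> cj b = \<ominus> \<one>" "cj b \<noteq> b"
    by (rule norm_minus_one_exists)
  define t where "t = (\<one> \<oplus> b \<otimes> b) [^] m"
  have t: "t \<in> carrier K" "t \<noteq> \<zero>" "cj t = \<ominus> t"
    using one_plus_square_nonsquare[OF b] b(1) by (simp_all add: t_def)
  define N where "N = cj b \<ominus> b"
  have N: "N \<in> carrier K" "N \<noteq> \<zero>" using b diff_neq_0 by (simp_all add: N_def)
  have cN: "cj N = \<ominus> N" using b(1) by (simp add: N_def minus_eq minus_add a_comm)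
  define \<kappa> where "\<kappa> = N \<otimes> inv t"
  have \<kappa>: "\<kappa> \<in> carrier K" using N t by (simp add: \<kappa>_def)
  have \<kappa>t: "\<kappa> \<otimes> t = N" using N t by (simp add: \<kappa>_def m_assoc)
  have "cj \<kappa> \<otimes> \<ominus> t = \<ominus> N"
    using arg_cong[OF \<kappa>t, of cj] cN t \<kappa> by simp
  then have "\<ominus> (cj \<kappa> \<otimes> t) = \<ominus> (\<kappa> \<otimes> t)"
    using \<kappa> t(1) \<kappa>t by (simp add: r_minus)
  then have "cj \<kappa> \<otimes> t = \<kappa> \<otimes> t"
    using \<kappa> t(1) by (metis cj_closed m_closed minus_minus)
  then have c\<kappa>: "cj \<kappa> = \<kappa>" using \<kappa> t m_rcancel[of t "cj \<kappa>" \<kappa>] by simp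
  have \<kappa>0: "\<kappa> \<noteq> \<zero>" using \<kappa>t N t by auto
  define p where "p = vec \<one> \<one> b b \<zero>"
  have p: "p \<in> carrier V" using b by (simp add: p_def)
  have Np: "Nf p = N" using b by (simp add: Nf_def p_def N_def)
  have Qp: "Qf p [^] m = t" using b by (simp add: Qf_def p_def t_def)
  have "p \<noteq> \<zero>\<^bsub>V\<^esub>"
  proof
    assume "p = \<zero>\<^bsub>V\<^esub>"
    then have "h p e2 = \<zero>" by simp
    moreover have "X1 p = \<one>" using b by (simp add: p_def)
    ultimately show False by (simp add: X1_def)
  qed
  \<comment> \<open>The form takes the value 2 + 2 b cj(b) at \<open>p\<close>, which is zero by the
    choice of \<open>b\<close>.\<close>
  moreover have "h p p = \<zero>"
  proof -
    have "h p p = \<one> \<oplus> \<one> \<oplus> b \<otimes> cj b \<oplus> b \<otimes> cj b"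
      unfolding h_coords[OF p p] using b(1) by (simp add: p_def)
    then show ?thesis by (simp add: b(2) a_assoc r_neg2 r_neg)
  qed
  ultimately have "pt p \<in> \<Omega>" using p by (auto simp: \<Omega>_eq)
  moreover have "N \<noteq> \<ominus> \<kappa> \<otimes> t"
  proof
    assume "N = \<ominus> \<kappa> \<otimes> t"
    then have "N = \<ominus> N" using \<kappa> t(1) \<kappa>t by (simp add: l_minus)
    then have "N \<oplus> N = \<zero>" using N(1) by (metis l_neg)
    then show False using two_cancel N by blast
  qed
  then have "mult \<kappa> (pt p) = 2"
    using p \<kappa> \<kappa>t by (simp add: mult_def level_pt Np Qp)
  ultimately show ?thesis using \<kappa> \<kappa>0 c\<kappa> by blast
qed

lemma PGammaU_non_spreading:
  assumes C: "condition_C"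
  shows "non_spreading (PGammaU K V h) \<Omega> (\<lambda>\<pi>. restrict \<pi> \<Omega>)"
proof -
  obtain \<kappa> U where \<kappa>: "\<kappa> \<in> carrier K" "\<kappa> \<noteq> \<zero>" "cj \<kappa> = \<kappa>" and U: "U \<in> \<Omega>" "mult \<kappa> U = 2"
    using mult_eq_2_exists by blast
  define Y where "Y = line e1 e3"
  have Y: "Y \<subseteq> \<Omega>" unfolding Y_def by (rule line_subset_\<Omega>[OF e1_e3])
  have e1: "pt e1 \<in> Y" and e3: "pt e3 \<in> Y" and e13: "pt e1 \<noteq> pt e3"
  proof -
    have "line_point e1 e3 None \<in> Y" "line_point e1 e3 (Some \<zero>) \<in> Y"
      unfolding Y_def line_eq[OF e1_e3] by auto
    moreover have "line_point e1 e3 None \<noteq> line_point e1 e3 (Some \<zero>)"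
      using inj_onD[OF inj_on_line_point[OF e1_e3], of None "Some \<zero>"] by auto
    ultimately show "pt e1 \<in> Y" "pt e3 \<in> Y" "pt e1 \<noteq> pt e3"
      by (auto simp: line_point_def)
  qed
  \<comment> \<open>The values 1 at \<open>pt e1\<close> and 2 at \<open>U\<close> exclude both a
    constant and a support of one point.\<close>
  have "\<not> trivial_multiset_on \<Omega> (mult \<kappa>)"
  proof -
    have m1: "mult \<kappa> (pt e1) = 1" "pt e1 \<in> \<Omega>"
      using mult_e1 \<kappa> e1 Y by auto
    show ?thesis
    proof
      assume "trivial_multiset_on \<Omega> (mult \<kappa>)"
      then consider c where "\<forall>i \<in> \<Omega>. mult \<kappa> i = c" | "\<exists>!i. i \<in> \<Omega> \<and> mult \<kappa> i \<noteq> 0"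
        by (auto simp: trivial_multiset_on_def)
      then show False
      proof cases
        case 1
        then show False using m1 U by fastforce
      next
        case 2
        moreover have "mult \<kappa> (pt e1) \<noteq> 0" "mult \<kappa> U \<noteq> 0" using m1 U by simp_all
        ultimately have "pt e1 = U" using m1 U by blast
        then show False using m1 U by simp
      qed
    qed
  qed
  \<comment> \<open>\<open>Y\<close> contains the two points of \<open>e1\<close> and
    \<open>e3\<close> and misses that of \<open>e2\<close>.\<close>
  moreover have "\<not> trivial_multiset_on \<Omega> (indicator Y)"
  proof
    assume "trivial_multiset_on \<Omega> (indicator Y)"
    then consider c where "\<forall>i \<in> \<Omega>. indicator Y i = (c :: nat)"
      | "\<exists>!i. i \<in> \<Omega> \<and> indicator Y i \<noteq> (0 :: nat)"
      unfolding trivial_multiset_on_def by blast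
    then show False
    proof cases
      case 1
      have "indicator Y (pt e2) = (0 :: nat)" "indicator Y (pt e1) = (1 :: nat)"
        using pt_e2_notin_line e1 by (simp_all add: Y_def)
      then show False using 1 pt_e2_notin_line(1) e1 Y by (metis subsetD zero_neq_one)
    next
      case 2
      have "indicator Y (pt e1) \<noteq> (0 :: nat)" "indicator Y (pt e3) \<noteq> (0 :: nat)"
        using e1 e3 by simp_all
      then show False using 2 e1 e3 e13 Y by blast
    qed
  qed
  moreover have "(\<Sum>i\<in>\<Omega>. mult \<kappa> i) dvd card \<Omega>"
    using sum_mult[OF finite_\<Omega> card_\<Omega>_level[OF \<kappa>(1)]] by simp
  \<comment> \<open>The constant is the number q^2 + 1 of points on a line: the translate of
    \<open>Y\<close> is a line, on which the two level sets contribute equally with opposite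
    signs.\<close>
  moreover have "(\<Sum>i\<in>\<Omega>. mult \<kappa> i * indicator (restrict \<pi> \<Omega> ` Y) i) = card (carrier K) + 1"
    if \<pi>G: "\<pi> \<in> carrier (PGammaU K V h)" for \<pi>
  proof -
    obtain g where g: "semisimilarity K V h g" and \<pi>: "\<pi> = point_map g"
      using \<pi>G unfolding carrier_PGammaU by blast
    have "restrict \<pi> \<Omega> ` Y = ((`) g) ` Y"
      using Y \<Omega>_subset by (intro image_cong refl) (auto simp: \<pi> point_map_def)
    also have "\<dots> = line (g e1) (g e3)"
      unfolding Y_def by (rule semisimilarity_line(2)[OF g e1_e3])
    finally have img: "restrict \<pi> \<Omega> ` Y = line (g e1) (g e3)" .
    have ge: "isotropic_pair (g e1) (g e3)"
      by (rule semisimilarity_line(1)[OF g e1_e3])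
    note sub = line_subset_\<Omega>[OF ge]
    have "(\<Sum>i\<in>\<Omega>. mult \<kappa> i * indicator (line (g e1) (g e3)) i) = (\<Sum>i\<in>line (g e1) (g e3). mult \<kappa> i)"
      using finite_\<Omega> sub by (simp add: Int_absorb1 flip: sum.inter_restrict[where g = "mult \<kappa>"] add: indicator_def if_distrib[where f = "\<lambda>x. _ * x"] cong: if_cong)
    also have "\<dots> = card (line (g e1) (g e3))"
      by (rule sum_mult[OF finite_subset[OF sub finite_\<Omega>] card_line_level[OF C \<kappa> ge]])
    also have "\<dots> = card (carrier K) + 1"
      by (rule card_line[OF ge])
    finally show ?thesis by (simp only: img)
  qed
  ultimately show ?thesis
    unfolding non_spreading_def using finite_\<Omega> PGammaU_transitive Y by blast
qed

end

section \<open>The coordinate space and the conclusion\<close>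

lemma coord_space_module:
  assumes "cring K"
  shows "module K (coord_space K n)"
proof -
  interpret cring K by (rule assms)
  have inv: "\<exists>y \<in> {..<n} \<rightarrow>\<^sub>E carrier K. (\<lambda>i\<in>{..<n}. y i \<oplus>\<^bsub>K\<^esub> x i) = (\<lambda>i\<in>{..<n}. \<zero>\<^bsub>K\<^esub>)"
    if "x \<in> {..<n} \<rightarrow>\<^sub>E carrier K" for x
    by (rule bexI[of _ "\<lambda>i\<in>{..<n}. \<ominus>\<^bsub>K\<^esub> x i"]) (use that in \<open>auto simp: fun_eq_iff l_neg PiE_def Pi_def\<close>)
  have "abelian_group (coord_space K n)"
    by (rule abelian_groupI)
      (use inv in \<open>auto simp: coord_space_def fun_eq_iff a_ac PiE_def Pi_def extensional_def\<close>)
  then show ?thesis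
    using assms
    by (intro moduleI)
      (auto simp: coord_space_def fun_eq_iff l_distr r_distr m_assoc PiE_def Pi_def extensional_def)
qed

theorem theorem4p2:
  fixes q :: nat and K :: "'a ring" and h :: "(nat \<Rightarrow> 'a) \<Rightarrow> (nat \<Rightarrow> 'a) \<Rightarrow> 'a"
  assumes "condition_C"
    and "primepow q" and "odd q"
    and "field_of_order K (q\<^sup>2)"
    and "hermitian_form K q (coord_space K 5) h"
    and "nondegenerate K (coord_space K 5) h"
  shows "non_spreading
           (PGammaU K (coord_space K 5) h)
           (isotropic_one_spaces K (coord_space K 5) h)
           (\<lambda>\<pi>. restrict \<pi> (isotropic_one_spaces K (coord_space K 5) h))"
proof -
  have K: "field K" "finite (carrier K)" "card (carrier K) = q\<^sup>2"
    using assms(4) by (simp_all add: field_of_order_def)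
  interpret field K by (rule K)
  interpret V: module K "coord_space K 5"
    by (rule coord_space_module[OF is_cring])
  \<comment> \<open>This count is how the five coordinates enter
    \<open>hermitian_space\<close>.\<close>
  have "card (carrier (coord_space K 5)) = card (carrier K) ^ 5"
    by (simp add: coord_space_def card_PiE)
  then interpret hermitian_space K q "coord_space K 5" h
    using assms K by unfold_locales
  obtain e1 e2 e3 e4 e5 where "hyperbolic_frame K q (coord_space K 5) h e1 e2 e3 e4 e5"
    using hyperbolic_frame_exists by blast
  then show ?thesis
    using assms(1) by (rule hyperbolic_frame.PGammaU_non_spreading)
qed

end
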